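(* Let $\omega\colon\mathbb{R}\to\mathbb{R}$ be even, convex and superlinear. Suppose that an absolutely continuous curve $\gamma(t)=(x(t),y(t))\colon[a,b]\to\mathbb{R}^2$ is such that for almost all $t\in[a,b]$, either $$\limsup_{s\to t}\left|\frac{y(s)-y(t)}{x(s)-x(t)}\right|<\infty$$ or $$\liminf_{s\to t}|x(s)-x(t)|\;\omega\left(\frac{y(s)-y(t)}{x(s)-x(t)}\right)>0,$$ where, when $x(s)-x(t)=0$, the quantity $\left|\frac{y(s)-y(t)}{x(s)-x(t)}\right|$ is taken to be $0$ and the quantity $|x(s)-x(t)|\,\omega\left(\frac{y(s)-y(t)}{x(s)-x(t)}\right)$ is taken to be $\infty$. Then for every Lagrangian $L$ with $L(x,y,p)\ge\omega(p)$ for all $(x,y,p)\in\mathbb{R}^3$, the set $\{\gamma(t):t\in[a,b]\}$ meets the universal singular set of $L$ in a set of linear measure zero.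
   Context: A function $\omega\colon\mathbb{R}\to\mathbb{R}$ is superlinear if $\lim_{|p|\to\infty}\omega(p)/|p|=\infty$. A Lagrangian is a function $L\colon\mathbb{R}^3\to\mathbb{R}$ that is Borel measurable, bounded from below, locally bounded from above, and for which there is a superlinear function $\omega\colon\mathbb{R}\to\mathbb{R}$ with $L(x,y,p)\ge\omega(p)$ for all $(x,y,p)\in\mathbb{R}^3$. $AC[a,b]$ denotes the absolutely continuous real-valued functions on $[a,b]$. For $a<b$ and $u\in AC[a,b]$ put $\mathcal{L}(u;a,b)=\int_a^b L(x,u(x),u'(x))\,dx\in(-\infty,\infty]$, $\mathcal{L}(a,A;b,B)=\inf\{\mathcal{L}(v;a,b):v\in AC[a,b],\ v(a)=A,\ v(b)=B\}$, and define the excess $\mathcal{E}(u;a,b)=\mathcal{L}(u;a,b)-\mathcal{L}(a,u(a);b,u(b))$. A function $u\in C[a,b]$ is a generalized minimizer for $L$ on $[a,b]$ if its restriction to $(a,b)$ is a locally uniform limit of a sequence $u_n\in AC[a_n,b_n]$ with $\mathcal{E}(u_n;a_n,b_n)\to0$ (in particular $\limsup a_n\le a$ and $\liminf b_n\ge b$). The universal singular set of $L$ is the set of all $(x_0,y_0)\in\mathbb{R}^2$ for which there are $a\le x_0\le b$ with $a<b$ and a generalized minimizer $u$ for $L$ on $[a,b]$ such that $u(x_0)=y_0$ and $u$ has infinite derivative ($+\infty$ or $-\infty$; one-sided if $x_0$ is an endpoint) at $x_0$. Linear measure is one-dimensional Hausdorff measure $\mathcal{H}^1$. *)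

theory Defs
  imports "HOL-Analysis.Analysis"
begin

definition superlinear :: "(real \<Rightarrow> real) \<Rightarrow> bool" where
  "superlinear \<omega> \<longleftrightarrow> filterlim (\<lambda>p. \<omega> p / \<bar>p\<bar>) at_top at_infinity"

definition lagrangian :: "(real \<times> real \<times> real \<Rightarrow> real) \<Rightarrow> bool" where
  "lagrangian L \<longleftrightarrow>
     L \<in> borel_measurable borel \<and>
     bdd_below (range L) \<and>
     (\<forall>z. \<exists>U. open U \<and> z \<in> U \<and> bdd_above (L ` U)) \<and>
     (\<exists>\<omega>. superlinear \<omega> \<and> (\<forall>x y p. L (x, y, p) \<ge> \<omega> p))"

(* The pairs (s i, t i), i < n, are the endpoints of finitely many non-overlapping
   subintervals of [a, b]. The codomain is a metric space so that the notion covers both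
   real functions and plane curves. *)
definition abs_continuous :: "real \<Rightarrow> real \<Rightarrow> (real \<Rightarrow> 'a::metric_space) \<Rightarrow> bool" where
  "abs_continuous a b f \<longleftrightarrow>
     (\<forall>\<epsilon>>0. \<exists>\<delta>>0. \<forall>(n::nat) s t.
        (\<forall>i<n. a \<le> s i \<and> s i \<le> t i \<and> t i \<le> b) \<longrightarrow>
        disjoint_family_on (\<lambda>i. {s i<..<t i}) {..<n} \<longrightarrow>
        (\<Sum>i<n. t i - s i) < \<delta> \<longrightarrow>
        (\<Sum>i<n. dist (f (s i)) (f (t i))) < \<epsilon>)"

(* The integral of L(x, u(x), u'(x)) as an extended real: positive part minus negative part.
   The second term is finite whenever L is bounded below. The open interval makes the value
   independent of u outside [a, b]; deriv is a fixed junk value where u is not differentiable,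
   which is a null set for absolutely continuous u. *)
definition action :: "(real \<times> real \<times> real \<Rightarrow> real) \<Rightarrow> (real \<Rightarrow> real) \<Rightarrow> real \<Rightarrow> real \<Rightarrow> ereal" where
  "action L u a b =
     enn2ereal (\<integral>\<^sup>+x\<in>{a<..<b}. ennreal (L (x, u x, deriv u x)) \<partial>lborel)
   - enn2ereal (\<integral>\<^sup>+x\<in>{a<..<b}. ennreal (- L (x, u x, deriv u x)) \<partial>lborel)"

definition min_action :: "(real \<times> real \<times> real \<Rightarrow> real) \<Rightarrow> real \<Rightarrow> real \<Rightarrow> real \<Rightarrow> real \<Rightarrow> ereal" where
  "min_action L a A b B =
     (INF v \<in> {v :: real \<Rightarrow> real. abs_continuous a b v \<and> v a = A \<and> v b = B}. action L v a b)"

definition excess :: "(real \<times> real \<times> real \<Rightarrow> real) \<Rightarrow> (real \<Rightarrow> real) \<Rightarrow> real \<Rightarrow> real \<Rightarrow> ereal" where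
  "excess L u a b = action L u a b - min_action L a (u a) b (u b)"

(* Locally uniform convergence on (a, b) includes that the domains [\<alpha> n, \<beta> n] eventually
   contain a neighbourhood of each point; by compactness, limsup \<alpha> \<le> a and liminf \<beta> \<ge> b. *)
definition generalized_minimizer ::
    "(real \<times> real \<times> real \<Rightarrow> real) \<Rightarrow> real \<Rightarrow> real \<Rightarrow> (real \<Rightarrow> real) \<Rightarrow> bool" where
  "generalized_minimizer L a b u \<longleftrightarrow>
     continuous_on {a..b} u \<and>
     (\<exists>(\<alpha> :: nat \<Rightarrow> real) \<beta> (v :: nat \<Rightarrow> real \<Rightarrow> real).
        (\<forall>n. \<alpha> n < \<beta> n \<and> abs_continuous (\<alpha> n) (\<beta> n) (v n)) \<and>
        (\<lambda>n. excess L (v n) (\<alpha> n) (\<beta> n)) \<longlonglongrightarrow> 0 \<and>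
        (\<forall>x\<in>{a<..<b}. \<exists>d>0. cball x d \<subseteq> {a<..<b} \<and>
           (\<forall>\<^sub>F n in sequentially. cball x d \<subseteq> {\<alpha> n..\<beta> n}) \<and>
           uniform_limit (cball x d) v u sequentially))"

(* The filter "at x0 within {a..b}" is one-sided when x0 is an endpoint. *)
definition universal_singular_set :: "(real \<times> real \<times> real \<Rightarrow> real) \<Rightarrow> (real \<times> real) set" where
  "universal_singular_set L =
     {(x0, y0). \<exists>a b u. a < b \<and> a \<le> x0 \<and> x0 \<le> b \<and>
        generalized_minimizer L a b u \<and> u x0 = y0 \<and>
        (filterlim (\<lambda>x. (u x - u x0) / (x - x0)) at_top (at x0 within {a..b}) \<or>
         filterlim (\<lambda>x. (u x - u x0) / (x - x0)) at_bot (at x0 within {a..b}))}"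

(* One-dimensional Hausdorff (outer) measure. Boundedness of the covering sets is required
   because diameter is not meaningful for unbounded sets. *)
definition linear_measure :: "'a::metric_space set \<Rightarrow> ennreal" where
  "linear_measure S =
     (SUP \<delta>\<in>{0<..}. INF C \<in> {C :: nat \<Rightarrow> 'a set. S \<subseteq> (\<Union>i. C i) \<and>
                                 (\<forall>i. bounded (C i) \<and> diameter (C i) \<le> \<delta>)}.
        (\<Sum>i. ennreal (diameter (C i))))"

end

theory Submission
  imports Defs
begin

text \<open>Subtracting \<open>\<omega> 0\<close> from \<open>\<omega>\<close> and \<open>L\<close> gives a nonnegative even convex growth function \<open>w\<close> and a
nonnegative Lagrangian \<open>\<Lambda>\<close>; the excess of a function does not change. After a reflection in the
coordinate axes a singular point \<open>z0 = (x0, y0)\<close> lies on the graph of a limit \<open>u\<close> of near-minimizers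
whose right derivative at \<open>x0\<close> is \<open>+\<infinity>\<close>.

Fix a target \<open>Z = (X, Y)\<close> with rational coordinates, slightly to the right of \<open>z0\<close> and above the graph
of \<open>u\<close>, and let \<open>f z\<close> be the least energy of a path from \<open>z\<close> to \<open>Z\<close> that never drops below its
starting height. Superlinear growth makes a steep climb expensive: the energy per unit of height
tends to infinity with the slope, by Jensen's inequality (\<open>energy_ge\<close>, \<open>steep_rise_cost\<close>), whereas
\<open>\<Lambda>\<close> is locally bounded, so a segment of bounded slope costs a constant times its length. A nearly
optimal path from \<open>z0\<close> either climbs about as steeply as \<open>u\<close>, or runs below \<open>u\<close> and crosses it
later; in the second case a near-minimizer close to \<open>u\<close> does the climbing at no essential extra
cost (\<open>splice_dichotomy\<close>, \<open>cheap_tail\<close>). Either way the part of the path below the height \<open>y0 + \<Delta>\<close>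
costs at least \<open>K * \<Delta>\<close>, for every \<open>K\<close> once \<open>\<Delta>\<close> is small. A point \<open>z\<close> at distance of order \<open>\<Delta>\<close> from
\<open>z0\<close> that reaches the remaining part of the path by a segment of bounded slope saves this cost,
hence \<open>f z \<le> f z0 - K * dist z z0\<close> (\<open>value_fn_descent\<close>).

Such a drop of a real function, for every \<open>K\<close> and on one fixed side with respect to a coordinate, is
possible only on a null set (\<open>content1_zero_of_descent\<close>): the inverse of \<open>f\<close> is locally Lipschitz with
one-sided derivative zero, so a theorem of Sard's kind applies. There are only countably many targets.

It remains to find the points \<open>z\<close>. At parameters where the first alternative holds, and near which the
first coordinate is not constant, the curve splits into countably many graphs of Lipschitz functions
of this coordinate; the points of the graph to the left of \<open>z0\<close> are suitable, since they have time to
climb at bounded slope (\<open>content1_singular_lipschitz_graph\<close>). At the other parameters it splits into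
steep graphs over the second coordinate. There \<open>z\<close> is chosen above \<open>z0\<close> and moves horizontally to the
right; this reaches the path unless the path has climbed faster than the graph itself, which would
cost \<open>\<bar>\<Delta>x\<bar> * w (\<Delta>y / \<Delta>x)\<close>. This quantity is only known to be bounded below by a positive constant,
but the bound improves by chaining: at almost every height the graph has points in between on all
small scales (\<open>gaps_small_almost_everywhere\<close>), and by convexity a chain of many short hops is far
steeper than its hops are known to be, so that the cost tends to infinity (\<open>steepness_upgrade\<close>) and
exceeds the total energy of the path (\<open>content1_singular_steep_graph\<close>).

Null sets of parameters do not matter since an absolutely continuous curve maps them to null sets
(\<open>content1_abs_continuous_null\<close>). Throughout, the energy of an absolutely continuous function is
controlled by its increments because such a function is the integral of its derivative
(\<open>abs_continuous_derivative\<close>).\<close>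

section \<open>Absolutely continuous functions\<close>

text \<open>The intervals are the components of the set. When there are only finitely many, the enumeration is
padded with the empty interval \<open>{a<..<a}\<close>.\<close>

lemma bounded_open_real_disjoint_intervals:
  fixes U :: "real set"
  assumes "open U" "U \<subseteq> {a<..<b}"
  shows "\<exists>s t :: nat \<Rightarrow> real. (\<forall>i. s i \<le> t i) \<and> (\<forall>i. s i < t i \<longrightarrow> a \<le> s i \<and> t i \<le> b) \<and>
    disjoint_family (\<lambda>i. {s i<..<t i}) \<and> U = (\<Union>i. {s i<..<t i})"
proof -
  define C where "C = components U"
  have cC: "countable C"
    unfolding C_def using assms(1)
    using pairwise_disjoint_components[of U]
    by (intro countable_disjoint_open_subsets) (auto intro: open_components simp: disjnt_def pairwise_def disjoint_def)
  have comp: "c = {Inf c<..<Sup c} \<and> Inf c < Sup c \<and> a \<le> Inf c \<and> Sup c \<le> b" if "c \<in> C" for c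
  proof -
    have o: "open c" using that assms(1) C_def open_components by auto
    have ne: "c \<noteq> {}" using that C_def in_components_nonempty by auto
    have con: "connected c" using that C_def in_components_connected by auto
    have sub: "c \<subseteq> {a<..<b}" using that assms(2) C_def in_components_subset by blast
    have bd: "bdd_below c" "bdd_above c"
      using sub by (meson bdd_below_Ioo bdd_above_Ioo bdd_below_mono bdd_above_mono)+
    have lo: "Inf c < x" if "x \<in> c" for x
    proof -
      obtain e where "e > 0" "ball x e \<subseteq> c" using o \<open>x \<in> c\<close> openE by blast
      then have "x - e/2 \<in> c" by (auto simp: dist_real_def)
      then show ?thesis using cInf_lower[OF _ bd(1)] \<open>e > 0\<close> by fastforce
    qed
    have hi: "x < Sup c" if "x \<in> c" for x
    proof -
      obtain e where "e > 0" "ball x e \<subseteq> c" using o \<open>x \<in> c\<close> openE by blast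
      then have "x + e/2 \<in> c" by (auto simp: dist_real_def)
      then show ?thesis using cSup_upper[OF _ bd(2)] \<open>e > 0\<close> by fastforce
    qed
    have "x \<in> c" if x: "Inf c < x" "x < Sup c" for x
    proof -
      obtain p where p: "p \<in> c" "p < x" using x(1) cInf_lessD[OF ne] by blast
      obtain q where q: "q \<in> c" "x < q" using x(2) less_cSupD[OF ne] by blast
      show ?thesis using con p q unfolding connected_iff_interval by (meson less_imp_le)
    qed
    with lo hi have "c = {Inf c<..<Sup c}" by auto
    moreover have "Inf c < Sup c" using ne lo hi by (meson all_not_in_conv less_trans)
    moreover have "a \<le> Inf c" "Sup c \<le> b"
      using sub ne by (auto intro!: cInf_greatest cSup_least)
    ultimately show ?thesis by auto
  qed
  define J where "J = to_nat_on C ` C"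
  define s where "s i = (if i \<in> J then Inf (from_nat_into C i) else a)" for i
  define t where "t i = (if i \<in> J then Sup (from_nat_into C i) else a)" for i
  have inC: "from_nat_into C i \<in> C" if "i \<in> J" for i
    using that cC unfolding J_def by auto
  have I: "{s i<..<t i} = (if i \<in> J then from_nat_into C i else {})" for i
    using comp[OF inC, of i] by (auto simp: s_def t_def)
  show ?thesis
  proof (rule exI[of _ s], rule exI[of _ t], intro conjI allI impI)
    show "s i \<le> t i" for i using comp[OF inC, of i] by (auto simp: s_def t_def)
    show "a \<le> s i" "t i \<le> b" if "s i < t i" for i
      using that comp[OF inC, of i] by (auto simp: s_def t_def split: if_splits)
    show "disjoint_family (\<lambda>i. {s i<..<t i})"
    proof (unfold disjoint_family_on_def I, intro ballI impI)
      fix i j :: nat assume "i \<noteq> j"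
      have "from_nat_into C i \<noteq> from_nat_into C j" if "i \<in> J" "j \<in> J"
      proof -
        obtain c d where "c \<in> C" "i = to_nat_on C c" "d \<in> C" "j = to_nat_on C d"
          using \<open>i \<in> J\<close> \<open>j \<in> J\<close> unfolding J_def by blast
        then show ?thesis using cC \<open>i \<noteq> j\<close> by auto
      qed
      then show "(if i \<in> J then from_nat_into C i else {}) \<inter> (if j \<in> J then from_nat_into C j else {}) = {}"
        using inC components_nonoverlap[of "from_nat_into C i" U "from_nat_into C j"]
        by (auto simp: C_def)
    qed
    have "(\<Union>i. {s i<..<t i}) = \<Union>C"
    proof (unfold I, intro set_eqI iffI)
      fix x assume "x \<in> (\<Union>i. if i \<in> J then from_nat_into C i else {})"
      then show "x \<in> \<Union>C" using inC by (auto split: if_splits)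
    next
      fix x assume "x \<in> \<Union>C"
      then obtain c where "c \<in> C" "x \<in> c" by auto
      then have "x \<in> (if to_nat_on C c \<in> J then from_nat_into C (to_nat_on C c) else {})"
        using cC by (auto simp: J_def)
      then show "x \<in> (\<Union>i. if i \<in> J then from_nat_into C i else {})" by blast
    qed
    then show "U = (\<Union>i. {s i<..<t i})" using Union_components C_def by metis
  qed
qed

text \<open>Finite families indexed by pairs occur below, when every interval of a family is subdivided.\<close>

lemma abs_continuousD:
  fixes f :: "real \<Rightarrow> 'a::metric_space"
  assumes "abs_continuous a b f" "\<epsilon> > 0"
  shows "\<exists>\<delta>>0. \<forall>(I::'i set) s t. finite I \<longrightarrow> (\<forall>i\<in>I. a \<le> s i \<and> s i \<le> t i \<and> t i \<le> b) \<longrightarrow>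
        disjoint_family_on (\<lambda>i. {s i<..<t i}) I \<longrightarrow> (\<Sum>i\<in>I. t i - s i) < \<delta> \<longrightarrow>
        (\<Sum>i\<in>I. dist (f (s i)) (f (t i))) < \<epsilon>"
proof -
  obtain \<delta> where \<delta>: "\<delta> > 0" and
    D: "\<And>(n::nat) s t. (\<forall>i<n. a \<le> s i \<and> s i \<le> t i \<and> t i \<le> b) \<Longrightarrow>
        disjoint_family_on (\<lambda>i. {s i<..<t i}) {..<n} \<Longrightarrow>
        (\<Sum>i<n. t i - s i) < \<delta> \<Longrightarrow> (\<Sum>i<n. dist (f (s i)) (f (t i))) < \<epsilon>"
    using assms unfolding abs_continuous_def by meson
  show ?thesis
  proof (intro exI[of _ \<delta>] conjI allI impI, fact \<delta>)
    fix I :: "'i set" and s t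
    assume fin: "finite I" and st: "\<forall>i\<in>I. a \<le> s i \<and> s i \<le> t i \<and> t i \<le> b"
      and dj: "disjoint_family_on (\<lambda>i. {s i<..<t i}) I" and len: "(\<Sum>i\<in>I. t i - s i) < \<delta>"
    obtain h where h: "bij_betw h {..<card I} I"
      using ex_bij_betw_nat_finite[OF fin] by (auto simp: atLeast0LessThan)
    have "(\<Sum>i<card I. dist (f (s (h i))) (f (t (h i)))) < \<epsilon>"
    proof (rule D)
      show "\<forall>i<card I. a \<le> s (h i) \<and> s (h i) \<le> t (h i) \<and> t (h i) \<le> b"
        using st bij_betwE[OF h] by auto
      show "disjoint_family_on (\<lambda>i. {s (h i)<..<t (h i)}) {..<card I}"
        unfolding disjoint_family_on_def
      proof (intro ballI impI)
        fix i j assume "i \<in> {..<card I}" "j \<in> {..<card I}" "i \<noteq> j"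
        then have "h i \<in> I" "h j \<in> I" "h i \<noteq> h j"
          using bij_betwE[OF h] bij_betw_imp_inj_on[OF h] by (auto dest: inj_onD)
        then show "{s (h i)<..<t (h i)} \<inter> {s (h j)<..<t (h j)} = {}"
          using dj by (auto simp: disjoint_family_on_def)
      qed
      show "(\<Sum>i<card I. t (h i) - s (h i)) < \<delta>"
        using len sum.reindex_bij_betw[OF h, of "\<lambda>i. t i - s i"] by simp
    qed
    then show "(\<Sum>i\<in>I. dist (f (s i)) (f (t i))) < \<epsilon>"
      using sum.reindex_bij_betw[OF h, of "\<lambda>i. dist (f (s i)) (f (t i))"] by simp
  qed
qed

lemma abs_continuous_subinterval:
  assumes "abs_continuous a b f" "a \<le> c" "d \<le> b"
  shows "abs_continuous c d f"
  unfolding abs_continuous_def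
proof (intro allI impI)
  fix \<epsilon> :: real assume "\<epsilon> > 0"
  then obtain \<delta> where "\<delta> > 0" and
    D: "\<And>(n::nat) s t. (\<forall>i<n. a \<le> s i \<and> s i \<le> t i \<and> t i \<le> b) \<Longrightarrow>
        disjoint_family_on (\<lambda>i. {s i<..<t i}) {..<n} \<Longrightarrow>
        (\<Sum>i<n. t i - s i) < \<delta> \<Longrightarrow> (\<Sum>i<n. dist (f (s i)) (f (t i))) < \<epsilon>"
    using assms unfolding abs_continuous_def by meson
  then show "\<exists>\<delta>>0. \<forall>(n::nat) s t. (\<forall>i<n. c \<le> s i \<and> s i \<le> t i \<and> t i \<le> d) \<longrightarrow>
        disjoint_family_on (\<lambda>i. {s i<..<t i}) {..<n} \<longrightarrow>
        (\<Sum>i<n. t i - s i) < \<delta> \<longrightarrow> (\<Sum>i<n. dist (f (s i)) (f (t i))) < \<epsilon>"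
    using assms(2,3) by (intro exI[of _ \<delta>]) (meson order_trans)
qed

lemma disjoint_family_clamp:
  fixes s t :: "'i \<Rightarrow> real"
  assumes "disjoint_family_on (\<lambda>i. {s i<..<t i}) I"
  shows "disjoint_family_on (\<lambda>i. {min (s i) c<..<min (t i) c}) I"
    and "disjoint_family_on (\<lambda>i. {max (s i) c<..<max (t i) c}) I"
proof -
  have sub: "{min (s i) c<..<min (t i) c} \<subseteq> {s i<..<t i}" "{max (s i) c<..<max (t i) c} \<subseteq> {s i<..<t i}" for i
    by auto
  show "disjoint_family_on (\<lambda>i. {min (s i) c<..<min (t i) c}) I"
    using assms sub(1) unfolding disjoint_family_on_def by blast
  show "disjoint_family_on (\<lambda>i. {max (s i) c<..<max (t i) c}) I"
    using assms sub(2) unfolding disjoint_family_on_def by blast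
qed

lemma abs_continuous_lipschitz_compose:
  fixes f :: "real \<Rightarrow> 'a::metric_space" and h :: "real \<Rightarrow> 'b::metric_space"
  assumes f: "abs_continuous a b f"
    and h: "\<And>s t. a \<le> s \<Longrightarrow> s \<le> t \<Longrightarrow> t \<le> b \<Longrightarrow> dist (h s) (h t) \<le> B * dist (f s) (f t)"
  shows "abs_continuous a b h"
  unfolding abs_continuous_def
proof (intro allI impI)
  fix \<epsilon> :: real assume "\<epsilon> > 0"
  define B' where "B' = max B 1"
  have B': "B' > 0" "B \<le> B'" by (auto simp: B'_def)
  have "\<epsilon> / B' > 0" using \<open>\<epsilon> > 0\<close> B' by simp
  then obtain \<delta> where "\<delta> > 0" and
    D: "\<And>(n::nat) s t. (\<forall>i<n. a \<le> s i \<and> s i \<le> t i \<and> t i \<le> b) \<Longrightarrow>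
        disjoint_family_on (\<lambda>i. {s i<..<t i}) {..<n} \<Longrightarrow>
        (\<Sum>i<n. t i - s i) < \<delta> \<Longrightarrow> (\<Sum>i<n. dist (f (s i)) (f (t i))) < \<epsilon>/B'"
    using f unfolding abs_continuous_def by meson
  show "\<exists>\<delta>>0. \<forall>(n::nat) s t. (\<forall>i<n. a \<le> s i \<and> s i \<le> t i \<and> t i \<le> b) \<longrightarrow>
        disjoint_family_on (\<lambda>i. {s i<..<t i}) {..<n} \<longrightarrow>
        (\<Sum>i<n. t i - s i) < \<delta> \<longrightarrow> (\<Sum>i<n. dist (h (s i)) (h (t i))) < \<epsilon>"
  proof (intro exI[of _ \<delta>] conjI allI impI)
    fix n :: nat and s t
    assume *: "\<forall>i<n. a \<le> s i \<and> s i \<le> t i \<and> t i \<le> b"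
      "disjoint_family_on (\<lambda>i. {s i<..<t i}) {..<n}" "(\<Sum>i<n. t i - s i) < \<delta>"
    have "(\<Sum>i<n. dist (h (s i)) (h (t i))) \<le> (\<Sum>i<n. B' * dist (f (s i)) (f (t i)))"
      using * B' by (intro sum_mono order_trans[OF h] mult_right_mono) auto
    also have "\<dots> = B' * (\<Sum>i<n. dist (f (s i)) (f (t i)))" by (simp add: sum_distrib_left)
    also have "\<dots> < \<epsilon>" using D[OF *] B' by (simp add: field_simps)
    finally show "(\<Sum>i<n. dist (h (s i)) (h (t i))) < \<epsilon>" .
  qed (fact \<open>\<delta> > 0\<close>)
qed

lemma abs_continuous_cong:
  assumes "abs_continuous a b f" "\<And>x. a \<le> x \<Longrightarrow> x \<le> b \<Longrightarrow> f x = g x"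
  shows "abs_continuous a b g"
  by (rule abs_continuous_lipschitz_compose[OF assms(1), of g 1]) (use assms(2) in force)

text \<open>An interval that straddles \<open>c\<close> is cut there, and its two parts are charged to the two pieces.\<close>

lemma abs_continuous_join:
  assumes "abs_continuous a c f" "abs_continuous c b f" "a \<le> c" "c \<le> b"
  shows "abs_continuous a b f"
  unfolding abs_continuous_def
proof (intro allI impI)
  fix \<epsilon> :: real assume "\<epsilon> > 0"
  then have e2: "\<epsilon>/2 > 0" by simp
  obtain d1 where d1: "d1 > 0" and
    D1: "\<And>(n::nat) s t. (\<forall>i<n. a \<le> s i \<and> s i \<le> t i \<and> t i \<le> c) \<Longrightarrow>
        disjoint_family_on (\<lambda>i. {s i<..<t i}) {..<n} \<Longrightarrow>
        (\<Sum>i<n. t i - s i) < d1 \<Longrightarrow> (\<Sum>i<n. dist (f (s i)) (f (t i))) < \<epsilon>/2"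
    using assms(1) e2 unfolding abs_continuous_def by meson
  obtain d2 where d2: "d2 > 0" and
    D2: "\<And>(n::nat) s t. (\<forall>i<n. c \<le> s i \<and> s i \<le> t i \<and> t i \<le> b) \<Longrightarrow>
        disjoint_family_on (\<lambda>i. {s i<..<t i}) {..<n} \<Longrightarrow>
        (\<Sum>i<n. t i - s i) < d2 \<Longrightarrow> (\<Sum>i<n. dist (f (s i)) (f (t i))) < \<epsilon>/2"
    using assms(2) e2 unfolding abs_continuous_def by meson
  show "\<exists>\<delta>>0. \<forall>(n::nat) s t. (\<forall>i<n. a \<le> s i \<and> s i \<le> t i \<and> t i \<le> b) \<longrightarrow>
        disjoint_family_on (\<lambda>i. {s i<..<t i}) {..<n} \<longrightarrow>
        (\<Sum>i<n. t i - s i) < \<delta> \<longrightarrow> (\<Sum>i<n. dist (f (s i)) (f (t i))) < \<epsilon>"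
  proof (intro exI[of _ "min d1 d2"] conjI allI impI)
    fix n :: nat and s t
    assume *: "\<forall>i<n. a \<le> s i \<and> s i \<le> t i \<and> t i \<le> b"
      "disjoint_family_on (\<lambda>i. {s i<..<t i}) {..<n}" "(\<Sum>i<n. t i - s i) < min d1 d2"
    have l1: "(\<Sum>i<n. min (t i) c - min (s i) c) \<le> (\<Sum>i<n. t i - s i)"
      using *(1) by (intro sum_mono) (auto simp: min_def)
    have l2: "(\<Sum>i<n. max (t i) c - max (s i) c) \<le> (\<Sum>i<n. t i - s i)"
      using *(1) by (intro sum_mono) (auto simp: max_def)
    have "(\<Sum>i<n. dist (f (s i)) (f (t i))) \<le>
      (\<Sum>i<n. dist (f (min (s i) c)) (f (min (t i) c))) + (\<Sum>i<n. dist (f (max (s i) c)) (f (max (t i) c)))"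
      unfolding sum.distrib[symmetric]
    proof (intro sum_mono)
      fix i assume "i \<in> {..<n}"
      show "dist (f (s i)) (f (t i)) \<le> dist (f (min (s i) c)) (f (min (t i) c)) + dist (f (max (s i) c)) (f (max (t i) c))"
        using dist_triangle[of "f (s i)" "f (t i)" "f c"] * \<open>i \<in> {..<n}\<close>
        by (auto simp: min_def max_def)
    qed
    also have "\<dots> < \<epsilon>/2 + \<epsilon>/2"
    proof (rule add_strict_mono)
      show "(\<Sum>i<n. dist (f (min (s i) c)) (f (min (t i) c))) < \<epsilon>/2"
      proof (rule D1)
        show "\<forall>i<n. a \<le> min (s i) c \<and> min (s i) c \<le> min (t i) c \<and> min (t i) c \<le> c"
          using *(1) assms(3) by fastforce
        show "(\<Sum>i<n. min (t i) c - min (s i) c) < d1" using l1 *(3) by linarith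
      qed (rule disjoint_family_clamp(1)[OF *(2)])
      show "(\<Sum>i<n. dist (f (max (s i) c)) (f (max (t i) c))) < \<epsilon>/2"
      proof (rule D2)
        show "\<forall>i<n. c \<le> max (s i) c \<and> max (s i) c \<le> max (t i) c \<and> max (t i) c \<le> b"
          using *(1) assms(4) by fastforce
        show "(\<Sum>i<n. max (t i) c - max (s i) c) < d2" using l2 *(3) by linarith
      qed (rule disjoint_family_clamp(2)[OF *(2)])
    qed
    finally show "(\<Sum>i<n. dist (f (s i)) (f (t i))) < \<epsilon>" by simp
  qed (use d1 d2 in auto)
qed

lemma abs_continuous_ident: "abs_continuous a b (\<lambda>x::real. x)"
  unfolding abs_continuous_def
proof (intro allI impI)
  fix \<epsilon> :: real assume "\<epsilon> > 0"
  show "\<exists>\<delta>>0. \<forall>(n::nat) s t. (\<forall>i<n. a \<le> s i \<and> s i \<le> t i \<and> t i \<le> b) \<longrightarrow>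
        disjoint_family_on (\<lambda>i. {s i<..<t i}) {..<n} \<longrightarrow>
        (\<Sum>i<n. t i - s i) < \<delta> \<longrightarrow> (\<Sum>i<n. dist (s i) (t i)) < \<epsilon>"
  proof (intro exI[of _ \<epsilon>] conjI allI impI)
    fix n :: nat and s t :: "nat \<Rightarrow> real"
    assume "\<forall>i<n. a \<le> s i \<and> s i \<le> t i \<and> t i \<le> b" "(\<Sum>i<n. t i - s i) < \<epsilon>"
    moreover have "(\<Sum>i<n. dist (s i) (t i)) = (\<Sum>i<n. t i - s i)"
      using calculation by (intro sum.cong) (auto simp: dist_real_def)
    ultimately show "(\<Sum>i<n. dist (s i) (t i)) < \<epsilon>" by simp
  qed (fact \<open>\<epsilon> > 0\<close>)
qed

lemma abs_continuous_affine: "abs_continuous a b (\<lambda>x::real. p * (x - c) + q)"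
  by (rule abs_continuous_lipschitz_compose[OF abs_continuous_ident, where B="\<bar>p\<bar>"])
     (simp add: dist_real_def abs_mult right_diff_distrib[symmetric])

lemma abs_continuous_imp_continuous_on:
  fixes f :: "real \<Rightarrow> 'a::metric_space"
  assumes "abs_continuous a b f"
  shows "continuous_on {a..b} f"
proof (unfold continuous_on_iff, intro ballI allI impI)
  fix x \<epsilon> :: real assume x: "x \<in> {a..b}" and "\<epsilon> > 0"
  obtain \<delta> where "\<delta> > 0" and
    D: "\<forall>(I::unit set) s t. finite I \<longrightarrow> (\<forall>i\<in>I. a \<le> s i \<and> s i \<le> t i \<and> t i \<le> b) \<longrightarrow>
        disjoint_family_on (\<lambda>i. {s i<..<t i}) I \<longrightarrow> (\<Sum>i\<in>I. t i - s i) < \<delta> \<longrightarrow>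
        (\<Sum>i\<in>I. dist (f (s i)) (f (t i))) < \<epsilon>"
    using abs_continuousD[OF assms \<open>\<epsilon> > 0\<close>] by blast
  show "\<exists>d>0. \<forall>x'\<in>{a..b}. dist x' x < d \<longrightarrow> dist (f x') (f x) < \<epsilon>"
  proof (intro exI[of _ \<delta>] conjI ballI impI)
    fix y assume y: "y \<in> {a..b}" "dist y x < \<delta>"
    have "(\<Sum>i\<in>{()}. dist (f (min x y)) (f (max x y))) < \<epsilon>"
      using x y by (intro D[rule_format]) (auto simp: dist_real_def disjoint_family_on_def min_def max_def)
    then show "dist (f y) (f x) < \<epsilon>" by (auto simp: min_def max_def dist_commute split: if_splits)
  qed (fact \<open>\<delta> > 0\<close>)
qed

text \<open>The weights \<open>m\<close> stand for the measures or the diameters of images of the intervals; an index with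
\<open>t i \<le> s i\<close> belongs to the padding of the enumeration.\<close>

definition small_oscillation :: "(real \<Rightarrow> 'a::metric_space) \<Rightarrow> real \<Rightarrow> (nat \<Rightarrow> real) \<Rightarrow> (nat \<Rightarrow> real) \<Rightarrow> bool" where
  "small_oscillation f \<epsilon> s t \<longleftrightarrow>
     (\<forall>p q m. (\<forall>i. s i < t i \<longrightarrow> s i \<le> p i \<and> p i \<le> q i \<and> q i \<le> t i \<and> m i \<le> ennreal (dist (f (p i)) (f (q i)))) \<longrightarrow>
       (\<forall>i. t i \<le> s i \<longrightarrow> m i = 0) \<longrightarrow> (\<Sum>i. m i) \<le> ennreal \<epsilon>)"

lemma small_oscillationD:
  assumes "small_oscillation f \<epsilon> s t"
    and "\<And>i. s i < t i \<Longrightarrow> s i \<le> p i \<and> p i \<le> q i \<and> q i \<le> t i \<and> m i \<le> ennreal (dist (f (p i)) (f (q i)))"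
    and "\<And>i. t i \<le> s i \<Longrightarrow> m i = 0"
  shows "(\<Sum>i. m i) \<le> ennreal \<epsilon>"
  by (rule assms(1)[unfolded small_oscillation_def, rule_format, where p=p and q=q]) (use assms(2,3) in blast)+

text \<open>The set has an open neighbourhood whose measure is below the \<open>\<delta>\<close> of absolute continuity, and the
intervals are its components.\<close>

lemma abs_continuous_null_cover:
  fixes f :: "real \<Rightarrow> 'a::metric_space"
  assumes ac: "abs_continuous a b f" and N: "N \<in> null_sets lebesgue" and "\<epsilon> > 0"
  shows "\<exists>s t :: nat \<Rightarrow> real. (\<forall>i. s i \<le> t i) \<and> (\<forall>i. s i < t i \<longrightarrow> a \<le> s i \<and> t i \<le> b) \<and>
    disjoint_family (\<lambda>i. {s i<..<t i}) \<and> N \<inter> {a<..<b} \<subseteq> (\<Union>i. {s i<..<t i}) \<and>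
    small_oscillation f \<epsilon> s t"
proof -
  obtain \<delta> where "\<delta> > 0" and
    D: "\<forall>(I::nat set) s t. finite I \<longrightarrow> (\<forall>i\<in>I. a \<le> s i \<and> s i \<le> t i \<and> t i \<le> b) \<longrightarrow>
        disjoint_family_on (\<lambda>i. {s i<..<t i}) I \<longrightarrow> (\<Sum>i\<in>I. t i - s i) < \<delta> \<longrightarrow>
        (\<Sum>i\<in>I. dist (f (s i)) (f (t i))) < \<epsilon>"
    using abs_continuousD[OF ac \<open>\<epsilon> > 0\<close>] by blast
  obtain T where T: "open T" "N \<subseteq> T" "emeasure lebesgue (T - N) < ennreal \<delta>"
    using sets_lebesgue_outer_open[OF _ \<open>\<delta> > 0\<close>] null_setsD2[OF N] by metis
  define U where "U = T \<inter> {a<..<b}"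
  have U: "open U" "U \<subseteq> {a<..<b}" "N \<inter> {a<..<b} \<subseteq> U" using T by (auto simp: U_def)
  have "emeasure lebesgue T = emeasure lebesgue (T - N)"
    using N T(1) by (intro emeasure_Diff_null_set[symmetric]) auto
  then have "emeasure lborel T < ennreal \<delta>" using T by simp
  then have Ul: "emeasure lborel U < ennreal \<delta>"
    using T(1) by (elim le_less_trans[rotated]) (auto simp: U_def intro!: emeasure_mono)
  obtain s t :: "nat \<Rightarrow> real" where st: "\<forall>i. s i \<le> t i" "\<forall>i. s i < t i \<longrightarrow> a \<le> s i \<and> t i \<le> b"
    "disjoint_family (\<lambda>i. {s i<..<t i})" "U = (\<Union>i. {s i<..<t i})"
    using bounded_open_real_disjoint_intervals[OF U(1,2)] by blast
  have "(\<Sum>i. m i) \<le> ennreal \<epsilon>"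
    if pq: "\<forall>i. s i < t i \<longrightarrow> s i \<le> p i \<and> p i \<le> q i \<and> q i \<le> t i \<and> m i \<le> ennreal (dist (f (p i)) (f (q i)))"
      and m0: "\<forall>i. t i \<le> s i \<longrightarrow> m i = 0" for p q and m :: "nat \<Rightarrow> ennreal"
  proof (rule suminf_le_const)
    fix n
    define I where "I = {i. i < n \<and> s i < t i}"
    have "ennreal (\<Sum>i\<in>I. t i - s i) = (\<Sum>i\<in>I. emeasure lborel {s i<..<t i})"
      using st(1) by (subst sum_ennreal[symmetric]) (auto intro!: sum.cong)
    also have "\<dots> = emeasure lborel (\<Union>i\<in>I. {s i<..<t i})"
      using st(3) by (intro sum_emeasure) (auto simp: I_def disjoint_family_on_def)
    also have "\<dots> \<le> emeasure lborel U" unfolding st(4) by (intro emeasure_mono) auto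
    finally have "ennreal (\<Sum>i\<in>I. t i - s i) < ennreal \<delta>" using Ul by simp
    then have len: "(\<Sum>i\<in>I. t i - s i) < \<delta>" by (meson ennreal_leI not_le)
    have sub: "s i \<le> p i" "p i \<le> q i" "q i \<le> t i" "a \<le> s i" "t i \<le> b" "m i \<le> ennreal (dist (f (p i)) (f (q i)))"
      if "i \<in> I" for i
      using pq st(2) that by (auto simp: I_def)
    have "(\<Sum>i\<in>I. dist (f (p i)) (f (q i))) < \<epsilon>"
    proof (rule D[rule_format])
      show "finite I" by (simp add: I_def)
      show "a \<le> p i \<and> p i \<le> q i \<and> q i \<le> b" if "i \<in> I" for i using sub[OF that] by auto
      have "{p i<..<q i} \<subseteq> {s i<..<t i}" if "i \<in> I" for i using sub[OF that] by auto
      then show "disjoint_family_on (\<lambda>i. {p i<..<q i}) I"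
        using st(3) unfolding disjoint_family_on_def by blast
      have "(\<Sum>i\<in>I. q i - p i) \<le> (\<Sum>i\<in>I. t i - s i)"
      proof (rule sum_mono)
        fix i assume "i \<in> I"
        from sub[OF this] show "q i - p i \<le> t i - s i" by auto
      qed
      then show "(\<Sum>i\<in>I. q i - p i) < \<delta>" using len by linarith
    qed
    moreover have "(\<Sum>i<n. m i) = (\<Sum>i\<in>I. m i)"
    proof (rule sum.mono_neutral_right)
      show "\<forall>i\<in>{..<n} - I. m i = 0"
      proof
        fix i assume "i \<in> {..<n} - I"
        then have "t i \<le> s i" by (auto simp: I_def)
        then show "m i = 0" using m0 by blast
      qed
    qed (auto simp: I_def)
    moreover have "(\<Sum>i\<in>I. m i) \<le> (\<Sum>i\<in>I. ennreal (dist (f (p i)) (f (q i))))"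
      by (intro sum_mono sub(6))
    ultimately show "(\<Sum>i<n. m i) \<le> ennreal \<epsilon>" by (simp add: sum_ennreal order_trans[OF _ ennreal_leI])
  qed auto
  then have "small_oscillation f \<epsilon> s t" unfolding small_oscillation_def by blast
  then show ?thesis using st(1-3) U(3) unfolding st(4) by blast
qed

section \<open>Variation and differentiation\<close>

text \<open>The total variation on \<open>{a..x}\<close>. Chains are monotone on all of \<open>nat\<close>, so that clamping a chain to an
interval gives a chain again.\<close>

definition variation :: "(real \<Rightarrow> real) \<Rightarrow> real \<Rightarrow> real \<Rightarrow> real" where
  "variation v a x =
     Sup {\<Sum>i<n. \<bar>v (p (Suc i)) - v (p i)\<bar> |(p::nat \<Rightarrow> real) n. mono p \<and> range p \<subseteq> {a..x}}"

text \<open>This is what makes the variation additive: clamping from above and from below cuts a chain at \<open>c\<close>.\<close>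

lemma chain_sum_clamp:
  fixes v :: "real \<Rightarrow> real"
  assumes "mono p"
  shows "(\<Sum>i<n. \<bar>v (p (Suc i)) - v (p i)\<bar>) \<le>
    (\<Sum>i<n. \<bar>v (min (p (Suc i)) c) - v (min (p i) c)\<bar>) +
    (\<Sum>i<n. \<bar>v (max (p (Suc i)) c) - v (max (p i) c)\<bar>)"
  unfolding sum.distrib[symmetric]
proof (intro sum_mono)
  fix i
  have "p i \<le> p (Suc i)" using assms by (simp add: monoD)
  then show "\<bar>v (p (Suc i)) - v (p i)\<bar> \<le> \<bar>v (min (p (Suc i)) c) - v (min (p i) c)\<bar> +
      \<bar>v (max (p (Suc i)) c) - v (max (p i) c)\<bar>"
    by (auto simp: min_def max_def)
qed

lemma disjoint_family_chain:
  fixes p :: "nat \<Rightarrow> real"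
  assumes "mono p"
  shows "disjoint_family_on (\<lambda>i. {p i<..<p (Suc i)}) I"
  unfolding disjoint_family_on_def
proof (intro ballI impI)
  have *: "{p i<..<p (Suc i)} \<inter> {p j<..<p (Suc j)} = {}" if "i < j" for i j
  proof -
    have "p (Suc i) \<le> p j" using that assms by (simp add: monoD)
    then show ?thesis by auto
  qed
  fix i j :: nat assume "i \<noteq> j"
  then show "{p i<..<p (Suc i)} \<inter> {p j<..<p (Suc j)} = {}"
    using *[of i j] *[of j i] by (cases "i < j") (auto simp: Int_commute)
qed

text \<open>On an interval shorter than the \<open>\<delta>\<close> that belongs to \<open>\<epsilon> = 1\<close> every chain sum is at most one. The
induction is on the number of intervals of length \<open>\<delta> / 2\<close> and cuts off the last one.\<close>

lemma chain_sums_bounded: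
  fixes v :: "real \<Rightarrow> real"
  assumes "abs_continuous a b v"
  obtains B where "\<And>p n. mono p \<Longrightarrow> range p \<subseteq> {a..b} \<Longrightarrow> (\<Sum>i<n. \<bar>v (p (Suc i)) - v (p i)\<bar>) \<le> B"
proof -
  obtain \<delta> where "\<delta> > 0" and
    D: "\<forall>(I::nat set) s t. finite I \<longrightarrow> (\<forall>i\<in>I. a \<le> s i \<and> s i \<le> t i \<and> t i \<le> b) \<longrightarrow>
        disjoint_family_on (\<lambda>i. {s i<..<t i}) I \<longrightarrow> (\<Sum>i\<in>I. t i - s i) < \<delta> \<longrightarrow>
        (\<Sum>i\<in>I. dist (v (s i)) (v (t i))) < 1"
    using abs_continuousD[OF assms, of 1] by auto
  have short: "(\<Sum>i<n. \<bar>v (p (Suc i)) - v (p i)\<bar>) \<le> 1"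
    if p: "mono p" "range p \<subseteq> {a..b}" and c: "range p \<subseteq> {c..d}" "d - c < \<delta>" for p n c d
  proof -
    have "(\<Sum>i\<in>{..<n}. dist (v (p i)) (v (p (Suc i)))) < 1"
    proof (rule D[rule_format])
      show "a \<le> p i \<and> p i \<le> p (Suc i) \<and> p (Suc i) \<le> b" for i
        using p by (auto simp: monoD image_subset_iff)
      have "(\<Sum>i<n. p (Suc i) - p i) = p n - p 0" by (rule sum_lessThan_telescope)
      also have "\<dots> \<le> d - c" using c by (auto simp: image_subset_iff intro: diff_mono)
      finally show "(\<Sum>i<n. p (Suc i) - p i) < \<delta>" using c(2) by simp
    qed (use disjoint_family_chain[OF p(1)] in auto)
    then show ?thesis by (simp add: dist_real_def abs_minus_commute)
  qed
  have "\<forall>c p n. c \<le> b \<longrightarrow> c - a \<le> real k * (\<delta>/2) \<longrightarrow> mono p \<longrightarrow> range p \<subseteq> {a..c} \<longrightarrow>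
      (\<Sum>i<n. \<bar>v (p (Suc i)) - v (p i)\<bar>) \<le> real (k + 1)" for k
  proof (induction k)
    case 0
    show ?case
    proof (intro allI impI)
      fix c and p :: "nat \<Rightarrow> real" and n assume *: "c \<le> b" "c - a \<le> real 0 * (\<delta>/2)" "mono p" "range p \<subseteq> {a..c}"
      then have "range p \<subseteq> {a..b}" by fastforce
      then show "(\<Sum>i<n. \<bar>v (p (Suc i)) - v (p i)\<bar>) \<le> real (0 + 1)"
        using short[of p a c n] * \<open>\<delta> > 0\<close> by auto
    qed
  next
    case (Suc k)
    show ?case
    proof (intro allI impI)
      fix c and p :: "nat \<Rightarrow> real" and n assume *: "c \<le> b" "c - a \<le> real (Suc k) * (\<delta>/2)" "mono p" "range p \<subseteq> {a..c}"
      define c' where "c' = max a (c - \<delta>/2)"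
      have ac: "a \<le> c" using *(4) by force
      have c': "a \<le> c'" "c' \<le> c" "c' - a \<le> real k * (\<delta>/2)" "c - c' < \<delta>"
        using ac *(2) \<open>\<delta> > 0\<close> mult_nonneg_nonneg[of "real k" "\<delta>/2"]
        by (auto simp: c'_def max_def algebra_simps)
      have m1: "mono (\<lambda>i. min (p i) c')" "mono (\<lambda>i. max (p i) c')"
        using *(3) by (auto simp: mono_def min.coboundedI1 max.coboundedI1)
      have r: "range (\<lambda>i. min (p i) c') \<subseteq> {a..c'}" "range (\<lambda>i. max (p i) c') \<subseteq> {c'..c}"
        using *(4) c' by (auto simp: image_subset_iff)
      have "(\<Sum>i<n. \<bar>v (min (p (Suc i)) c') - v (min (p i) c')\<bar>) \<le> real (k + 1)"
        using Suc.IH[rule_format, OF _ c'(3) m1(1) r(1)] c' *(1) by auto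
      moreover have "(\<Sum>i<n. \<bar>v (max (p (Suc i)) c') - v (max (p i) c')\<bar>) \<le> 1"
      proof (rule short[OF m1(2) _ r(2) c'(4)])
        show "range (\<lambda>i. max (p i) c') \<subseteq> {a..b}" using r(2) c' *(1) by fastforce
      qed
      ultimately show "(\<Sum>i<n. \<bar>v (p (Suc i)) - v (p i)\<bar>) \<le> real (Suc k + 1)"
        using chain_sum_clamp[OF *(3), of v n c'] by simp
    qed
  qed note bound = this
  obtain k :: nat where "(b - a) / (\<delta>/2) \<le> real k" using real_arch_simple by blast
  then have "b - a \<le> real k * (\<delta>/2)" using \<open>\<delta> > 0\<close> by (simp add: field_simps)
  then show ?thesis using that bound[rule_format, of b k] by blast
qed

context
  fixes a b :: real and v :: "real \<Rightarrow> real"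
  assumes ac: "abs_continuous a b v" and ab: "a \<le> b"
begin

lemma chain_sum_le_variation:
  assumes "mono p" "range p \<subseteq> {a..x}" "x \<le> b"
  shows "(\<Sum>i<n. \<bar>v (p (Suc i)) - v (p i)\<bar>) \<le> variation v a x"
proof -
  obtain B where B: "\<And>p n. mono p \<Longrightarrow> range p \<subseteq> {a..b} \<Longrightarrow> (\<Sum>i<n. \<bar>v (p (Suc i)) - v (p i)\<bar>) \<le> B"
    using chain_sums_bounded[OF ac] by metis
  show ?thesis unfolding variation_def
  proof (rule cSup_upper)
    have "range q \<subseteq> {a..b}" if "range q \<subseteq> {a..x}" for q :: "nat \<Rightarrow> real"
      using that assms(3) by fastforce
    then show "bdd_above {\<Sum>i<n. \<bar>v (p (Suc i)) - v (p i)\<bar> |(p::nat \<Rightarrow> real) n. mono p \<and> range p \<subseteq> {a..x}}"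
      using B by (intro bdd_aboveI[of _ B]) auto
  qed (use assms in blast)
qed

lemma variation_step:
  assumes "a \<le> x" "x \<le> y" "y \<le> b"
  shows "\<bar>v y - v x\<bar> \<le> variation v a y - variation v a x"
proof -
  have "variation v a x \<le> variation v a y - \<bar>v y - v x\<bar>"
    unfolding variation_def[of v a x]
  proof (rule cSup_least)
    have "mono (\<lambda>i::nat. x)" "range (\<lambda>i::nat. x) \<subseteq> {a..x}" using assms by (auto simp: mono_def)
    then show "{\<Sum>i<n. \<bar>v (p (Suc i)) - v (p i)\<bar> |(p::nat \<Rightarrow> real) n. mono p \<and> range p \<subseteq> {a..x}} \<noteq> {}"
      by blast
    fix z assume "z \<in> {\<Sum>i<n. \<bar>v (p (Suc i)) - v (p i)\<bar> |(p::nat \<Rightarrow> real) n. mono p \<and> range p \<subseteq> {a..x}}"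
    then obtain p n where p: "mono p" "range p \<subseteq> {a..x}" and z: "z = (\<Sum>i<n. \<bar>v (p (Suc i)) - v (p i)\<bar>)"
      by blast
    define q where "q i = (if i \<le> n then p i else if i = Suc n then x else y)" for i
    have px: "p i \<le> x" "a \<le> p i" for i using p by (auto simp: image_subset_iff)
    have "mono q" unfolding mono_def q_def using px assms p(1)
      by (auto simp: monoD intro: order_trans[OF px(1)])
    moreover have "range q \<subseteq> {a..y}" using px assms by (auto simp: q_def intro: order_trans[OF px(1)])
    ultimately have "(\<Sum>i<Suc (Suc n). \<bar>v (q (Suc i)) - v (q i)\<bar>) \<le> variation v a y"
      using assms by (intro chain_sum_le_variation)
    moreover have "(\<Sum>i<n. \<bar>v (q (Suc i)) - v (q i)\<bar>) = z"
      unfolding z by (intro sum.cong) (auto simp: q_def)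
    ultimately have "z + \<bar>v x - v (p n)\<bar> + \<bar>v y - v x\<bar> \<le> variation v a y" by (simp add: q_def)
    then show "z \<le> variation v a y - \<bar>v y - v x\<bar>" by linarith
  qed
  then show ?thesis by linarith
qed

lemma variation_increment_approx:
  assumes "a \<le> x" "x \<le> y" "y \<le> b" "e > 0"
  obtains p n where "mono p" "range p \<subseteq> {x..y}"
    "variation v a y - variation v a x < (\<Sum>i<n. \<bar>v (p (Suc i)) - v (p i)\<bar>) + e"
proof -
  have "\<exists>z \<in> {\<Sum>i<n. \<bar>v (p (Suc i)) - v (p i)\<bar> |(p::nat \<Rightarrow> real) n. mono p \<and> range p \<subseteq> {a..y}}.
      variation v a y - e < z"
    unfolding variation_def
  proof (rule less_cSupD)
    have "mono (\<lambda>i::nat. x)" "range (\<lambda>i::nat. x) \<subseteq> {a..y}" using assms by (auto simp: mono_def)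
    then show "{\<Sum>i<n. \<bar>v (p (Suc i)) - v (p i)\<bar> |(p::nat \<Rightarrow> real) n. mono p \<and> range p \<subseteq> {a..y}} \<noteq> {}"
      by blast
  qed (use assms in simp)
  then obtain p n where p: "mono p" "range p \<subseteq> {a..y}"
    and e: "variation v a y - e < (\<Sum>i<n. \<bar>v (p (Suc i)) - v (p i)\<bar>)" by blast
  have "(\<Sum>i<n. \<bar>v (min (p (Suc i)) x) - v (min (p i) x)\<bar>) \<le> variation v a x"
  proof (rule chain_sum_le_variation)
    show "mono (\<lambda>i. min (p i) x)" using p(1) by (auto simp: mono_def min.coboundedI1)
    show "range (\<lambda>i. min (p i) x) \<subseteq> {a..x}" using p(2) assms(1) by (auto simp: image_subset_iff)
    show "x \<le> b" using assms by simp
  qed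
  then have "variation v a y - variation v a x < (\<Sum>i<n. \<bar>v (max (p (Suc i)) x) - v (max (p i) x)\<bar>) + e"
    using chain_sum_clamp[OF p(1), of v n x] e by linarith
  moreover have "mono (\<lambda>i. max (p i) x)" using p(1) by (auto simp: mono_def max.coboundedI1)
  moreover have "range (\<lambda>i. max (p i) x) \<subseteq> {x..y}" using p(2) assms(2) by (auto simp: image_subset_iff)
  ultimately show ?thesis using that by blast
qed

text \<open>The increment of the variation over an interval is nearly attained by a chain inside it, and the
chains in finitely many disjoint intervals form again a family of disjoint intervals.\<close>

lemma abs_continuous_variation: "abs_continuous a b (variation v a)"
  unfolding abs_continuous_def
proof (intro allI impI)
  fix \<epsilon> :: real assume "\<epsilon> > 0"
  then obtain \<delta> where "\<delta> > 0" and
    D: "\<forall>(I::(nat \<times> nat) set) s t. finite I \<longrightarrow> (\<forall>i\<in>I. a \<le> s i \<and> s i \<le> t i \<and> t i \<le> b) \<longrightarrow>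
        disjoint_family_on (\<lambda>i. {s i<..<t i}) I \<longrightarrow> (\<Sum>i\<in>I. t i - s i) < \<delta> \<longrightarrow>
        (\<Sum>i\<in>I. dist (v (s i)) (v (t i))) < \<epsilon>/2"
    using abs_continuousD[OF ac, of "\<epsilon>/2"] by auto
  show "\<exists>\<delta>>0. \<forall>(n::nat) s t. (\<forall>i<n. a \<le> s i \<and> s i \<le> t i \<and> t i \<le> b) \<longrightarrow>
        disjoint_family_on (\<lambda>i. {s i<..<t i}) {..<n} \<longrightarrow>
        (\<Sum>i<n. t i - s i) < \<delta> \<longrightarrow> (\<Sum>i<n. dist (variation v a (s i)) (variation v a (t i))) < \<epsilon>"
  proof (intro exI[of _ \<delta>] conjI allI impI)
    fix n :: nat and s t
    assume st: "\<forall>i<n. a \<le> s i \<and> s i \<le> t i \<and> t i \<le> b"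
      and dj: "disjoint_family_on (\<lambda>i. {s i<..<t i}) {..<n}" and len: "(\<Sum>i<n. t i - s i) < \<delta>"
    define e where "e = \<epsilon> / (2 * (real n + 1))"
    have e: "e > 0" using \<open>\<epsilon> > 0\<close> by (simp add: e_def)
    have "\<exists>p m. mono p \<and> range p \<subseteq> {s i..t i} \<and>
        variation v a (t i) - variation v a (s i) < (\<Sum>j<m. \<bar>v (p (Suc j)) - v (p j)\<bar>) + e" if "i < n" for i
    proof -
      have *: "a \<le> s i" "s i \<le> t i" "t i \<le> b" using st that by auto
      show ?thesis by (rule variation_increment_approx[OF * e]) blast
    qed
    then have "\<forall>i\<in>{..<n}. \<exists>pm. mono (fst pm) \<and> range (fst pm) \<subseteq> {s i..t i} \<and>
        variation v a (t i) - variation v a (s i) < (\<Sum>j<snd pm. \<bar>v (fst pm (Suc j)) - v (fst pm j)\<bar>) + e"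
      by simp
    from bchoice[OF this] obtain f where f: "\<forall>i\<in>{..<n}. mono (fst (f i)) \<and> range (fst (f i)) \<subseteq> {s i..t i} \<and>
        variation v a (t i) - variation v a (s i) <
        (\<Sum>j<snd (f i). \<bar>v (fst (f i) (Suc j)) - v (fst (f i) j)\<bar>) + e" by blast
    define p where "p i = fst (f i)" for i
    define m where "m i = snd (f i)" for i
    have pm: "mono (p i)" "range (p i) \<subseteq> {s i..t i}"
      "variation v a (t i) - variation v a (s i) < (\<Sum>j<m i. \<bar>v (p i (Suc j)) - v (p i j)\<bar>) + e" if "i < n" for i
      using f that by (auto simp: p_def m_def)
    have rng: "s i \<le> p i j" "p i j \<le> t i" if "i < n" for i j
      using pm(2)[OF that] by (auto simp: image_subset_iff)
    have "(\<Sum>(i,j)\<in>Sigma {..<n} (\<lambda>i. {..<m i}). dist (v (p i j)) (v (p i (Suc j)))) < \<epsilon>/2"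
    proof -
      have "(\<Sum>k\<in>Sigma {..<n} (\<lambda>i. {..<m i}). dist (v (p (fst k) (snd k))) (v (p (fst k) (Suc (snd k))))) < \<epsilon>/2"
      proof (rule D[rule_format])
        show "a \<le> p (fst k) (snd k) \<and> p (fst k) (snd k) \<le> p (fst k) (Suc (snd k)) \<and> p (fst k) (Suc (snd k)) \<le> b"
          if "k \<in> Sigma {..<n} (\<lambda>i. {..<m i})" for k
        proof -
          have k: "fst k < n" using that by auto
          show ?thesis
            using rng[OF k, of "snd k"] rng[OF k, of "Suc (snd k)"] st k pm(1)[OF k] by (auto simp: monoD)
        qed
        show "disjoint_family_on (\<lambda>k. {p (fst k) (snd k)<..<p (fst k) (Suc (snd k))}) (Sigma {..<n} (\<lambda>i. {..<m i}))"
          unfolding disjoint_family_on_def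
        proof (intro ballI impI)
          fix k l assume k: "k \<in> Sigma {..<n} (\<lambda>i. {..<m i})" and l: "l \<in> Sigma {..<n} (\<lambda>i. {..<m i})" and "k \<noteq> l"
          have kn: "fst k < n" "fst l < n" using k l by auto
          show "{p (fst k) (snd k)<..<p (fst k) (Suc (snd k))} \<inter> {p (fst l) (snd l)<..<p (fst l) (Suc (snd l))} = {}"
          proof (cases "fst k = fst l")
            case True
            then have "snd k \<noteq> snd l" using \<open>k \<noteq> l\<close> by (auto simp: prod_eq_iff)
            then show ?thesis
              using disjoint_family_chain[OF pm(1)[OF kn(1)], of UNIV] True
              by (auto simp: disjoint_family_on_def)
          next
            case False
            have "{p i j<..<p i (Suc j)} \<subseteq> {s i<..<t i}" if "i < n" for i j
              using rng[OF that, of j] rng[OF that, of "Suc j"] by auto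
            moreover have "{s (fst k)<..<t (fst k)} \<inter> {s (fst l)<..<t (fst l)} = {}"
              using dj False kn by (auto simp: disjoint_family_on_def)
            ultimately show ?thesis using kn by blast
          qed
        qed
        have "(\<Sum>k\<in>Sigma {..<n} (\<lambda>i. {..<m i}). p (fst k) (Suc (snd k)) - p (fst k) (snd k))
            = (\<Sum>i<n. \<Sum>j<m i. p i (Suc j) - p i j)"
          by (subst sum.Sigma) (auto simp: case_prod_beta)
        also have "\<dots> = (\<Sum>i<n. p i (m i) - p i 0)"
          by (intro sum.cong refl sum_lessThan_telescope)
        also have "\<dots> \<le> (\<Sum>i<n. t i - s i)"
          using rng by (intro sum_mono diff_mono) auto
        finally show "(\<Sum>k\<in>Sigma {..<n} (\<lambda>i. {..<m i}). p (fst k) (Suc (snd k)) - p (fst k) (snd k)) < \<delta>"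
          using len by simp
      qed auto
      then show ?thesis by (simp add: case_prod_beta)
    qed
    then have half: "(\<Sum>i<n. \<Sum>j<m i. \<bar>v (p i (Suc j)) - v (p i j)\<bar>) < \<epsilon>/2"
      by (subst sum.Sigma) (auto simp: dist_real_def abs_minus_commute)
    have "(\<Sum>i<n. dist (variation v a (s i)) (variation v a (t i)))
        \<le> (\<Sum>i<n. (\<Sum>j<m i. \<bar>v (p i (Suc j)) - v (p i j)\<bar>) + e)"
    proof (intro sum_mono)
      fix i assume "i \<in> {..<n}"
      then have "i < n" by simp
      moreover have "variation v a (s i) \<le> variation v a (t i)"
        using variation_step[of "s i" "t i"] st \<open>i < n\<close> by fastforce
      ultimately show "dist (variation v a (s i)) (variation v a (t i)) \<le> (\<Sum>j<m i. \<bar>v (p i (Suc j)) - v (p i j)\<bar>) + e"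
        using pm(3)[of i] by (simp add: dist_real_def)
    qed
    also have "\<dots> = (\<Sum>i<n. \<Sum>j<m i. \<bar>v (p i (Suc j)) - v (p i j)\<bar>) + real n * e"
      by (simp add: sum.distrib)
    also have "real n * e < \<epsilon>/2" using \<open>\<epsilon> > 0\<close> by (simp add: e_def field_simps)
    finally show "(\<Sum>i<n. dist (variation v a (s i)) (variation v a (t i))) < \<epsilon>" using half by linarith
  qed (fact \<open>\<delta> > 0\<close>)
qed

end

text \<open>Lebesgue's differentiation theorem for averages to the right; applied to the reflected function
it covers the averages to the left.\<close>

lemma integral_averages_tendsto_AE:
  fixes g :: "real \<Rightarrow> real"
  assumes g: "integrable lborel g"
  shows "AE x in lborel. ((\<lambda>y. integral {x..y} g / (y - x)) \<longlongrightarrow> g x) (at_right x) \<and>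
      ((\<lambda>y. integral {y..x} g / (x - y)) \<longlongrightarrow> g x) (at_left x)"
proof -
  have right: "\<exists>N. negligible N \<and> (\<forall>x. x \<notin> N \<longrightarrow> ((\<lambda>y. integral {x..y} f / (y - x)) \<longlongrightarrow> f x) (at_right x))"
    if f: "integrable lborel f" for f :: "real \<Rightarrow> real"
  proof -
    have "f integrable_on cbox a b" for a b
    proof -
      have "set_integrable lborel (cbox a b) f"
        unfolding set_integrable_def using f by (intro integrable_mult_indicator) auto
      then show ?thesis by (rule set_borel_integral_eq_integral)
    qed
    then obtain N where N: "negligible N" and
      lim: "\<And>x e. x \<notin> N \<Longrightarrow> 0 < e \<Longrightarrow> \<exists>d>0. \<forall>h. 0 < h \<and> h < d \<longrightarrow>
          norm (integral (cbox x (x + h *\<^sub>R One)) f /\<^sub>R h ^ DIM(real) - f x) < e"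
      using integrable_ccontinuous_explicit[of f] by metis
    have "((\<lambda>y. integral {x..y} f / (y - x)) \<longlongrightarrow> f x) (at_right x)" if xN: "x \<notin> N" for x
    proof (rule tendstoI)
      fix e :: real assume "e > 0"
      then obtain d where "d > 0" and d: "\<And>h. 0 < h \<Longrightarrow> h < d \<Longrightarrow>
          norm (integral (cbox x (x + h *\<^sub>R One)) f /\<^sub>R h ^ DIM(real) - f x) < e"
        using lim[OF xN] by blast
      show "\<forall>\<^sub>F y in at_right x. dist (integral {x..y} f / (y - x)) (f x) < e"
        unfolding eventually_at_right_field
      proof (intro exI[of _ "x + d"] conjI allI impI)
        fix y assume "x < y" "y < x + d"
        then show "dist (integral {x..y} f / (y - x)) (f x) < e"
          using d[of "y - x"] by (simp add: dist_real_def divide_inverse mult.commute)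
      qed (use \<open>d > 0\<close> in simp)
    qed
    then show ?thesis using N by blast
  qed
  obtain N1 where N1: "negligible N1"
    and r: "\<And>x. x \<notin> N1 \<Longrightarrow> ((\<lambda>y. integral {x..y} g / (y - x)) \<longlongrightarrow> g x) (at_right x)"
    using right[OF g] by blast
  have "integrable lborel (\<lambda>x. g (- x))"
    using lborel_integrable_real_affine[OF g, of "-1" 0] by simp
  then obtain N2 where N2: "negligible N2" and
    l: "\<And>x. x \<notin> N2 \<Longrightarrow> ((\<lambda>y. integral {x..y} (\<lambda>x. g (- x)) / (y - x)) \<longlongrightarrow> g (- x)) (at_right x)"
    using right by blast
  have N2': "negligible (uminus ` N2)"
    by (rule negligible_differentiable_image_negligible[OF _ N2]) (auto intro!: derivative_intros)
  have left: "((\<lambda>y. integral {y..x} g / (x - y)) \<longlongrightarrow> g x) (at_left x)" if "x \<notin> uminus ` N2" for x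
  proof -
    have "- x \<notin> N2" using that by (metis imageI minus_minus)
    from l[OF this] have "((\<lambda>y. integral {-x..y} (\<lambda>x. g (- x)) / (y + x)) \<longlongrightarrow> g x) (at_right (-x))"
      by simp
    moreover have "(\<lambda>y. integral {-x..y} (\<lambda>x. g (- x)) / (y + x)) = (\<lambda>y. integral {-y..x} g / (x - (-y)))"
    proof
      show "integral {-x..y} (\<lambda>x. g (- x)) / (y + x) = integral {-y..x} g / (x - (-y))" for y
        using Henstock_Kurzweil_Integration.integral_reflect_real[of x "-y" g] by (simp add: add.commute)
    qed
    ultimately show ?thesis by (simp only: filterlim_at_left_to_right) 
  qed
  have "AE x in lebesgue. x \<notin> N1 \<union> uminus ` N2"
    using N1 N2' by (intro AE_not_in) (simp add: negligible_iff_null_sets null_sets.Un)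
  then have "AE x in lebesgue. ((\<lambda>y. integral {x..y} g / (y - x)) \<longlongrightarrow> g x) (at_right x) \<and>
      ((\<lambda>y. integral {y..x} g / (x - y)) \<longlongrightarrow> g x) (at_left x)"
    by eventually_elim (use r left in auto)
  then show ?thesis by (simp add: AE_completion_iff)
qed

lemma indefinite_integral_derivative_AE:
  fixes v g :: "real \<Rightarrow> real"
  assumes g: "integrable lborel g"
    and v: "\<And>c d. a \<le> c \<Longrightarrow> c \<le> d \<Longrightarrow> d \<le> b \<Longrightarrow> v d - v c = (LINT x:{c..d}|lborel. g x)"
  shows "AE x in lborel. x \<in> {a<..<b} \<longrightarrow> (v has_real_derivative g x) (at x)"
  using integral_averages_tendsto_AE[OF g]
proof eventually_elim
  fix x
  assume lim: "((\<lambda>y. integral {x..y} g / (y - x)) \<longlongrightarrow> g x) (at_right x) \<and>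
      ((\<lambda>y. integral {y..x} g / (x - y)) \<longlongrightarrow> g x) (at_left x)"
  have eq: "v d - v c = integral {c..d} g" if "a \<le> c" "c \<le> d" "d \<le> b" for c d
  proof -
    have "set_integrable lborel {c..d} g"
      unfolding set_integrable_def using g by (intro integrable_mult_indicator) auto
    then show ?thesis using v[OF that] set_borel_integral_eq_integral(2) by metis
  qed
  show "x \<in> {a<..<b} \<longrightarrow> (v has_real_derivative g x) (at x)"
  proof
    assume x: "x \<in> {a<..<b}"
    have "\<forall>\<^sub>F y in at_right x. integral {x..y} g / (y - x) = (v y - v x) / (y - x)"
      unfolding eventually_at_right_field using x eq by (intro exI[of _ b]) auto
    then have R: "((\<lambda>y. (v y - v x) / (y - x)) \<longlongrightarrow> g x) (at_right x)"
      by (rule Lim_transform_eventually[OF conjunct1[OF lim]])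
    have "\<forall>\<^sub>F y in at_left x. integral {y..x} g / (x - y) = (v y - v x) / (y - x)"
      unfolding eventually_at_left_field
    proof (intro exI[of _ a] conjI allI impI)
      fix y assume "a < y" "y < x"
      then have "v x - v y = integral {y..x} g" using eq[of y x] x by auto
      then show "integral {y..x} g / (x - y) = (v y - v x) / (y - x)"
        using \<open>y < x\<close> by (simp add: divide_simps) (simp add: algebra_simps)
    qed (use x in auto)
    then have L: "((\<lambda>y. (v y - v x) / (y - x)) \<longlongrightarrow> g x) (at_left x)"
      by (rule Lim_transform_eventually[OF conjunct2[OF lim]])
    show "(v has_real_derivative g x) (at x)"
      unfolding has_field_derivative_iff using L R filterlim_split_at by blast
  qed
qed

text \<open>Absolute continuity says that the Stieltjes measure of \<open>F\<close>, continued by constants outside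
\<open>{a..b}\<close>, vanishes on Lebesgue null sets. The density comes from the Radon-Nikodym theorem.\<close>

lemma monotone_abs_continuous_density:
  fixes F :: "real \<Rightarrow> real"
  assumes ac: "abs_continuous a b F" and ab: "a \<le> b"
    and mono: "\<And>x y. a \<le> x \<Longrightarrow> x \<le> y \<Longrightarrow> y \<le> b \<Longrightarrow> F x \<le> F y"
  shows "\<exists>g. g \<in> borel_measurable borel \<and> integrable lborel g \<and>
    (\<forall>c d. a \<le> c \<longrightarrow> c \<le> d \<longrightarrow> d \<le> b \<longrightarrow> F d - F c = (LINT x:{c..d}|lborel. g x))"
proof -
  define G where "G x = F (max a (min b x))" for x
  have G: "G x = F x" if "x \<in> {a..b}" for x using that by (auto simp: G_def)
  have Gmono: "G x \<le> G y" if "x \<le> y" for x y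
    unfolding G_def using that ab by (intro mono) auto
  have Gcont: "continuous_on UNIV G"
    unfolding G_def
    by (rule continuous_on_compose2[OF abs_continuous_imp_continuous_on[OF ac]])
       (use ab in \<open>auto intro!: continuous_intros\<close>)
  have Gr: "continuous (at_right x) G" for x
    using Gcont by (meson continuous_at_imp_continuous_within continuous_on_eq_continuous_at open_UNIV UNIV_I)
  define \<mu> where "\<mu> = interval_measure G"
  have sets_mu: "sets \<mu> = sets lborel" by (simp add: \<mu>_def)
  have Icc: "emeasure \<mu> {c..d} = ennreal (G d - G c)" if "c \<le> d" for c d
    unfolding \<mu>_def by (rule emeasure_interval_measure_Icc[OF that Gmono Gcont])
  have out: "emeasure \<mu> (- {a<..<b}) = 0"
  proof -
    have "- {a<..<b} \<subseteq> (\<Union>n. {a - real n..a} \<union> {b..b + real n})"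
    proof
      fix x assume x: "x \<in> - {a<..<b}"
      obtain n where "\<bar>x - a\<bar> + \<bar>x - b\<bar> \<le> real n" using real_arch_simple by blast
      then show "x \<in> (\<Union>n. {a - real n..a} \<union> {b..b + real n})" using x by (intro UN_I[of n]) auto
    qed
    moreover have "(\<Union>n. {a - real n..a} \<union> {b..b + real n}) \<in> null_sets \<mu>"
    proof (intro null_sets_UN null_sets.Un)
      show "{a - real n..a} \<in> null_sets \<mu>" for n
        using Icc[of "a - real n" a] ab by (auto simp: null_sets_def \<mu>_def G_def)
      show "{b..b + real n} \<in> null_sets \<mu>" for n
        using Icc[of b "b + real n"] ab by (auto simp: null_sets_def \<mu>_def G_def)
    qed
    moreover from calculation(2) have "(\<Union>n. {a - real n..a} \<union> {b..b + real n}) \<in> sets \<mu>" by auto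
    ultimately have "emeasure \<mu> (- {a<..<b}) \<le> 0"
      by (metis (no_types, lifting) emeasure_mono null_setsD1)
    then show ?thesis by simp
  qed
  have acm: "absolutely_continuous lborel \<mu>"
    unfolding absolutely_continuous_def
  proof
    fix N :: "real set" assume N: "N \<in> null_sets lborel"
    have small: "emeasure \<mu> (N \<inter> {a<..<b}) \<le> ennreal \<epsilon>" if "\<epsilon> > 0" for \<epsilon>
    proof -
      have "N \<in> null_sets lebesgue" using N by (rule null_sets_completionI)
      from abs_continuous_null_cover[OF ac this \<open>\<epsilon> > 0\<close>]
      obtain s t :: "nat \<Rightarrow> real" where st: "\<forall>i. s i < t i \<longrightarrow> a \<le> s i \<and> t i \<le> b"
        "disjoint_family (\<lambda>i. {s i<..<t i})" "N \<inter> {a<..<b} \<subseteq> (\<Union>i. {s i<..<t i})"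
        and osc: "small_oscillation F \<epsilon> s t" by blast
      have "emeasure \<mu> (N \<inter> {a<..<b}) \<le> emeasure \<mu> (\<Union>i. {s i<..<t i})"
        using st(3) by (intro emeasure_mono) (auto simp: \<mu>_def)
      also have "\<dots> = (\<Sum>i. emeasure \<mu> {s i<..<t i})"
        using st(2) by (intro suminf_emeasure[symmetric]) (auto simp: \<mu>_def)
      also have "\<dots> \<le> ennreal \<epsilon>"
      proof (rule small_oscillationD[OF osc, where p=s and q=t], intro conjI)
        fix i assume "s i < t i"
        then have i: "s i < t i" "a \<le> s i" "t i \<le> b" using st(1) by auto
        have "emeasure \<mu> {s i<..<t i} \<le> emeasure \<mu> {s i..t i}"
          by (intro emeasure_mono) (auto simp: \<mu>_def)
        also have "\<dots> = ennreal (F (t i) - F (s i))" using Icc[of "s i" "t i"] i G by simp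
        finally show "emeasure \<mu> {s i<..<t i} \<le> ennreal (dist (F (s i)) (F (t i)))"
          using mono[of "s i" "t i"] i by (simp add: dist_real_def)
      qed auto
      finally show ?thesis .
    qed
    have "emeasure \<mu> (N \<inter> {a<..<b}) = 0"
    proof (rule ccontr)
      assume "emeasure \<mu> (N \<inter> {a<..<b}) \<noteq> 0"
      then have "0 < emeasure \<mu> (N \<inter> {a<..<b})" by (simp add: zero_less_iff_neq_zero)
      moreover have "emeasure \<mu> (N \<inter> {a<..<b}) \<le> 0"
        by (rule ennreal_le_epsilon) (use small in simp)
      ultimately show False by simp
    qed
    moreover have "emeasure \<mu> N \<le> emeasure \<mu> (N \<inter> {a<..<b}) + emeasure \<mu> (- {a<..<b})"
      using N by (intro order_trans[OF emeasure_mono emeasure_subadditive]) (auto simp: \<mu>_def)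
    ultimately show "N \<in> null_sets \<mu>" using out N by (auto simp: null_sets_def \<mu>_def)
  qed
  obtain f where f: "f \<in> borel_measurable lborel" "density lborel f = \<mu>"
    using sigma_finite_measure.Radon_Nikodym[OF sigma_finite_lborel acm sets_mu] by blast
  have tot: "(\<integral>\<^sup>+x. f x \<partial>lborel) < \<infinity>"
  proof -
    have "(\<integral>\<^sup>+x. f x \<partial>lborel) = emeasure \<mu> UNIV"
      unfolding f(2)[symmetric] using f(1) by (simp add: emeasure_density)
    also have "\<dots> \<le> emeasure \<mu> {a..b} + emeasure \<mu> (- {a<..<b})"
      by (intro order_trans[OF emeasure_mono emeasure_subadditive]) (auto simp: \<mu>_def)
    also have "\<dots> < \<infinity>" using out Icc[OF ab] by simp
    finally show ?thesis .
  qed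
  define g where "g x = enn2real (f x)" for x
  have gm: "g \<in> borel_measurable borel" using f(1) by (simp add: g_def[abs_def])
  have "AE x in lborel. f x \<noteq> \<infinity>" using tot f(1) by (intro nn_integral_noteq_infinite) auto
  then have fg: "AE x in lborel. ennreal (g x) = f x"
    by eventually_elim (auto simp: g_def less_top)
  have gi: "integrable lborel g"
  proof (rule integrableI_nonneg)
    have "(\<integral>\<^sup>+x. ennreal (g x) \<partial>lborel) = (\<integral>\<^sup>+x. f x \<partial>lborel)"
      using fg by (rule nn_integral_cong_AE)
    then show "(\<integral>\<^sup>+x. ennreal (g x) \<partial>lborel) < \<infinity>" using tot by simp
  qed (use gm in \<open>auto simp: g_def\<close>)
  show ?thesis
  proof (intro exI[of _ g] conjI gm gi allI impI)
    fix c d assume cd: "a \<le> c" "c \<le> d" "d \<le> b"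
    have "ennreal (LINT x:{c..d}|lborel. g x) = (\<integral>\<^sup>+x. ennreal (indicator {c..d} x *\<^sub>R g x) \<partial>lborel)"
      unfolding set_lebesgue_integral_def using gi
      by (intro nn_integral_eq_integral[symmetric] integrable_mult_indicator gi) (auto simp: g_def)
    also have "\<dots> = (\<integral>\<^sup>+x. f x * indicator {c..d} x \<partial>lborel)"
      using fg by (intro nn_integral_cong_AE) (auto elim!: eventually_mono simp: indicator_def)
    also have "\<dots> = emeasure \<mu> {c..d}"
      unfolding f(2)[symmetric] using f(1) by (simp add: emeasure_density)
    also have "\<dots> = ennreal (F d - F c)" using Icc[of c d] cd G by simp
    finally have "ennreal (LINT x:{c..d}|lborel. g x) = ennreal (F d - F c)" .
    moreover have "0 \<le> (LINT x:{c..d}|lborel. g x)"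
      unfolding set_lebesgue_integral_def by (intro integral_nonneg_AE) (auto simp: g_def)
    ultimately show "F d - F c = (LINT x:{c..d}|lborel. g x)"
      using mono[OF cd] by (simp add: ennreal_inj)
  qed
qed

text \<open>The function is the difference of two absolutely continuous monotone functions, its variation
\<open>V\<close> and \<open>V - v\<close>.\<close>

theorem abs_continuous_derivative:
  fixes v :: "real \<Rightarrow> real"
  assumes ac: "abs_continuous a b v" and ab: "a \<le> b"
  shows "\<exists>g. g \<in> borel_measurable borel \<and> integrable lborel g \<and>
    (\<forall>c d. a \<le> c \<longrightarrow> c \<le> d \<longrightarrow> d \<le> b \<longrightarrow> v d - v c = (LINT x:{c..d}|lborel. g x)) \<and>
    (AE x in lborel. x \<in> {a<..<b} \<longrightarrow> (v has_real_derivative g x) (at x))"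
proof -
  define V where "V = variation v a"
  have step: "\<bar>v y - v x\<bar> \<le> V y - V x" if "a \<le> x" "x \<le> y" "y \<le> b" for x y
    unfolding V_def by (rule variation_step[OF ac ab that])
  have acV: "abs_continuous a b V" unfolding V_def by (rule abs_continuous_variation[OF ac ab])
  have ac2: "abs_continuous a b (\<lambda>x. V x - v x)"
  proof (rule abs_continuous_lipschitz_compose[OF acV, of _ 2])
    fix s t assume "a \<le> s" "s \<le> t" "t \<le> b"
    from step[OF this] show "dist (V s - v s) (V t - v t) \<le> 2 * dist (V s) (V t)"
      by (auto simp: dist_real_def)
  qed
  have mono2: "V x - v x \<le> V y - v y" if "a \<le> x" "x \<le> y" "y \<le> b" for x y
    using step[OF that] by linarith
  have mono1: "V x \<le> V y" if "a \<le> x" "x \<le> y" "y \<le> b" for x y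
    using step[OF that] by linarith
  obtain g2 where g2: "g2 \<in> borel_measurable borel" "integrable lborel g2"
    "\<And>c d. a \<le> c \<Longrightarrow> c \<le> d \<Longrightarrow> d \<le> b \<Longrightarrow> (V d - v d) - (V c - v c) = (LINT x:{c..d}|lborel. g2 x)"
    using monotone_abs_continuous_density[OF ac2 ab mono2] by blast
  obtain g1 where g1: "g1 \<in> borel_measurable borel" "integrable lborel g1"
    "\<And>c d. a \<le> c \<Longrightarrow> c \<le> d \<Longrightarrow> d \<le> b \<Longrightarrow> V d - V c = (LINT x:{c..d}|lborel. g1 x)"
    using monotone_abs_continuous_density[OF acV ab mono1] by blast
  define g where "g x = g1 x - g2 x" for x
  have g: "g \<in> borel_measurable borel" "integrable lborel g"
    using g1(1,2) g2(1,2) by (auto simp: g_def[abs_def])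
  have rep: "v d - v c = (LINT x:{c..d}|lborel. g x)" if "a \<le> c" "c \<le> d" "d \<le> b" for c d
  proof -
    have "set_integrable lborel {c..d} g1"
      unfolding set_integrable_def using g1(2) by (intro integrable_mult_indicator) auto
    moreover have "set_integrable lborel {c..d} g2"
      unfolding set_integrable_def using g2(2) by (intro integrable_mult_indicator) auto
    ultimately have "(LINT x:{c..d}|lborel. g x) = (V d - V c) - ((V d - v d) - (V c - v c))"
      using g1(3)[OF that] g2(3)[OF that] by (simp add: g_def)
    then show ?thesis by simp
  qed
  show ?thesis
    using g rep indefinite_integral_derivative_AE[OF g(2) rep] by blast
qed

section \<open>Hausdorff content\<close>

text \<open>The one-dimensional Hausdorff content: the diameters of the covering sets are not restricted. It
has the same null sets as linear measure.\<close>

definition content1 :: "'a::metric_space set \<Rightarrow> ennreal" where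
  "content1 S = (INF C \<in> {C :: nat \<Rightarrow> 'a set. S \<subseteq> (\<Union>i. C i) \<and> (\<forall>i. bounded (C i))}.
     \<Sum>i. ennreal (diameter (C i)))"

lemma content1_le:
  assumes "S \<subseteq> (\<Union>i. C i)" "\<And>i::nat. bounded (C i)"
  shows "content1 S \<le> (\<Sum>i. ennreal (diameter (C i)))"
  unfolding content1_def using assms by (intro INF_lower) auto

lemma content1_mono: "S \<subseteq> T \<Longrightarrow> content1 S \<le> content1 T"
  unfolding content1_def by (intro INF_superset_mono) auto

lemma content1_approx:
  assumes "content1 S < e"
  shows "\<exists>C::nat \<Rightarrow> 'a::metric_space set. S \<subseteq> (\<Union>i. C i) \<and> (\<forall>i. bounded (C i)) \<and> (\<Sum>i. ennreal (diameter (C i))) < e"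
  using assms unfolding content1_def INF_less_iff by auto

text \<open>A set of a cover with small total diameter has itself small diameter.\<close>

lemma linear_measure_0:
  fixes S :: "'a::metric_space set"
  assumes "content1 S = 0"
  shows "linear_measure S = 0"
proof -
  have "(INF C \<in> {C :: nat \<Rightarrow> 'a set. S \<subseteq> (\<Union>i. C i) \<and> (\<forall>i. bounded (C i) \<and> diameter (C i) \<le> \<delta>)}.
        (\<Sum>i. ennreal (diameter (C i)))) \<le> 0" (is "?I \<le> 0") if "\<delta> > 0" for \<delta> :: real
  proof (rule ennreal_le_epsilon)
    fix e :: real assume "e > 0"
    have "content1 S < ennreal (min e \<delta>)" using assms \<open>e > 0\<close> \<open>\<delta> > 0\<close> by simp
    then obtain C :: "nat \<Rightarrow> 'a set" where C: "S \<subseteq> (\<Union>i. C i)" "\<forall>i. bounded (C i)"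
      and sum: "(\<Sum>i. ennreal (diameter (C i))) < ennreal (min e \<delta>)"
      using content1_approx by blast
    have "diameter (C i) \<le> \<delta>" for i
    proof -
      have "ennreal (diameter (C i)) \<le> (\<Sum>i. ennreal (diameter (C i)))"
        using sum_le_suminf[of "\<lambda>i. ennreal (diameter (C i))" "{i}"] by simp
      also have "\<dots> < ennreal (min e \<delta>)" by (fact sum)
      finally have "ennreal (diameter (C i)) < ennreal \<delta>"
        by (rule less_le_trans) (simp add: ennreal_leI)
      then show ?thesis by (meson ennreal_leI not_le less_imp_le)
    qed
    then have "?I \<le> (\<Sum>i. ennreal (diameter (C i)))"
      using C by (intro INF_lower) auto
    also have "\<dots> \<le> ennreal e"
      using sum by (meson ennreal_leI less_imp_le min.cobounded1 order_trans)
    finally show "?I \<le> 0 + ennreal e" by simp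
  qed
  then have "linear_measure S \<le> 0" unfolding linear_measure_def by (intro SUP_least) auto
  then show ?thesis by simp
qed

lemma content1_UN:
  fixes S :: "nat \<Rightarrow> 'a::metric_space set"
  shows "content1 (\<Union>i. S i) \<le> (\<Sum>i. content1 (S i))"
proof (cases "(\<Sum>i. content1 (S i)) = \<infinity>")
  case False
  have fin: "content1 (S i) \<noteq> \<infinity>" for i
  proof
    assume "content1 (S i) = \<infinity>"
    moreover have "content1 (S i) \<le> (\<Sum>i. content1 (S i))"
      using sum_le_suminf[of "\<lambda>i. content1 (S i)" "{i}"] by simp
    ultimately show False using False by (simp add: top_unique)
  qed
  show ?thesis
  proof (rule ennreal_le_epsilon)
    fix e :: real assume "e > 0"
    define h where "h i = e * (1/2) ^ Suc i" for i
    have "\<exists>C::nat \<Rightarrow> 'a set. S i \<subseteq> (\<Union>j. C j) \<and> (\<forall>j. bounded (C j)) \<and>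
        (\<Sum>j. ennreal (diameter (C j))) < content1 (S i) + ennreal (h i)" for i
    proof (rule content1_approx)
      have "content1 (S i) + 0 < content1 (S i) + ennreal (h i)"
        using fin[of i] \<open>e > 0\<close> by (subst ennreal_add_left_cancel_less) (auto simp: h_def)
      then show "content1 (S i) < content1 (S i) + ennreal (h i)" by simp
    qed
    then obtain C where C: "\<And>i. S i \<subseteq> (\<Union>j. C i j)" "\<And>i j. bounded (C i j)"
      "\<And>i. (\<Sum>j. ennreal (diameter (C i (j::nat)))) < content1 (S i) + ennreal (h i)"
      by metis
    define D where "D k = C (fst (prod_decode k)) (snd (prod_decode k))" for k
    have "content1 (\<Union>i. S i) \<le> (\<Sum>k. ennreal (diameter (D k)))"
    proof (rule content1_le)
      show "(\<Union>i. S i) \<subseteq> (\<Union>k. D k)"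
      proof
        fix x assume "x \<in> (\<Union>i. S i)"
        then obtain i where "x \<in> S i" by blast
        then obtain j where "x \<in> C i j" using C(1)[of i] by blast
        then have "x \<in> D (prod_encode (i, j))" by (simp add: D_def)
        then show "x \<in> (\<Union>k. D k)" by blast
      qed
    qed (simp add: D_def C(2))
    also have "\<dots> = (\<Sum>i. \<Sum>j. ennreal (diameter (C i j)))"
    proof -
      have "(\<Sum>k. (\<lambda>(i, j). ennreal (diameter (C i j))) (prod_decode k)) = (\<Sum>i. \<Sum>j. ennreal (diameter (C i j)))"
        by (rule suminf_ennreal_2dimen) simp
      then show ?thesis by (simp add: D_def case_prod_beta)
    qed
    also have "\<dots> \<le> (\<Sum>i. content1 (S i) + ennreal (h i))"
      using C(3) by (intro suminf_le less_imp_le) auto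
    also have "\<dots> = (\<Sum>i. content1 (S i)) + (\<Sum>i. ennreal (h i))"
      by (intro suminf_add[symmetric]) auto
    also have "(\<Sum>i. ennreal (h i)) = ennreal e"
    proof (rule suminf_ennreal_eq)
      show "h sums e" using sums_mult[OF power_half_series, of e] by (simp add: h_def[abs_def])
    qed (use \<open>e > 0\<close> in \<open>simp add: h_def\<close>)
    finally show "content1 (\<Union>i. S i) \<le> (\<Sum>i. content1 (S i)) + ennreal e" .
  qed
qed simp

lemma content1_zero_subset: "content1 T = 0 \<Longrightarrow> S \<subseteq> T \<Longrightarrow> content1 S = 0"
  using content1_mono[of S T] by simp

lemma content1_empty [simp]: "content1 {} = 0"
  using content1_le[of "{}" "\<lambda>i. {}"] by simp

lemma content1_zero_countable_UN:
  assumes "countable I" "\<And>i. i \<in> I \<Longrightarrow> content1 (S i) = 0"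
  shows "content1 (\<Union>i\<in>I. S i) = 0"
proof (cases "I = {}")
  case False
  have "content1 (\<Union>n. S (from_nat_into I n)) \<le> (\<Sum>n. content1 (S (from_nat_into I n)))"
    by (rule content1_UN)
  also have "\<dots> = 0" using assms(2) False by (simp add: from_nat_into)
  finally have "content1 (\<Union>n. S (from_nat_into I n)) = 0" by simp
  moreover have "(\<Union>i\<in>I. S i) \<subseteq> (\<Union>n. S (from_nat_into I n))"
  proof
    fix x assume "x \<in> (\<Union>i\<in>I. S i)"
    then obtain i where "i \<in> I" "x \<in> S i" by blast
    moreover obtain n where "i = from_nat_into I n"
      using range_from_nat_into[OF False assms(1)] \<open>i \<in> I\<close> by blast
    ultimately show "x \<in> (\<Union>n. S (from_nat_into I n))" by blast
  qed
  ultimately show ?thesis by (rule content1_zero_subset)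
qed simp

lemma content1_zero_Un: "content1 S = 0 \<Longrightarrow> content1 T = 0 \<Longrightarrow> content1 (S \<union> T) = 0"
  using content1_zero_countable_UN[of "{True, False}" "\<lambda>b. if b then S else T"]
  by (simp add: Un_commute split: if_splits)

text \<open>The images of the components of an open set slightly larger than \<open>B\<close> form a cover.\<close>

lemma content1_lipschitz_real:
  fixes \<phi> :: "real \<Rightarrow> 'a::metric_space"
  assumes B: "B \<in> sets lborel" "D \<subseteq> B" "B \<subseteq> {a<..<b}" and "\<epsilon> \<ge> 0"
    and lip: "\<And>q q'. q \<in> D \<Longrightarrow> q' \<in> D \<Longrightarrow> q' < q \<Longrightarrow> dist (\<phi> q') (\<phi> q) \<le> \<epsilon> * (q - q')"
  shows "content1 (\<phi> ` D) \<le> ennreal \<epsilon> * emeasure lborel B"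
proof -
  have le: "content1 (\<phi> ` D) \<le> ennreal \<epsilon> * (emeasure lborel B + ennreal \<eta>)" if "\<eta> > 0" for \<eta>
  proof -
    have "B \<in> sets lebesgue" using B by auto
    then obtain T where T: "open T" "B \<subseteq> T" "emeasure lebesgue (T - B) < ennreal \<eta>"
      using sets_lebesgue_outer_open[OF _ \<open>\<eta> > 0\<close>] by metis
    define U where "U = T \<inter> {a<..<b}"
    have U: "open U" "U \<subseteq> {a<..<b}" "D \<subseteq> U" using T B by (auto simp: U_def)
    have "emeasure lborel U \<le> emeasure lborel (B \<union> (T - B))"
      using T B by (intro emeasure_mono) (auto simp: U_def)
    also have "\<dots> \<le> emeasure lborel B + emeasure lborel (T - B)"
      using T B by (intro emeasure_subadditive) auto
    also have "emeasure lborel (T - B) \<le> ennreal \<eta>" using T B by auto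
    finally have Ul: "emeasure lborel U \<le> emeasure lborel B + ennreal \<eta>" by (simp add: add_left_mono)
    obtain s t :: "nat \<Rightarrow> real" where st: "\<forall>i. s i \<le> t i"
      "disjoint_family (\<lambda>i. {s i<..<t i})" "U = (\<Union>i. {s i<..<t i})"
      using bounded_open_real_disjoint_intervals[OF U(1,2)] by blast
    define C where "C i = \<phi> ` (D \<inter> {s i<..<t i})" for i
    have dist: "dist x y \<le> \<epsilon> * (t i - s i)" if xy: "x \<in> C i" "y \<in> C i" for x y i
    proof -
      obtain q q' where q: "q \<in> D" "q' \<in> D" "q \<in> {s i<..<t i}" "q' \<in> {s i<..<t i}" "x = \<phi> q" "y = \<phi> q'"
        using xy by (auto simp: C_def)
      have "dist x y \<le> \<epsilon> * \<bar>q - q'\<bar>"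
        using lip[of q q'] lip[of q' q] q by (cases "q = q'"; cases "q < q'") (auto simp: dist_commute)
      also have "\<dots> \<le> \<epsilon> * (t i - s i)" using q \<open>\<epsilon> \<ge> 0\<close> by (intro mult_left_mono) auto
      finally show ?thesis .
    qed
    have "content1 (\<phi> ` D) \<le> (\<Sum>i. ennreal (diameter (C i)))"
    proof (rule content1_le)
      show "\<phi> ` D \<subseteq> (\<Union>i. C i)" using U(3) st(3) by (fastforce simp: C_def)
      show "bounded (C i)" for i using dist[of _ i] by (meson bounded_two_points)
    qed
    also have "\<dots> \<le> (\<Sum>i. ennreal \<epsilon> * emeasure lborel {s i<..<t i})"
    proof (intro suminf_le)
      fix i
      have "diameter (C i) \<le> \<epsilon> * (t i - s i)"
        unfolding diameter_def using dist[of _ i] st(1) \<open>\<epsilon> \<ge> 0\<close>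
        by (auto intro!: cSUP_least simp: image_iff)
      then have "ennreal (diameter (C i)) \<le> ennreal (\<epsilon> * (t i - s i))" by (rule ennreal_leI)
      then show "ennreal (diameter (C i)) \<le> ennreal \<epsilon> * emeasure lborel {s i<..<t i}"
        using st(1) \<open>\<epsilon> \<ge> 0\<close> by (simp add: ennreal_mult')
    qed auto
    also have "\<dots> = ennreal \<epsilon> * (\<Sum>i. emeasure lborel {s i<..<t i})" by simp
    also have "(\<Sum>i. emeasure lborel {s i<..<t i}) = emeasure lborel U"
      unfolding st(3) using st(2) by (intro suminf_emeasure) auto
    also have "ennreal \<epsilon> * emeasure lborel U \<le> ennreal \<epsilon> * (emeasure lborel B + ennreal \<eta>)"
      using Ul by (intro mult_left_mono) auto
    finally show ?thesis .
  qed
  show ?thesis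
  proof (rule ennreal_le_epsilon)
    fix e :: real assume "e > 0"
    have "content1 (\<phi> ` D) \<le> ennreal \<epsilon> * (emeasure lborel B + ennreal (e / (\<epsilon> + 1)))"
      using \<open>e > 0\<close> \<open>\<epsilon> \<ge> 0\<close> by (intro le) auto
    also have "\<dots> = ennreal \<epsilon> * emeasure lborel B + ennreal (\<epsilon> * (e / (\<epsilon> + 1)))"
      using \<open>e > 0\<close> \<open>\<epsilon> \<ge> 0\<close> by (simp add: distrib_left flip: ennreal_mult')
    also have "\<dots> \<le> ennreal \<epsilon> * emeasure lborel B + ennreal e"
      using \<open>e > 0\<close> \<open>\<epsilon> \<ge> 0\<close> by (intro add_left_mono ennreal_leI) (simp add: field_simps)
    finally show "content1 (\<phi> ` D) \<le> ennreal \<epsilon> * emeasure lborel B + ennreal e" .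
  qed
qed

lemma content1_lipschitz_null:
  fixes \<phi> :: "real \<Rightarrow> 'a::metric_space"
  assumes D: "D \<in> null_sets lebesgue" "D \<subseteq> {a<..<b}" and "\<epsilon> \<ge> 0"
    and lip: "\<And>q q'. q \<in> D \<Longrightarrow> q' \<in> D \<Longrightarrow> q' < q \<Longrightarrow> dist (\<phi> q') (\<phi> q) \<le> \<epsilon> * (q - q')"
  shows "content1 (\<phi> ` D) = 0"
proof -
  obtain N where N: "N \<in> null_sets lborel" "D \<subseteq> N"
    using D(1) by (meson null_sets_completion_iff2)
  have "content1 (\<phi> ` D) \<le> ennreal \<epsilon> * emeasure lborel (N \<inter> {a<..<b})"
    using N D \<open>\<epsilon> \<ge> 0\<close> lip by (intro content1_lipschitz_real[where a=a and b=b]) auto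
  also have "emeasure lborel (N \<inter> {a<..<b}) = 0"
    using N by (metis emeasure_mono inf_le1 le_zero_eq null_setsD1 null_setsD2)
  finally show ?thesis by simp
qed

lemma content1_abs_continuous_null:
  fixes \<gamma> :: "real \<Rightarrow> 'a::metric_space"
  assumes ac: "abs_continuous a b \<gamma>" and N: "N \<in> null_sets lebesgue" "N \<subseteq> {a..b}"
  shows "content1 (\<gamma> ` N) = 0"
proof -
  have small: "content1 (\<gamma> ` (N \<inter> {a<..<b})) \<le> ennreal \<epsilon>" if "\<epsilon> > 0" for \<epsilon>
  proof -
    from abs_continuous_null_cover[OF ac N(1) \<open>\<epsilon> > 0\<close>]
    obtain s t :: "nat \<Rightarrow> real" where st: "\<forall>i. s i < t i \<longrightarrow> a \<le> s i \<and> t i \<le> b"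
      "N \<inter> {a<..<b} \<subseteq> (\<Union>i. {s i<..<t i})"
      and osc: "small_oscillation \<gamma> \<epsilon> s t" by blast
    have cont: "continuous_on {a..b} \<gamma>" by (rule abs_continuous_imp_continuous_on[OF ac])
    have "\<exists>p q. s i < t i \<longrightarrow> s i \<le> p \<and> p \<le> q \<and> q \<le> t i \<and>
        dist (\<gamma> p) (\<gamma> q) = diameter (\<gamma> ` {s i..t i}) \<and> bounded (\<gamma> ` {s i..t i})" for i
    proof (cases "s i < t i")
      case True
      then have "compact (\<gamma> ` {s i..t i})" "\<gamma> ` {s i..t i} \<noteq> {}"
        using st(1) by (auto intro!: compact_continuous_image continuous_on_subset[OF cont])
      then obtain x y where "x \<in> \<gamma> ` {s i..t i}" "y \<in> \<gamma> ` {s i..t i}" "dist x y = diameter (\<gamma> ` {s i..t i})"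
        "bounded (\<gamma> ` {s i..t i})"
        using diameter_compact_attained compact_imp_bounded by metis
      then obtain p q where pq: "p \<in> {s i..t i}" "q \<in> {s i..t i}" "dist (\<gamma> p) (\<gamma> q) = diameter (\<gamma> ` {s i..t i})"
        "bounded (\<gamma> ` {s i..t i})" by auto
      show ?thesis
        using pq by (intro exI[of _ "min p q"] exI[of _ "max p q"]) (auto simp: min_def max_def dist_commute)
    qed auto
    then obtain p q where pq: "\<And>i. s i < t i \<Longrightarrow> s i \<le> p i \<and> p i \<le> q i \<and> q i \<le> t i \<and>
        dist (\<gamma> (p i)) (\<gamma> (q i)) = diameter (\<gamma> ` {s i..t i}) \<and> bounded (\<gamma> ` {s i..t i})" by metis
    define C where "C i = \<gamma> ` {s i<..<t i}" for i
    have bdd: "bounded (C i)" for i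
      using pq[of i] by (cases "s i < t i") (auto simp: C_def intro: bounded_subset[of "\<gamma> ` {s i..t i}"])
    have "content1 (\<gamma> ` (N \<inter> {a<..<b})) \<le> (\<Sum>i. ennreal (diameter (C i)))"
    proof (rule content1_le)
      have "\<gamma> ` (N \<inter> {a<..<b}) \<subseteq> \<gamma> ` (\<Union>i. {s i<..<t i})" using st(2) by blast
      then show "\<gamma> ` (N \<inter> {a<..<b}) \<subseteq> (\<Union>i. C i)" by (simp add: C_def image_UN)
    qed (rule bdd)
    also have "\<dots> \<le> ennreal \<epsilon>"
    proof (rule small_oscillationD[OF osc, where p=p and q=q])
      fix i assume i: "s i < t i"
      have "diameter (C i) \<le> dist (\<gamma> (p i)) (\<gamma> (q i))"
        using pq[OF i] by (auto simp: C_def intro!: diameter_subset image_mono)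
      then show "s i \<le> p i \<and> p i \<le> q i \<and> q i \<le> t i \<and> ennreal (diameter (C i)) \<le> ennreal (dist (\<gamma> (p i)) (\<gamma> (q i)))"
        using pq[OF i] by (simp add: ennreal_leI)
    qed (simp add: C_def)
    finally show ?thesis .
  qed
  have "content1 (\<gamma> ` (N \<inter> {a<..<b})) \<le> 0"
    by (rule ennreal_le_epsilon) (simp add: small)
  then have in0: "content1 (\<gamma> ` (N \<inter> {a<..<b})) = 0" by simp
  have ends:  "content1 {\<gamma> a, \<gamma> b} = 0"
  proof -
    have "content1 {z} = 0" for z :: 'a using content1_le[of "{z}" "\<lambda>i. {z}"] by simp
    then show ?thesis using content1_zero_Un[of "{\<gamma> a}" "{\<gamma> b}"] by (simp add: insert_commute)
  qed
  have "\<gamma> ` N \<subseteq> \<gamma> ` (N \<inter> {a<..<b}) \<union> {\<gamma> a, \<gamma> b}"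
  proof
    fix z assume "z \<in> \<gamma> ` N"
    then obtain t where "t \<in> N" "z = \<gamma> t" by blast
    then show "z \<in> \<gamma> ` (N \<inter> {a<..<b}) \<union> {\<gamma> a, \<gamma> b}" using N(2) by (cases "t = a \<or> t = b") force+
  qed
  then show ?thesis by (rule content1_zero_subset[OF content1_zero_Un[OF in0 ends]])
qed

text \<open>A one-sided theorem of Sard's kind. For given \<open>\<epsilon>\<close> the points at which the slope is at most \<open>\<epsilon>\<close> on the
scale \<open>1 / (j + 1)\<close> form a relatively closed set, so the sets for different \<open>j\<close> can be separated by
disjoint Borel sets. On each of these \<open>\<phi>\<close> is locally \<open>\<epsilon>\<close>-Lipschitz, and their measures add up to at
most \<open>b - a\<close>.\<close>

lemma content1_image_flat_bounded:
  fixes \<phi> :: "real \<Rightarrow> 'a::metric_space"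
  assumes Q: "Q \<subseteq> {a<..<b}" and cont: "continuous_on Q \<phi>"
    and flat: "\<And>q \<epsilon>. q \<in> Q \<Longrightarrow> \<epsilon> > 0 \<Longrightarrow>
      \<exists>\<delta>>0. \<forall>q'\<in>Q. q - \<delta> < q' \<and> q' < q \<longrightarrow> dist (\<phi> q') (\<phi> q) \<le> \<epsilon> * (q - q')"
  shows "content1 (\<phi> ` Q) = 0"
proof -
  have le: "content1 (\<phi> ` Q) \<le> ennreal \<epsilon> * emeasure lborel {a<..<b}" if "\<epsilon> > 0" for \<epsilon>
  proof -
    define R where "R j = {q \<in> Q. \<forall>q'\<in>Q. q - 1 / real (Suc j) < q' \<and> q' < q \<longrightarrow>
        dist (\<phi> q') (\<phi> q) \<le> \<epsilon> * (q - q')}" for j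
    have closed: "q \<in> R j" if q: "q \<in> Q" "q \<in> closure (R j)" for q j
      unfolding R_def
    proof (intro CollectI conjI ballI impI, fact q(1))
      fix q' assume q': "q' \<in> Q" "q - 1 / real (Suc j) < q' \<and> q' < q"
      obtain s where s: "\<And>n. s n \<in> R j" "s \<longlonglongrightarrow> q" using q(2) closure_sequential by blast
      have sQ: "s n \<in> Q" for n using s(1) by (simp add: R_def)
      have lim: "(\<lambda>n. dist (\<phi> q') (\<phi> (s n))) \<longlonglongrightarrow> dist (\<phi> q') (\<phi> q)"
        by (intro tendsto_intros continuous_on_tendsto_compose[OF cont s(2) q(1)]) (simp add: sQ)
      have lim2: "(\<lambda>n. \<epsilon> * (s n - q')) \<longlonglongrightarrow> \<epsilon> * (q - q')" by (intro tendsto_intros s(2))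
      have ev: "\<forall>\<^sub>F n in sequentially. s n \<in> {q'<..<q' + 1 / real (Suc j)}"
        using q'(2) by (intro topological_tendstoD[OF s(2)]) auto
      have "\<forall>\<^sub>F n in sequentially. dist (\<phi> q') (\<phi> (s n)) \<le> \<epsilon> * (s n - q')"
        using ev
      proof eventually_elim
        case (elim n)
        have "s n \<in> R j" by (rule s(1))
        then show ?case using elim q'(1) unfolding R_def by auto
      qed
      then show "dist (\<phi> q') (\<phi> q) \<le> \<epsilon> * (q - q')"
        by (rule tendsto_le[OF trivial_limit_sequentially lim2 lim])
    qed
    define B where "B j = disjointed (\<lambda>j. closure (R j)) j \<inter> {a<..<b}" for j
    have Bm: "B j \<in> sets lborel" for j
      unfolding B_def disjointed_def by (auto intro!: sets.Int sets.Diff sets.finite_UN)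
    have Bdj: "disjoint_family B"
      using disjoint_family_disjointed[of "\<lambda>j. closure (R j)"]
      unfolding B_def disjoint_family_on_def by blast
    have sub: "Q \<inter> B j \<subseteq> R j" for j
      using closed disjointed_subset[of "\<lambda>j. closure (R j)" j] by (auto simp: B_def)
    have Bj: "content1 (\<phi> ` (Q \<inter> B j)) \<le> ennreal \<epsilon> * emeasure lborel (B j)" for j
    proof -
      define r where "r = 1 / real (Suc j)"
      have r: "r > 0" by (simp add: r_def)
      define J where "J n = {x. \<lfloor>x / r\<rfloor> = int_decode n}" for n
      have Jm: "J n \<in> sets borel" for n unfolding J_def by measurable
      have close: "x - y < r" if "x \<in> J n" "y \<in> J n" for x y n
      proof -
        have "\<lfloor>x / r\<rfloor> = \<lfloor>y / r\<rfloor>" using that by (simp add: J_def)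
        then have "x / r - y / r < 1" by linarith
        then show ?thesis using r by (simp add: field_simps)
      qed
      have Jdj: "disjoint_family (\<lambda>n. B j \<inter> J n)"
        unfolding disjoint_family_on_def J_def by auto (metis int_decode_inverse)
      have Jcov: "x \<in> J (int_encode \<lfloor>x / r\<rfloor>)" for x by (simp add: J_def)
      have cov: "(\<Union>n. B j \<inter> J n) = B j" using Jcov by blast
      have "\<phi> ` (Q \<inter> B j) = (\<Union>n. \<phi> ` (Q \<inter> (B j \<inter> J n)))" using Jcov by blast
      then have "content1 (\<phi> ` (Q \<inter> B j)) \<le> (\<Sum>n. content1 (\<phi> ` (Q \<inter> (B j \<inter> J n))))"
        using content1_UN[of "\<lambda>n. \<phi> ` (Q \<inter> (B j \<inter> J n))"] by simp
      also have "\<dots> \<le> (\<Sum>n. ennreal \<epsilon> * emeasure lborel (B j \<inter> J n))"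
      proof (intro suminf_le)
        fix n
        show "content1 (\<phi> ` (Q \<inter> (B j \<inter> J n))) \<le> ennreal \<epsilon> * emeasure lborel (B j \<inter> J n)"
        proof (rule content1_lipschitz_real)
          show "B j \<inter> J n \<in> sets lborel" using Bm[of j] Jm[of n] by auto
          show "B j \<inter> J n \<subseteq> {a<..<b}" by (auto simp: B_def)
          fix q q' assume q: "q \<in> Q \<inter> (B j \<inter> J n)" "q' \<in> Q \<inter> (B j \<inter> J n)" "q' < q"
          have "q \<in> R j" using q(1) sub by blast
          moreover have "q - 1 / real (Suc j) < q'" using close[of q n q'] q by (simp add: r_def)
          ultimately show "dist (\<phi> q') (\<phi> q) \<le> \<epsilon> * (q - q')" using q unfolding R_def by blast
        qed (use \<open>\<epsilon> > 0\<close> in auto)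
      qed auto
      also have "\<dots> = ennreal \<epsilon> * (\<Sum>n. emeasure lborel (B j \<inter> J n))" by simp
      also have "(\<Sum>n. emeasure lborel (B j \<inter> J n)) = emeasure lborel (\<Union>n. B j \<inter> J n)"
        using Jdj Bm[of j] Jm by (intro suminf_emeasure) auto
      also have "\<dots> = emeasure lborel (B j)" by (simp only: cov)
      finally show ?thesis .
    qed
    have cover: "Q \<subseteq> (\<Union>j. B j)"
    proof
      fix q assume q: "q \<in> Q"
      obtain \<delta> where d: "\<delta> > 0" "\<forall>q'\<in>Q. q - \<delta> < q' \<and> q' < q \<longrightarrow> dist (\<phi> q') (\<phi> q) \<le> \<epsilon> * (q - q')"
        using flat[OF q \<open>\<epsilon> > 0\<close>] by blast
      obtain j where "1 / real (Suc j) < \<delta>" using nat_approx_posE[OF d(1)] .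
      then have "q \<in> R j" using d(2) q unfolding R_def by fastforce
      then have "q \<in> (\<Union>j. closure (R j))" using closure_subset by blast
      then show "q \<in> (\<Union>j. B j)"
        using Q q UN_disjointed_eq[of "\<lambda>j. closure (R j)"] by (auto simp: B_def)
    qed
    have "content1 (\<phi> ` Q) \<le> content1 (\<Union>j. \<phi> ` (Q \<inter> B j))" using cover by (intro content1_mono) blast
    also have "\<dots> \<le> (\<Sum>j. content1 (\<phi> ` (Q \<inter> B j)))" by (rule content1_UN)
    also have "\<dots> \<le> (\<Sum>j. ennreal \<epsilon> * emeasure lborel (B j))" using Bj by (intro suminf_le) auto
    also have "\<dots> = ennreal \<epsilon> * (\<Sum>j. emeasure lborel (B j))" by simp
    also have "(\<Sum>j. emeasure lborel (B j)) = emeasure lborel (\<Union>j. B j)"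
      using Bm Bdj by (intro suminf_emeasure) auto
    also have "ennreal \<epsilon> * emeasure lborel (\<Union>j. B j) \<le> ennreal \<epsilon> * emeasure lborel {a<..<b}"
      by (intro mult_left_mono emeasure_mono) (auto simp: B_def)
    finally show ?thesis .
  qed
  show ?thesis
  proof (cases "a < b")
    case True
    have "content1 (\<phi> ` Q) \<le> 0"
    proof (rule ennreal_le_epsilon)
      fix e :: real assume "e > 0"
      have "content1 (\<phi> ` Q) \<le> ennreal (e / (b - a)) * emeasure lborel {a<..<b}"
        using \<open>e > 0\<close> True by (intro le) auto
      also have "\<dots> = ennreal (e / (b - a) * (b - a))"
        using \<open>e > 0\<close> True by (subst ennreal_mult) auto
      also have "e / (b - a) * (b - a) = e" using True by simp
      finally show "content1 (\<phi> ` Q) \<le> 0 + ennreal e" by simp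
    qed
    then show ?thesis by simp
  next
    case False
    then have "Q = {}" using Q by auto
    then show ?thesis by simp
  qed
qed

text \<open>The hypothesis for \<open>K = 1\<close> makes \<open>f\<close> injective on small pieces, with a 1-Lipschitz inverse \<open>\<phi>\<close>. The
hypothesis for all \<open>K\<close> says that \<open>\<phi>\<close> has one-sided derivative zero everywhere, so its image is null.\<close>

lemma content1_zero_of_descent:
  fixes P :: "'a::{metric_space, second_countable_topology} set" and \<kappa> f :: "'a \<Rightarrow> real"
  assumes inj: "inj_on \<kappa> P"
    and desc: "\<And>z K. z \<in> P \<Longrightarrow> K > 0 \<Longrightarrow> \<exists>\<delta>>0. \<forall>z'\<in>P. dist z' z < \<delta> \<and> \<kappa> z < \<kappa> z' \<longrightarrow>
      f z' \<le> f z - K * dist z' z"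
  shows "content1 P = 0"
proof -
  define R where "R j = {z \<in> P. \<forall>z'\<in>P. dist z' z < 1 / real (Suc j) \<and> \<kappa> z < \<kappa> z' \<longrightarrow> f z' \<le> f z - dist z' z}" for j
  obtain E :: "'a set" where E: "countable E" "\<And>X. open X \<Longrightarrow> X \<noteq> {} \<Longrightarrow> \<exists>d\<in>E. d \<in> X"
    using countable_dense_exists by blast
  define S where "S = (\<lambda>(j, d, n::int). R j \<inter> ball d (1 / (2 * real (Suc j))) \<inter> {z. f z \<in> {real_of_int n - 1<..<real_of_int n + 1}})"
  have zero: "content1 (S (j, d, n)) = 0" for j d n
  proof -
    define P' where "P' = S (j, d, n)"
    have P'P: "P' \<subseteq> P" "P' \<subseteq> R j" by (auto simp: P'_def S_def R_def)
    have near: "dist z z' < 1 / real (Suc j)" if "z \<in> P'" "z' \<in> P'" for z z'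
    proof -
      have "dist d z < 1 / (2 * real (Suc j))" "dist d z' < 1 / (2 * real (Suc j))"
        using that by (auto simp: P'_def S_def)
      then have "dist z z' < 1 / (2 * real (Suc j)) + 1 / (2 * real (Suc j))"
        using dist_triangle3[of z z' d] by linarith
      then show ?thesis by (simp add: field_simps)
    qed
    have ord: "f z' \<le> f z - dist z' z" if "z \<in> P'" "z' \<in> P'" "\<kappa> z < \<kappa> z'" for z z'
      using that near[of z' z] P'P unfolding R_def by blast
    have lip: "dist z z' \<le> \<bar>f z - f z'\<bar>" if "z \<in> P'" "z' \<in> P'" for z z'
    proof (cases "\<kappa> z = \<kappa> z'")
      case True
      then have "z = z'" using inj that P'P by (auto dest: inj_onD)
      then show ?thesis by simp
    next
      case False
      then show ?thesis using ord[of z z'] ord[of z' z] that by (cases "\<kappa> z < \<kappa> z'") (auto simp: dist_commute)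
    qed
    have injf: "inj_on f P'"
    proof (rule inj_onI)
      fix z z' assume "z \<in> P'" "z' \<in> P'" "f z = f z'"
      then show "z = z'" using lip[of z z'] by simp
    qed
    define \<phi> where "\<phi> = the_inv_into P' f"
    have phi: "\<phi> (f z) = z" if "z \<in> P'" for z unfolding \<phi>_def using injf that by (rule the_inv_into_f_f)
    have "content1 (\<phi> ` (f ` P')) = 0"
    proof (rule content1_image_flat_bounded)
      show "f ` P' \<subseteq> {real_of_int n - 1<..<real_of_int n + 1}" by (auto simp: P'_def S_def)
      show "continuous_on (f ` P') \<phi>"
        unfolding continuous_on_iff
      proof (intro ballI allI impI)
        fix q e :: real assume "q \<in> f ` P'" "e > 0"
        then show "\<exists>d>0. \<forall>q'\<in>f ` P'. dist q' q < d \<longrightarrow> dist (\<phi> q') (\<phi> q) < e"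
          using lip by (intro exI[of _ e]) (fastforce simp: phi dist_real_def)
      qed
      fix q \<epsilon> :: real assume q: "q \<in> f ` P'" and "\<epsilon> > 0"
      then obtain z where z: "z \<in> P'" "q = f z" by blast
      obtain \<delta> where d: "\<delta> > 0" "\<forall>z'\<in>P. dist z' z < \<delta> \<and> \<kappa> z < \<kappa> z' \<longrightarrow> f z' \<le> f z - (1/\<epsilon>) * dist z' z"
        using desc[of z "1/\<epsilon>"] z P'P \<open>\<epsilon> > 0\<close> by auto
      show "\<exists>\<delta>>0. \<forall>q'\<in>f ` P'. q - \<delta> < q' \<and> q' < q \<longrightarrow> dist (\<phi> q') (\<phi> q) \<le> \<epsilon> * (q - q')"
      proof (intro exI[of _ \<delta>] conjI ballI impI d(1))
        fix q' assume q': "q' \<in> f ` P'" "q - \<delta> < q' \<and> q' < q"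
        then obtain z' where z': "z' \<in> P'" "q' = f z'" by blast
        have "\<kappa> z < \<kappa> z'"
        proof (rule ccontr)
          assume "\<not> \<kappa> z < \<kappa> z'"
          moreover have "\<kappa> z \<noteq> \<kappa> z'" using inj z z' P'P q'(2) by (auto dest: inj_onD)
          ultimately have "f z \<le> f z' - dist z z'" using ord[of z' z] z z' by simp
          then show False using q'(2) z z' zero_le_dist[of z z'] by linarith
        qed
        moreover have "dist z' z < \<delta>" using lip[OF z'(1) z(1)] q'(2) z z' by auto
        ultimately have "f z' \<le> f z - (1/\<epsilon>) * dist z' z" using d(2) z' P'P by blast
        then have "dist z' z \<le> \<epsilon> * (f z - f z')" using \<open>\<epsilon> > 0\<close> by (simp add: field_simps)
        then show "dist (\<phi> q') (\<phi> q) \<le> \<epsilon> * (q - q')" using z z' phi by simp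
      qed
    qed
    moreover have "\<phi> ` (f ` P') = P'" using phi by (force simp: image_iff)
    ultimately show ?thesis by (simp add: P'_def)
  qed
  have "P \<subseteq> (\<Union>x\<in>UNIV \<times> E \<times> UNIV. S x)"
  proof
    fix z assume z: "z \<in> P"
    obtain \<delta> where d: "\<delta> > 0" "\<forall>z'\<in>P. dist z' z < \<delta> \<and> \<kappa> z < \<kappa> z' \<longrightarrow> f z' \<le> f z - 1 * dist z' z"
      using desc[OF z, of 1] by auto
    obtain j where "1 / real (Suc j) < \<delta>" using nat_approx_posE[OF d(1)] .
    then have "z \<in> R j" using d(2) z unfolding R_def by auto
    moreover obtain e where "e \<in> E" "e \<in> ball z (1 / (2 * real (Suc j)))"
      using E(2)[of "ball z (1 / (2 * real (Suc j)))"] by fastforce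
    moreover have "f z \<in> {real_of_int \<lfloor>f z\<rfloor> - 1<..<real_of_int \<lfloor>f z\<rfloor> + 1}" by simp linarith
    ultimately have "z \<in> S (j, e, \<lfloor>f z\<rfloor>)" by (auto simp: S_def dist_commute)
    then show "z \<in> (\<Union>x\<in>UNIV \<times> E \<times> UNIV. S x)" using \<open>e \<in> E\<close> by blast
  qed
  moreover have "content1 (\<Union>x\<in>UNIV \<times> E \<times> UNIV. S x) = 0"
    using zero E(1) by (intro content1_zero_countable_UN) auto
  ultimately show ?thesis using content1_zero_subset by blast
qed

section \<open>Energy\<close>

text \<open>The action integral of a nonnegative Lagrangian.\<close>

definition energy :: "(real \<times> real \<times> real \<Rightarrow> real) \<Rightarrow> (real \<Rightarrow> real) \<Rightarrow> real \<Rightarrow> real \<Rightarrow> ennreal" where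
  "energy \<Lambda> v a b = (\<integral>\<^sup>+x\<in>{a<..<b}. ennreal (\<Lambda> (x, v x, deriv v x)) \<partial>lborel)"

text \<open>Borel representatives of a function and of its derivative. They show that the integrand of the
energy is Borel up to a null set.\<close>

lemma abs_continuous_borel_derivative:
  assumes ac: "abs_continuous a b v" and ab: "a \<le> b"
  shows "\<exists>u g. u \<in> borel_measurable borel \<and> g \<in> borel_measurable borel \<and> (\<forall>x\<in>{a..b}. u x = v x) \<and>
    integrable lborel g \<and> v b - v a = (LINT x:{a..b}|lborel. g x) \<and>
    (AE x in lborel. x \<in> {a<..<b} \<longrightarrow> (v has_real_derivative g x) (at x))"
proof -
  obtain g where g: "g \<in> borel_measurable borel" "integrable lborel g"
    "\<forall>c d. a \<le> c \<longrightarrow> c \<le> d \<longrightarrow> d \<le> b \<longrightarrow> v d - v c = (LINT x:{c..d}|lborel. g x)"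
    "AE x in lborel. x \<in> {a<..<b} \<longrightarrow> (v has_real_derivative g x) (at x)"
    using abs_continuous_derivative[OF ac ab] by blast
  define u where "u x = v (max a (min b x))" for x
  have "continuous_on UNIV u"
    unfolding u_def
    by (rule continuous_on_compose2[OF abs_continuous_imp_continuous_on[OF ac]])
       (use ab in \<open>auto intro!: continuous_intros\<close>)
  then have "u \<in> borel_measurable borel" by (rule borel_measurable_continuous_onI)
  moreover have "\<forall>x\<in>{a..b}. u x = v x" by (auto simp: u_def)
  ultimately show ?thesis using g ab by blast
qed

lemma energy_density:
  assumes \<Lambda>: "\<Lambda> \<in> borel_measurable borel" and ac: "abs_continuous a b v" and ab: "a \<le> b"
  shows "\<exists>h. h \<in> borel_measurable borel \<and> (AE x in lborel. x \<in> {a<..<b} \<longrightarrow> h x = \<Lambda> (x, v x, deriv v x))"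
proof -
  obtain u g where ug: "u \<in> borel_measurable borel" "g \<in> borel_measurable borel" "\<forall>x\<in>{a..b}. u x = v x"
    "AE x in lborel. x \<in> {a<..<b} \<longrightarrow> (v has_real_derivative g x) (at x)"
    using abs_continuous_borel_derivative[OF ac ab] by blast
  define h where "h x = \<Lambda> (x, u x, g x)" for x
  have "h \<in> borel_measurable borel"
    unfolding h_def[abs_def] using ug(1,2) \<Lambda> by measurable
  moreover have "AE x in lborel. x \<in> {a<..<b} \<longrightarrow> h x = \<Lambda> (x, v x, deriv v x)"
    using ug(4) by eventually_elim (use ug(3) in \<open>auto simp: h_def DERIV_imp_deriv\<close>)
  ultimately show ?thesis by blast
qed

lemma set_nn_integral_split_interval:
  fixes h :: "real \<Rightarrow> ennreal"
  assumes "h \<in> borel_measurable borel" "a \<le> c" "c \<le> b"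
  shows "(\<integral>\<^sup>+x\<in>{a<..<b}. h x \<partial>lborel) = (\<integral>\<^sup>+x\<in>{a<..<c}. h x \<partial>lborel) + (\<integral>\<^sup>+x\<in>{c<..<b}. h x \<partial>lborel)"
proof -
  have "(\<integral>\<^sup>+x\<in>{a<..<b}. h x \<partial>lborel) = (\<integral>\<^sup>+x. h x * indicator {a<..<c} x + h x * indicator {c<..<b} x \<partial>lborel)"
  proof (rule nn_integral_cong_AE)
    have "AE x in lborel. x \<noteq> c" by (rule AE_lborel_singleton)
    then show "AE x in lborel. h x * indicator {a<..<b} x = h x * indicator {a<..<c} x + h x * indicator {c<..<b} x"
      by eventually_elim (use assms in \<open>auto simp: indicator_def\<close>)
  qed
  also have "\<dots> = (\<integral>\<^sup>+x\<in>{a<..<c}. h x \<partial>lborel) + (\<integral>\<^sup>+x\<in>{c<..<b}. h x \<partial>lborel)"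
    using assms(1) by (intro nn_integral_add) auto
  finally show ?thesis .
qed

lemma energy_split:
  assumes \<Lambda>: "\<Lambda> \<in> borel_measurable borel" and ac: "abs_continuous a b v" and c: "a \<le> c" "c \<le> b"
  shows "energy \<Lambda> v a b = energy \<Lambda> v a c + energy \<Lambda> v c b"
proof -
  have ab: "a \<le> b" using c by simp
  obtain h where h: "h \<in> borel_measurable borel" "AE x in lborel. x \<in> {a<..<b} \<longrightarrow> h x = \<Lambda> (x, v x, deriv v x)"
    using energy_density[OF \<Lambda> ac ab] by blast
  have eq: "energy \<Lambda> v p q = (\<integral>\<^sup>+x\<in>{p<..<q}. ennreal (h x) \<partial>lborel)" if "a \<le> p" "q \<le> b" for p q
    unfolding energy_def
  proof (rule nn_integral_cong_AE)
    show "AE x in lborel. ennreal (\<Lambda> (x, v x, deriv v x)) * indicator {p<..<q} x = ennreal (h x) * indicator {p<..<q} x"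
      using h(2) by eventually_elim (use that in \<open>auto simp: indicator_def\<close>)
  qed
  show ?thesis using set_nn_integral_split_interval[of "\<lambda>x. ennreal (h x)" a c b] h(1) c by (simp add: eq)
qed

lemma deriv_cong_open:
  fixes u v :: "real \<Rightarrow> real"
  assumes "\<And>x. x \<in> {a<..<b} \<Longrightarrow> u x = v x" "x \<in> {a<..<b}"
  shows "deriv u x = deriv v x"
proof (rule deriv_cong_ev[OF _ refl])
  have "open {a<..<b}" by simp
  then show "\<forall>\<^sub>F x in nhds x. u x = v x"
    using assms eventually_nhds by blast
qed

lemma energy_cong:
  assumes "\<And>x. x \<in> {a<..<b} \<Longrightarrow> u x = v x"
  shows "energy \<Lambda> u a b = energy \<Lambda> v a b"
  unfolding energy_def
  by (rule nn_integral_cong) (use assms deriv_cong_open[of a b u v] in \<open>auto simp: indicator_def\<close>)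

lemma energy_affine_le:
  assumes "a \<le> b" "\<And>x. x \<in> {a<..<b} \<Longrightarrow> \<Lambda> (x, p * (x - c) + q, p) \<le> C" 
  shows "energy \<Lambda> (\<lambda>x. p * (x - c) + q) a b \<le> ennreal (C * (b - a))"
proof (cases "a = b")
  case True
  then show ?thesis by (simp add: energy_def)
next
  case False
  have d: "deriv (\<lambda>x. p * (x - c) + q) x = p" for x
    by (rule DERIV_imp_deriv) (auto intro!: derivative_eq_intros)
  have "energy \<Lambda> (\<lambda>x. p * (x - c) + q) a b \<le> (\<integral>\<^sup>+x. ennreal C * indicator {a<..<b} x \<partial>lborel)"
    unfolding energy_def using assms(2) by (intro nn_integral_mono) (auto simp: indicator_def d intro: ennreal_leI)
  also have "\<dots> = ennreal C * ennreal (b - a)" using assms(1) by (simp add: nn_integral_cmult_indicator)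
  also have "\<dots> = ennreal (C * (b - a))" using assms(1) by (simp add: ennreal_mult'')
  finally show ?thesis .
qed

definition join_at :: "real \<Rightarrow> (real \<Rightarrow> real) \<Rightarrow> (real \<Rightarrow> real) \<Rightarrow> real \<Rightarrow> real" where
  "join_at c u v x = (if x \<le> c then u x else v x)"

lemma join_at_simps:
  "x \<le> c \<Longrightarrow> join_at c u v x = u x" "u c = v c \<Longrightarrow> c \<le> x \<Longrightarrow> join_at c u v x = v x"
  by (auto simp: join_at_def)

lemma abs_continuous_join_at:
  assumes "abs_continuous a c u" "abs_continuous c b v" "u c = v c" "a \<le> c" "c \<le> b"
  shows "abs_continuous a b (join_at c u v)"
  by (rule abs_continuous_join[where c=c])
     (auto intro: abs_continuous_cong[OF assms(1)] abs_continuous_cong[OF assms(2)] simp: join_at_simps assms)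

lemma energy_join_at:
  assumes "\<Lambda> \<in> borel_measurable borel"
    "abs_continuous a c u" "abs_continuous c b v" "u c = v c" "a \<le> c" "c \<le> b"
  shows "energy \<Lambda> (join_at c u v) a b = energy \<Lambda> u a c + energy \<Lambda> v c b"
proof -
  have "energy \<Lambda> (join_at c u v) a c = energy \<Lambda> u a c" by (rule energy_cong) (simp add: join_at_def)
  moreover have "energy \<Lambda> (join_at c u v) c b = energy \<Lambda> v c b" by (rule energy_cong) (simp add: join_at_def)
  ultimately show ?thesis
    using energy_split[OF assms(1) abs_continuous_join_at[OF assms(2-6)] assms(5,6)] by simp
qed

text \<open>Finite energy is included so that energies over complementary intervals can be cancelled.\<close>

definition near_minimizer :: "(real \<times> real \<times> real \<Rightarrow> real) \<Rightarrow> real \<Rightarrow> (real \<Rightarrow> real) \<Rightarrow> real \<Rightarrow> real \<Rightarrow> bool" where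
  "near_minimizer \<Lambda> e v a b \<longleftrightarrow> abs_continuous a b v \<and> energy \<Lambda> v a b < \<infinity> \<and>
     (\<forall>u. abs_continuous a b u \<longrightarrow> u a = v a \<longrightarrow> u b = v b \<longrightarrow> energy \<Lambda> v a b \<le> energy \<Lambda> u a b + ennreal e)"

text \<open>A competitor on the subinterval is extended by the function itself; the energy of the common part
is finite and cancels.\<close>

lemma near_minimizer_subinterval:
  assumes \<Lambda>: "\<Lambda> \<in> borel_measurable borel" and nm: "near_minimizer \<Lambda> e v a b"
    and cd: "a \<le> c" "c \<le> d" "d \<le> b"
  shows "near_minimizer \<Lambda> e v c d"
proof -
  have ac: "abs_continuous a b v" and fin: "energy \<Lambda> v a b < \<infinity>"
    using nm by (auto simp: near_minimizer_def)
  have acs: "abs_continuous a c v" "abs_continuous c d v" "abs_continuous d b v" "abs_continuous c b v"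
    using cd by (auto intro: abs_continuous_subinterval[OF ac])
  have split: "energy \<Lambda> v a b = energy \<Lambda> v a c + (energy \<Lambda> v c d + energy \<Lambda> v d b)"
    using energy_split[OF \<Lambda> ac, of c] energy_split[OF \<Lambda> acs(4), of d] cd by simp
  have "energy \<Lambda> v c d \<le> energy \<Lambda> u c d + ennreal e"
    if u: "abs_continuous c d u" "u c = v c" "u d = v d" for u
  proof -
    define q where "q = join_at c v (join_at d u v)"
    have ac1: "abs_continuous c b (join_at d u v)"
      using u acs cd by (intro abs_continuous_join_at) auto
    have ju: "join_at d u v c = v c" using u cd by (simp add: join_at_simps)
    have "abs_continuous a b q" unfolding q_def
      by (rule abs_continuous_join_at[OF acs(1) ac1]) (use ju cd in auto)
    moreover have "q a = v a" "q b = v b"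
      using cd u by (auto simp: q_def join_at_def)
    ultimately have "energy \<Lambda> v a b \<le> energy \<Lambda> q a b + ennreal e"
      using nm by (auto simp: near_minimizer_def)
    also have "energy \<Lambda> q a b = energy \<Lambda> v a c + (energy \<Lambda> u c d + energy \<Lambda> v d b)"
      unfolding q_def using energy_join_at[OF \<Lambda> acs(1) ac1] energy_join_at[OF \<Lambda> u(1) acs(3) u(3)] ju cd
      by simp
    finally have "(energy \<Lambda> v a c + energy \<Lambda> v d b) + energy \<Lambda> v c d \<le>
        (energy \<Lambda> v a c + energy \<Lambda> v d b) + (energy \<Lambda> u c d + ennreal e)"
      unfolding split by (simp add: ac_simps)
    moreover have "energy \<Lambda> v a c + energy \<Lambda> v d b < \<infinity>"
      using fin unfolding split by (auto simp: ennreal_add_eq_top less_top)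
    ultimately show ?thesis using ennreal_add_left_cancel_le by auto
  qed
  moreover have "energy \<Lambda> v c d < \<infinity>" using fin unfolding split by (auto simp: less_top)
  ultimately show ?thesis using acs(2) by (auto simp: near_minimizer_def)
qed

section \<open>Even convex superlinear growth\<close>

locale growth =
  fixes w :: "real \<Rightarrow> real"
  assumes conv: "convex_on UNIV w" and even: "w (- p) = w p" and zero: "w 0 = 0"
    and superlin: "superlinear w"
begin

lemma nonneg: "0 \<le> w p"
proof -
  have "w ((1 - 1/2) *\<^sub>R p + (1/2) *\<^sub>R (- p)) \<le> (1 - 1/2) * w p + (1/2) * w (- p)"
    by (rule convex_onD[OF conv]) auto
  then show ?thesis by (simp add: even zero)
qed

lemma scale_le: "0 \<le> t \<Longrightarrow> t \<le> 1 \<Longrightarrow> w (t * p) \<le> t * w p"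
  using convex_onD[OF conv, of t 0 p] by (simp add: zero)

lemma abs_arg: "w \<bar>p\<bar> = w p"
  by (cases "p \<ge> 0") (auto simp: even)

lemma mono: "0 \<le> p \<Longrightarrow> p \<le> q \<Longrightarrow> w p \<le> w q"
proof (cases "q = 0")
  case False
  assume pq: "0 \<le> p" "p \<le> q"
  then have "w ((p / q) * q) \<le> (p / q) * w q" using False by (intro scale_le) auto
  also have "\<dots> \<le> 1 * w q" using pq False nonneg by (intro mult_right_mono) auto
  finally show "w p \<le> w q" using False by simp
qed auto

text \<open>The perspective function \<open>\<xi> * w (D / \<xi>)\<close> is the least cost of climbing by \<open>D\<close> within the time \<open>\<xi>\<close>;
taking more time is cheaper.\<close>

lemma perspective_antimono:
  assumes "0 < \<xi>" "\<xi> \<le> \<xi>'"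
  shows "\<xi>' * w (D / \<xi>') \<le> \<xi> * w (D / \<xi>)"
proof -
  have "w ((\<xi> / \<xi>') * (D / \<xi>)) \<le> (\<xi> / \<xi>') * w (D / \<xi>)" using assms by (intro scale_le) auto
  then show ?thesis using assms by (simp add: field_simps)
qed

lemma slope_mono:
  assumes "0 < p" "p \<le> q"
  shows "w p / p \<le> w q / q"
  using scale_le[of "p / q" q] assms by (simp add: field_simps)

lemma continuous: "continuous_on UNIV w"
  by (rule convex_on_continuous[OF open_UNIV conv])

lemma superlinear_bound: "\<exists>M>0. \<forall>p\<ge>M. K * p \<le> w p"
proof -
  have "\<forall>\<^sub>F p in at_infinity. K \<le> w p / \<bar>p\<bar>"
    using superlin unfolding superlinear_def filterlim_at_top by blast
  then obtain M where M: "\<forall>p. M \<le> norm p \<longrightarrow> K \<le> w p / \<bar>p\<bar>" unfolding eventually_at_infinity by blast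
  have "K * p \<le> w p" if "p \<ge> max M 1" for p
    using M[rule_format, of p] that by (simp add: field_simps)
  then show ?thesis by (intro exI[of _ "max M 1"]) auto
qed

text \<open>Jensen's inequality, by integrating the supporting line of \<open>w\<close> at the mean slope.\<close>

lemma energy_ge:
  assumes lower: "\<And>x y p. w p \<le> \<Lambda> (x, y, p)"
    and ac: "abs_continuous a b v" and ab: "a < b"
  shows "ennreal ((b - a) * w ((v b - v a) / (b - a))) \<le> energy \<Lambda> v a b"
proof -
  obtain u g where g: "g \<in> borel_measurable borel"
    "integrable lborel g" "v b - v a = (LINT x:{a..b}|lborel. g x)"
    "AE x in lborel. x \<in> {a<..<b} \<longrightarrow> (v has_real_derivative g x) (at x)"
    using abs_continuous_borel_derivative[OF ac less_imp_le[OF ab]] by blast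
  define s where "s = (v b - v a) / (b - a)"
  obtain m where m: "\<And>p. w p \<ge> w s + m * (p - s)"
    using convex_le_Inf_differential[OF conv, of s] by (metis UNIV_I interior_UNIV)
  define h where "h x = w s + m * (g x - s)" for x
  have "set_integrable lborel {a..b} g"
    unfolding set_integrable_def using g(2) by (intro integrable_mult_indicator) auto
  moreover have const: "set_integrable lborel {a..b} (\<lambda>x. k)" for k :: real
    unfolding set_integrable_def by (intro integrable_real_indicator[THEN integrable_scaleR_left])
      (auto simp: emeasure_lborel_Icc_eq)
  ultimately have hi: "set_integrable lborel {a..b} h"
    and "(LINT x:{a..b}|lborel. h x) = (LINT x:{a..b}|lborel. w s - m * s) + m * (LINT x:{a..b}|lborel. g x)"
  proof -
    assume g': "set_integrable lborel {a..b} g"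
    have heq: "h = (\<lambda>x. (w s - m * s) + m * g x)" by (auto simp: h_def algebra_simps)
    show "set_integrable lborel {a..b} h" unfolding heq
      using g' const by (intro set_integral_add(1)) auto
    show "(LINT x:{a..b}|lborel. h x) = (LINT x:{a..b}|lborel. w s - m * s) + m * (LINT x:{a..b}|lborel. g x)"
      unfolding heq using g' const by (subst set_integral_add(2)) auto
  qed
  note hint = this(2)
  have "(LINT x:{a..b}|lborel. w s - m * s) = (b - a) * (w s - m * s)"
    using ab by (simp add: set_lebesgue_integral_def)
  then have "(LINT x:{a..b}|lborel. h x) = (b - a) * w s"
    unfolding hint g(3)[symmetric] using ab by (simp add: s_def field_simps)
  then have "ennreal ((b - a) * w s) = ennreal (\<integral>x. indicator {a..b} x *\<^sub>R h x \<partial>lborel)"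
    by (simp add: set_lebesgue_integral_def)
  also have "\<dots> \<le> (\<integral>\<^sup>+x. ennreal (indicator {a..b} x *\<^sub>R h x) \<partial>lborel)"
  proof -
    have i: "integrable lborel (\<lambda>x. indicator {a..b} x *\<^sub>R h x)" using hi by (simp add: set_integrable_def)
    have "(\<integral>x. indicator {a..b} x *\<^sub>R h x \<partial>lborel) \<le> (\<integral>x. max 0 (indicator {a..b} x *\<^sub>R h x) \<partial>lborel)"
      using i by (intro integral_mono integrable_max) auto
    then have "ennreal (\<integral>x. indicator {a..b} x *\<^sub>R h x \<partial>lborel) \<le> ennreal (\<integral>x. max 0 (indicator {a..b} x *\<^sub>R h x) \<partial>lborel)"
      by (rule ennreal_leI)
    also have "\<dots> = (\<integral>\<^sup>+x. ennreal (max 0 (indicator {a..b} x *\<^sub>R h x)) \<partial>lborel)"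
      using i by (intro nn_integral_eq_integral[symmetric] integrable_max) auto
    also have "\<dots> = (\<integral>\<^sup>+x. ennreal (indicator {a..b} x *\<^sub>R h x) \<partial>lborel)"
      by (intro nn_integral_cong) (simp add: max_def ennreal_neg)
    finally show ?thesis .
  qed
  also have "\<dots> \<le> energy \<Lambda> v a b"
    unfolding energy_def
  proof (rule nn_integral_mono_AE)
    have "AE x in lborel. x \<noteq> a" "AE x in lborel. x \<noteq> b" by (rule AE_lborel_singleton)+
    then show "AE x in lborel. ennreal (indicator {a..b} x *\<^sub>R h x) \<le> ennreal (\<Lambda> (x, v x, deriv v x)) * indicator {a<..<b} x"
      using g(4)
    proof eventually_elim
      case (elim x)
      have "h x \<le> \<Lambda> (x, v x, g x)" using m[of "g x"] lower[of "g x" x "v x"] by (simp add: h_def)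
      then show ?case using elim by (auto simp: indicator_def DERIV_imp_deriv intro: ennreal_leI)
    qed
  qed
  finally show ?thesis by (simp add: s_def)
qed

text \<open>Superlinear growth in the form in which it is used: above some slope every unit of height costs at
least \<open>K\<close>.\<close>

lemma steep_rise_cost:
  assumes lower: "\<And>x y p. w p \<le> \<Lambda> (x, y, p)" and "K \<ge> 0"
  shows "\<exists>M>0. \<forall>v a b. abs_continuous a b v \<longrightarrow> a < b \<longrightarrow> M * (b - a) \<le> v b - v a \<longrightarrow>
    ennreal (K * (v b - v a)) \<le> energy \<Lambda> v a b"
proof -
  obtain M where M: "M > 0" "\<forall>p\<ge>M. K * p \<le> w p" using superlinear_bound by blast
  show ?thesis
  proof (intro exI[of _ M] conjI allI impI M(1))
    fix v and a b :: real assume v: "abs_continuous a b v" "a < b" "M * (b - a) \<le> v b - v a"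
    then have "M \<le> (v b - v a) / (b - a)" by (simp add: field_simps)
    then have "K * ((v b - v a) / (b - a)) \<le> w ((v b - v a) / (b - a))" using M(2) by blast
    then have "(b - a) * (K * ((v b - v a) / (b - a))) \<le> (b - a) * w ((v b - v a) / (b - a))"
      using v(2) by (intro mult_left_mono) auto
    moreover have "(b - a) * (K * ((v b - v a) / (b - a))) = K * (v b - v a)" using v(2) by simp
    ultimately have "ennreal (K * (v b - v a)) \<le> ennreal ((b - a) * w ((v b - v a) / (b - a)))"
      by (intro ennreal_leI) simp
    also have "\<dots> \<le> energy \<Lambda> v a b" by (rule energy_ge[OF lower v(1,2)])
    finally show "ennreal (K * (v b - v a)) \<le> energy \<Lambda> v a b" .
  qed
qed

end

section \<open>Near-minimizers, reflections and singular points\<close>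

locale bounded_growth = growth +
  fixes \<Lambda> :: "real \<times> real \<times> real \<Rightarrow> real"
  assumes borel: "\<Lambda> \<in> borel_measurable borel"
    and lower: "w p \<le> \<Lambda> (x, y, p)"
    and local_bound: "\<exists>U. open U \<and> z \<in> U \<and> bdd_above (\<Lambda> ` U)"
begin

lemma box_bound: "\<exists>C\<ge>0. \<forall>x y p. \<bar>x\<bar> \<le> r \<longrightarrow> \<bar>y\<bar> \<le> r \<longrightarrow> \<bar>p\<bar> \<le> r \<longrightarrow> \<Lambda> (x, y, p) \<le> C"
proof -
  define K where "K = {-r..r} \<times> {-r..r} \<times> {-r..r}"
  have K: "compact K" unfolding K_def by (intro compact_Times) auto
  obtain U where U: "\<And>z. open (U z)" "\<And>z. z \<in> U z" "\<And>z. bdd_above (\<Lambda> ` U z)"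
    using local_bound by metis
  have "K \<subseteq> (\<Union>z\<in>K. U z)" using U(2) by blast
  then obtain F where F: "F \<subseteq> K" "finite F" "K \<subseteq> (\<Union>z\<in>F. U z)"
    using compactE_image[OF K, of K U] U(1) by blast
  have "bdd_above (\<Union>z\<in>F. \<Lambda> ` U z)" using F(2) by induction (use U(3) in auto)
  then obtain C where C: "\<forall>c\<in>(\<Union>z\<in>F. \<Lambda> ` U z). c \<le> C" unfolding bdd_above_def by blast
  have "\<Lambda> (x, y, p) \<le> max C 0" if "\<bar>x\<bar> \<le> r" "\<bar>y\<bar> \<le> r" "\<bar>p\<bar> \<le> r" for x y p
  proof -
    have "(x, y, p) \<in> K" using that by (auto simp: K_def)
    then obtain z where "z \<in> F" "(x, y, p) \<in> U z" using F(3) by blast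
    then have "\<Lambda> (x, y, p) \<le> C" using C by blast
    then show ?thesis by simp
  qed
  then show ?thesis by (intro exI[of _ "max C 0"]) auto
qed

lemma affine_energy_finite: "energy \<Lambda> (\<lambda>x. p * (x - c) + q) a b < \<infinity>"
proof (cases "a \<le> b")
  case True
  define r where "r = \<bar>a\<bar> + \<bar>b\<bar> + \<bar>p\<bar> + \<bar>p\<bar> * (\<bar>a\<bar> + \<bar>b\<bar> + \<bar>c\<bar>) + \<bar>q\<bar>"
  obtain C where C: "\<forall>x y p. \<bar>x\<bar> \<le> r \<longrightarrow> \<bar>y\<bar> \<le> r \<longrightarrow> \<bar>p\<bar> \<le> r \<longrightarrow> \<Lambda> (x, y, p) \<le> C"
    using box_bound by blast
  have "energy \<Lambda> (\<lambda>x. p * (x - c) + q) a b \<le> ennreal (C * (b - a))"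
  proof (rule energy_affine_le[OF True])
    fix x assume x: "x \<in> {a<..<b}"
    have x': "\<bar>x\<bar> \<le> \<bar>a\<bar> + \<bar>b\<bar>" using x by auto
    have "\<bar>p * (x - c)\<bar> \<le> \<bar>p\<bar> * (\<bar>a\<bar> + \<bar>b\<bar> + \<bar>c\<bar>)"
      using x' unfolding abs_mult by (intro mult_left_mono) auto
    moreover have "0 \<le> \<bar>p\<bar> * (\<bar>a\<bar> + \<bar>b\<bar> + \<bar>c\<bar>)" by simp
    ultimately show "\<Lambda> (x, p * (x - c) + q, p) \<le> C"
      using x' unfolding r_def by (intro C[unfolded r_def, rule_format]) linarith+
  qed
  then show ?thesis by (rule le_less_trans) simp
next
  case False
  then show ?thesis by (simp add: energy_def)
qed

end

text \<open>The constant is moved through the positive and negative parts of the integrand, of which the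
negative part is bounded.\<close>

lemma action_eq_energy:
  assumes L: "L \<in> borel_measurable borel" and L': "\<And>z. L z = \<Lambda> z + k" and nonneg: "\<And>z. 0 \<le> \<Lambda> z"
    and ac: "abs_continuous a b v" and ab: "a \<le> b"
  shows "action L v a b = enn2ereal (energy \<Lambda> v a b) + ereal (k * (b - a))"
proof -
  have \<Lambda>: "\<Lambda> \<in> borel_measurable borel"
  proof -
    have "\<Lambda> = (\<lambda>z. L z - k)" using L' by auto
    then show ?thesis using L by simp
  qed
  obtain h0 where h0: "h0 \<in> borel_measurable borel" "AE x in lborel. x \<in> {a<..<b} \<longrightarrow> h0 x = \<Lambda> (x, v x, deriv v x)"
    using energy_density[OF \<Lambda> ac ab] by blast
  define h where "h x = max 0 (h0 x)" for x
  have h: "h \<in> borel_measurable borel" "AE x in lborel. x \<in> {a<..<b} \<longrightarrow> h x = \<Lambda> (x, v x, deriv v x)" "\<And>x. 0 \<le> h x"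
    using h0 nonneg by (auto simp: h_def[abs_def] max_def elim!: eventually_mono)
  have P: "(\<integral>\<^sup>+x\<in>{a<..<b}. ennreal (L (x, v x, deriv v x)) \<partial>lborel) = (\<integral>\<^sup>+x\<in>{a<..<b}. ennreal (h x + k) \<partial>lborel)"
    using h(2) by (intro nn_integral_cong_AE) (auto elim!: eventually_mono simp: L' indicator_def)
  have N: "(\<integral>\<^sup>+x\<in>{a<..<b}. ennreal (- L (x, v x, deriv v x)) \<partial>lborel) = (\<integral>\<^sup>+x\<in>{a<..<b}. ennreal (- (h x + k)) \<partial>lborel)"
    using h(2) by (intro nn_integral_cong_AE) (auto elim!: eventually_mono simp: L' indicator_def)
  have E: "energy \<Lambda> v a b = (\<integral>\<^sup>+x\<in>{a<..<b}. ennreal (h x) \<partial>lborel)"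
    unfolding energy_def using h(2) by (intro nn_integral_cong_AE) (auto elim!: eventually_mono simp: indicator_def)
  have const: "(\<integral>\<^sup>+x\<in>{a<..<b}. ennreal c \<partial>lborel) = ennreal (c * (b - a))" if "c \<ge> 0" for c
    using ab that by (simp add: nn_integral_cmult_indicator ennreal_mult)
  \<comment> \<open>The identity \<open>(h + k)\<^sup>+ + k\<^sup>- = h + k\<^sup>+ + (h + k)\<^sup>-\<close> of positive and negative parts.\<close>
  have pt: "ennreal (h x + k) + ennreal (max 0 (- k)) = ennreal (h x) + ennreal (max 0 k) + ennreal (- (h x + k))" for x
  proof -
    have "ennreal (h x + k) = ennreal (max 0 (h x + k))" "ennreal (- (h x + k)) = ennreal (max 0 (- (h x + k)))"
      by (simp_all add: max_def ennreal_neg)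
    moreover have "max 0 (h x + k) + max 0 (- k) = h x + max 0 k + max 0 (- (h x + k))"
      using h(3)[of x] by (auto simp: max_def)
    ultimately show ?thesis using h(3)[of x] by (simp flip: ennreal_plus)
  qed
  have "(\<integral>\<^sup>+x\<in>{a<..<b}. ennreal (h x + k) + ennreal (max 0 (- k)) \<partial>lborel) =
      (\<integral>\<^sup>+x\<in>{a<..<b}. ennreal (h x) + ennreal (max 0 k) + ennreal (- (h x + k)) \<partial>lborel)"
    by (simp only: pt)
  then have id: "(\<integral>\<^sup>+x\<in>{a<..<b}. ennreal (h x + k) \<partial>lborel) + ennreal (max 0 (- k) * (b - a)) =
      energy \<Lambda> v a b + ennreal (max 0 k * (b - a)) + (\<integral>\<^sup>+x\<in>{a<..<b}. ennreal (- (h x + k)) \<partial>lborel)"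
    unfolding E using h(1) by (simp add: nn_integral_add const distrib_right)
  have "(\<integral>\<^sup>+x\<in>{a<..<b}. ennreal (- (h x + k)) \<partial>lborel) \<le> (\<integral>\<^sup>+x\<in>{a<..<b}. ennreal (max 0 (- k)) \<partial>lborel)"
  proof (intro nn_integral_mono mult_right_mono ennreal_leI)
    show "- (h x + k) \<le> max 0 (- k)" for x using h(3)[of x] by auto
  qed simp
  also have "\<dots> < \<infinity>" by (simp add: const)
  finally obtain n where n: "0 \<le> n" "(\<integral>\<^sup>+x\<in>{a<..<b}. ennreal (- (h x + k)) \<partial>lborel) = ennreal n"
    by (auto simp: less_top_ennreal)
  define l where "l = b - a"
  have l: "l \<ge> 0" using ab by (simp add: l_def)
  have kk: "k = max 0 k - max 0 (- k)" by (simp add: max_def)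
  show ?thesis
  proof (cases "energy \<Lambda> v a b")
    case top
    then have "(\<integral>\<^sup>+x\<in>{a<..<b}. ennreal (h x + k) \<partial>lborel) = \<infinity>"
      using id by (auto simp: ennreal_add_eq_top)
    then show ?thesis unfolding action_def P N n(2) using top by simp
  next
    case (real r)
    then have "(\<integral>\<^sup>+x\<in>{a<..<b}. ennreal (h x + k) \<partial>lborel) + ennreal (max 0 (- k) * l) = ennreal (r + max 0 k * l + n)"
      using id n l by (simp add: l_def ennreal_plus)
    moreover from this have "(\<integral>\<^sup>+x\<in>{a<..<b}. ennreal (h x + k) \<partial>lborel) \<noteq> \<infinity>" by auto
    then obtain q where q: "0 \<le> q" "(\<integral>\<^sup>+x\<in>{a<..<b}. ennreal (h x + k) \<partial>lborel) = ennreal q"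
      by (cases "(\<integral>\<^sup>+x\<in>{a<..<b}. ennreal (h x + k) \<partial>lborel)") auto
    ultimately have "ennreal (q + max 0 (- k) * l) = ennreal (r + max 0 k * l + n)"
      using l by (simp add: ennreal_plus)
    then have "q + max 0 (- k) * l = r + max 0 k * l + n"
      using q(1) n(1) real(1) l by (subst (asm) ennreal_inj) auto
    then have "q - n = r + k * l" by (subst kk) (simp add: algebra_simps)
    then show ?thesis unfolding action_def P N n(2) q(2) real(2)
      using q(1) n(1) real(1) by (simp add: enn2ereal_ennreal l_def)
  qed
qed

text \<open>The affine competitor has finite action. Hence the minimal action is a real number and the small
excess bounds the difference of two finite actions.\<close>

lemma (in bounded_growth) near_minimizer_of_excess:
  assumes L: "L \<in> borel_measurable borel" and L': "\<And>z. L z = \<Lambda> z + k"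
    and ac: "abs_continuous a b v" and ab: "a < b" and "e > 0" and ex: "excess L v a b < ereal e"
  shows "near_minimizer \<Lambda> e v a b"
proof -
  have nn: "0 \<le> \<Lambda> z" for z using lower nonneg by (metis order_trans prod_cases3)
  define A where "A u = action L u a b" for u
  have A: "A u = enn2ereal (energy \<Lambda> u a b) + ereal (k * (b - a))" if "abs_continuous a b u" for u
    unfolding A_def by (rule action_eq_energy[OF L L' nn that less_imp_le[OF ab]])
  define m where "m = min_action L a (v a) b (v b)"
  have m_le: "m \<le> A u" if "abs_continuous a b u" "u a = v a" "u b = v b" for u
    unfolding m_def min_action_def A_def using that by (intro INF_lower) auto
  define p where "p = (v b - v a) / (b - a)"
  have "m \<le> A (\<lambda>x. p * (x - a) + v a)"
    using ab by (intro m_le abs_continuous_affine) (auto simp: p_def)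
  also have "\<dots> < \<infinity>"
    using affine_energy_finite[of p a "v a" a b] A[OF abs_continuous_affine, of p a "v a"]
    by (auto simp: less_top_ennreal enn2ereal_ennreal)
  finally have m1: "m \<noteq> \<infinity>" by simp
  have "ereal (k * (b - a)) \<le> m"
    unfolding m_def min_action_def
  proof (rule INF_greatest)
    fix u assume "u \<in> {u. abs_continuous a b u \<and> u a = v a \<and> u b = v b}"
    then have "action L u a b = enn2ereal (energy \<Lambda> u a b) + ereal (k * (b - a))" using A[of u] by (simp add: A_def)
    then show "ereal (k * (b - a)) \<le> action L u a b" by (simp add: ereal_le_add_self2)
  qed
  then have m2: "m \<noteq> - \<infinity>" by auto
  obtain M where M: "m = ereal M" using m1 m2 by (cases m) auto
  have "A v - m < ereal e" using ex by (simp add: excess_def A_def m_def)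
  then have Av: "A v < ereal (M + e)" unfolding M by (cases "A v") auto
  have fin: "energy \<Lambda> v a b < \<infinity>"
  proof (rule ccontr)
    assume "\<not> ?thesis"
    then have "energy \<Lambda> v a b = \<infinity>" by (metis infinity_ennreal_def top.not_eq_extremum)
    then show False using A[OF ac] Av by simp
  qed
  moreover have "energy \<Lambda> v a b \<le> energy \<Lambda> u a b + ennreal e"
    if u: "abs_continuous a b u" "u a = v a" "u b = v b" for u
  proof (cases "energy \<Lambda> u a b")
    case (real r)
    obtain s where s: "0 \<le> s" "energy \<Lambda> v a b = ennreal s" using fin by (auto simp: less_top_ennreal)
    have "A v < A u + ereal e" using Av m_le[OF u] unfolding M by (cases "A u") (auto intro: less_le_trans)
    then have "s < r + e"
      unfolding A[OF ac] A[OF u(1)] real(2) s(2) using real(1) s(1) by (simp add: enn2ereal_ennreal)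
    then show ?thesis unfolding real(2) s(2) using real(1) \<open>e > 0\<close>
      by (simp flip: ennreal_plus add: ennreal_leI)
  qed simp
  ultimately show ?thesis using ac by (auto simp: near_minimizer_def)
qed

text \<open>Its energy at \<open>\<lambda>x. - v x\<close> is the energy of \<open>\<Lambda>\<close> at \<open>v\<close>.\<close>

definition reflect_y :: "(real \<times> real \<times> real \<Rightarrow> real) \<Rightarrow> real \<times> real \<times> real \<Rightarrow> real" where
  "reflect_y \<Lambda> = (\<lambda>(x, y, p). \<Lambda> (x, - y, - p))"

text \<open>Its energy at \<open>\<lambda>x. v (- x)\<close> is the energy of \<open>\<Lambda>\<close> at \<open>v\<close>, over the reflected interval.\<close>

definition reflect_x :: "(real \<times> real \<times> real \<Rightarrow> real) \<Rightarrow> real \<times> real \<times> real \<Rightarrow> real" where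
  "reflect_x \<Lambda> = (\<lambda>(x, y, p). \<Lambda> (- x, y, - p))"

lemma borel_measurable_compose_continuous:
  fixes \<Lambda> :: "'b::topological_space \<Rightarrow> real" and T :: "'a::topological_space \<Rightarrow> 'b"
  assumes "\<Lambda> \<in> borel_measurable borel" "continuous_on UNIV T"
  shows "(\<lambda>z. \<Lambda> (T z)) \<in> borel_measurable borel"
  using measurable_compose[OF borel_measurable_continuous_onI[OF assms(2)] assms(1)] .

lemma borel_measurable_reflect:
  assumes "\<Lambda> \<in> borel_measurable borel"
  shows "reflect_y \<Lambda> \<in> borel_measurable borel" "reflect_x \<Lambda> \<in> borel_measurable borel"
  unfolding reflect_y_def reflect_x_def case_prod_beta
  by (intro borel_measurable_compose_continuous[OF assms] continuous_intros)+

lemma reflect_reflect [simp]: "reflect_y (reflect_y \<Lambda>) = \<Lambda>" "reflect_x (reflect_x \<Lambda>) = \<Lambda>"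
  by (auto simp: reflect_x_def reflect_y_def)

lemma abs_continuous_uminus: "abs_continuous a b v \<Longrightarrow> abs_continuous a b (\<lambda>x. - v x :: real)"
  by (erule abs_continuous_lipschitz_compose[where B=1]) (simp add: dist_real_def)

lemma abs_continuous_reflect:
  assumes "abs_continuous a b v"
  shows "abs_continuous (- b) (- a) (\<lambda>x. v (- x))"
  unfolding abs_continuous_def
proof (intro allI impI)
  fix \<epsilon> :: real assume "\<epsilon> > 0"
  then obtain \<delta> where "\<delta> > 0" and
    D: "\<And>(n::nat) s t. (\<forall>i<n. a \<le> s i \<and> s i \<le> t i \<and> t i \<le> b) \<Longrightarrow>
        disjoint_family_on (\<lambda>i. {s i<..<t i}) {..<n} \<Longrightarrow>
        (\<Sum>i<n. t i - s i) < \<delta> \<Longrightarrow> (\<Sum>i<n. dist (v (s i)) (v (t i))) < \<epsilon>"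
    using assms unfolding abs_continuous_def by meson
  show "\<exists>\<delta>>0. \<forall>(n::nat) s t. (\<forall>i<n. - b \<le> s i \<and> s i \<le> t i \<and> t i \<le> - a) \<longrightarrow>
        disjoint_family_on (\<lambda>i. {s i<..<t i}) {..<n} \<longrightarrow>
        (\<Sum>i<n. t i - s i) < \<delta> \<longrightarrow> (\<Sum>i<n. dist (v (- s i)) (v (- t i))) < \<epsilon>"
  proof (intro exI[of _ \<delta>] conjI allI impI)
    fix n :: nat and s t
    assume *: "\<forall>i<n. - b \<le> s i \<and> s i \<le> t i \<and> t i \<le> - a"
      "disjoint_family_on (\<lambda>i. {s i<..<t i}) {..<n}" "(\<Sum>i<n. t i - s i) < \<delta>"
    have "(\<Sum>i<n. dist (v (- t i)) (v (- s i))) < \<epsilon>"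
    proof (rule D)
      show "\<forall>i<n. a \<le> - t i \<and> - t i \<le> - s i \<and> - s i \<le> b" using *(1) by fastforce
      show "disjoint_family_on (\<lambda>i. {- t i<..<- s i}) {..<n}"
        unfolding disjoint_family_on_def
      proof (intro ballI impI)
        fix i j assume ij: "i \<in> {..<n}" "j \<in> {..<n}" "i \<noteq> j"
        show "{- t i<..<- s i} \<inter> {- t j<..<- s j} = {}"
        proof (rule ccontr)
          assume "\<not> ?thesis"
          then obtain z where "z \<in> {- t i<..<- s i}" "z \<in> {- t j<..<- s j}" by blast
          then have "- z \<in> {s i<..<t i} \<inter> {s j<..<t j}" by auto
          then show False using *(2) ij unfolding disjoint_family_on_def by blast
        qed
      qed
      show "(\<Sum>i<n. - s i - - t i) < \<delta>" using *(3) by simp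
    qed
    then show "(\<Sum>i<n. dist (v (- s i)) (v (- t i))) < \<epsilon>" by (simp add: dist_commute)
  qed (fact \<open>\<delta> > 0\<close>)
qed

lemma energy_reflect_y:
  assumes ac: "abs_continuous a b v"
  shows "energy (reflect_y \<Lambda>) (\<lambda>x. - v x) a b = energy \<Lambda> v a b"
proof (cases "a \<le> b")
  case True
  obtain u g where g: "AE x in lborel. x \<in> {a<..<b} \<longrightarrow> (v has_real_derivative g x) (at x)"
    using abs_continuous_borel_derivative[OF ac True] by blast
  show ?thesis
    unfolding energy_def
  proof (rule nn_integral_cong_AE)
    show "AE x in lborel. ennreal (reflect_y \<Lambda> (x, - v x, deriv (\<lambda>x. - v x) x)) * indicator {a<..<b} x =
        ennreal (\<Lambda> (x, v x, deriv v x)) * indicator {a<..<b} x"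
      using g
    proof eventually_elim
      case (elim x)
      show ?case
      proof (cases "x \<in> {a<..<b}")
        case True
        then have d: "(v has_real_derivative g x) (at x)" using elim by blast
        then have "((\<lambda>x. - v x) has_real_derivative - g x) (at x)" by (rule DERIV_minus)
        with d show ?thesis by (simp add: DERIV_imp_deriv reflect_y_def)
      qed simp
    qed
  qed
qed (simp add: energy_def)

lemma energy_reflect_x:
  assumes \<Lambda>: "\<Lambda> \<in> borel_measurable borel" and ac: "abs_continuous a b v"
  shows "energy (reflect_x \<Lambda>) (\<lambda>x. v (- x)) (- b) (- a) = energy \<Lambda> v a b"
proof (cases "a \<le> b")
  case True
  obtain u g where g: "u \<in> borel_measurable borel" "g \<in> borel_measurable borel" "\<forall>x\<in>{a..b}. u x = v x"
    "AE x in lborel. x \<in> {a<..<b} \<longrightarrow> (v has_real_derivative g x) (at x)"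
    using abs_continuous_borel_derivative[OF ac True] by blast
  define h where "h x = ennreal (\<Lambda> (x, u x, g x)) * indicator {a<..<b} x" for x
  have hm: "h \<in> borel_measurable borel" unfolding h_def[abs_def] using g(1,2) \<Lambda> by measurable
  have E: "energy \<Lambda> v a b = (\<integral>\<^sup>+x. h x \<partial>lborel)"
    unfolding energy_def h_def using g(4)
    by (intro nn_integral_cong_AE) (auto elim!: eventually_mono simp: indicator_def DERIV_imp_deriv g(3))
  have g': "AE x in lborel. - x \<in> {a<..<b} \<longrightarrow> (v has_real_derivative g (- x)) (at (- x))"
  proof -
    have "AE x in distr lborel borel uminus. x \<in> {a<..<b} \<longrightarrow> (v has_real_derivative g x) (at x)"
      unfolding lborel_distr_uminus by (rule g(4))
    from AE_distrD[OF _ this] show ?thesis by simp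
  qed
  have "energy (reflect_x \<Lambda>) (\<lambda>x. v (- x)) (- b) (- a) = (\<integral>\<^sup>+x. h (- x) \<partial>lborel)"
    unfolding energy_def
  proof (rule nn_integral_cong_AE)
    show "AE x in lborel. ennreal (reflect_x \<Lambda> (x, v (- x), deriv (\<lambda>x. v (- x)) x)) * indicator {- b<..<- a} x = h (- x)"
      using g'
    proof eventually_elim
      case (elim x)
      show ?case
      proof (cases "- x \<in> {a<..<b}")
        case True
        then have d: "(v has_real_derivative g (- x)) (at (- x))" using elim by blast
        have "((\<lambda>x. v (- x)) has_real_derivative - g (- x)) (at x)"
          using DERIV_chain2[where f=v and g=uminus and x=x, OF d DERIV_minus[OF DERIV_ident]] by simp
        with True show ?thesis using g(3) by (auto simp: DERIV_imp_deriv reflect_x_def h_def)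
      qed (auto simp: h_def)
    qed
  qed
  also have "\<dots> = (\<integral>\<^sup>+x. h x \<partial>distr lborel borel uminus)"
    using hm by (subst nn_integral_distr) auto
  also have "\<dots> = (\<integral>\<^sup>+x. h x \<partial>lborel)" by (simp add: lborel_distr_uminus)
  finally show ?thesis by (simp add: E)
qed (simp add: energy_def)

lemma near_minimizer_reflect_y:
  assumes "near_minimizer \<Lambda> e v a b"
  shows "near_minimizer (reflect_y \<Lambda>) e (\<lambda>x. - v x) a b"
proof -
  have ac: "abs_continuous a b v" using assms by (simp add: near_minimizer_def)
  have "energy \<Lambda> v a b \<le> energy (reflect_y \<Lambda>) u a b + ennreal e"
    if u: "abs_continuous a b u" "u a = - v a" "u b = - v b" for u
  proof -
    have "energy \<Lambda> v a b \<le> energy \<Lambda> (\<lambda>x. - u x) a b + ennreal e"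
      using assms abs_continuous_uminus[OF u(1)] u(2,3) by (auto simp: near_minimizer_def)
    also have "energy \<Lambda> (\<lambda>x. - u x) a b = energy (reflect_y \<Lambda>) u a b"
      using energy_reflect_y[OF u(1), of "reflect_y \<Lambda>"] by simp
    finally show ?thesis .
  qed
  then show ?thesis
    using assms ac abs_continuous_uminus[OF ac] by (auto simp: near_minimizer_def energy_reflect_y)
qed

lemma near_minimizer_reflect_x:
  assumes \<Lambda>: "\<Lambda> \<in> borel_measurable borel" and "near_minimizer \<Lambda> e v a b"
  shows "near_minimizer (reflect_x \<Lambda>) e (\<lambda>x. v (- x)) (- b) (- a)"
proof -
  have ac: "abs_continuous a b v" using assms by (simp add: near_minimizer_def)
  have \<Lambda>': "reflect_x \<Lambda> \<in> borel_measurable borel"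
    by (rule borel_measurable_reflect[OF \<Lambda>])
  have "energy \<Lambda> v a b \<le> energy (reflect_x \<Lambda>) u (- b) (- a) + ennreal e"
    if u: "abs_continuous (- b) (- a) u" "u (- b) = v b" "u (- a) = v a" for u
  proof -
    have "energy \<Lambda> v a b \<le> energy \<Lambda> (\<lambda>x. u (- x)) a b + ennreal e"
      using assms abs_continuous_reflect[OF u(1)] u(2,3) by (auto simp: near_minimizer_def)
    also have "energy \<Lambda> (\<lambda>x. u (- x)) a b = energy (reflect_x \<Lambda>) u (- b) (- a)"
      using energy_reflect_x[OF \<Lambda>' u(1)] by simp
    finally show ?thesis .
  qed
  then show ?thesis
    using assms ac abs_continuous_reflect[OF ac] by (auto simp: near_minimizer_def energy_reflect_x)
qed

lemma (in bounded_growth) bounded_growth_reflect_y: "bounded_growth w (reflect_y \<Lambda>)"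
proof unfold_locales
  show "reflect_y \<Lambda> \<in> borel_measurable borel"
    by (rule borel_measurable_reflect[OF borel])
  show "w p \<le> reflect_y \<Lambda> (x, y, p)" for x y p
    using lower[of "- p" x "- y"] by (simp add: reflect_y_def even)
  fix z :: "real \<times> real \<times> real"
  define T where "T z = (fst z, - fst (snd z), - snd (snd z))" for z :: "real \<times> real \<times> real"
  obtain U where U: "open U" "T z \<in> U" "bdd_above (\<Lambda> ` U)" using local_bound[of "T z"] by blast
  have "continuous_on UNIV T" unfolding T_def by (intro continuous_intros)
  with U(1) have op: "open (T -` U)" by (rule open_vimage)
  have "reflect_y \<Lambda> ` (T -` U) \<subseteq> \<Lambda> ` U" by (auto simp: reflect_y_def T_def)
  then have "bdd_above (reflect_y \<Lambda> ` (T -` U))" by (rule bdd_above_mono[OF U(3)])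
  with op U(2) show "\<exists>U. open U \<and> z \<in> U \<and> bdd_above (reflect_y \<Lambda> ` U)"
    by (intro exI[of _ "T -` U"]) simp
qed

lemma (in bounded_growth) bounded_growth_reflect_x: "bounded_growth w (reflect_x \<Lambda>)"
proof unfold_locales
  show "reflect_x \<Lambda> \<in> borel_measurable borel"
    by (rule borel_measurable_reflect[OF borel])
  show "w p \<le> reflect_x \<Lambda> (x, y, p)" for x y p
    using lower[of "- p" "- x" y] by (simp add: reflect_x_def even)
  fix z :: "real \<times> real \<times> real"
  define T where "T z = (- fst z, fst (snd z), - snd (snd z))" for z :: "real \<times> real \<times> real"
  obtain U where U: "open U" "T z \<in> U" "bdd_above (\<Lambda> ` U)" using local_bound[of "T z"] by blast
  have "continuous_on UNIV T" unfolding T_def by (intro continuous_intros)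
  with U(1) have op: "open (T -` U)" by (rule open_vimage)
  have "reflect_x \<Lambda> ` (T -` U) \<subseteq> \<Lambda> ` U" by (auto simp: reflect_x_def T_def)
  then have "bdd_above (reflect_x \<Lambda> ` (T -` U))" by (rule bdd_above_mono[OF U(3)])
  with op U(2) show "\<exists>U. open U \<and> z \<in> U \<and> bdd_above (reflect_x \<Lambda> ` U)"
    by (intro exI[of _ "T -` U"]) simp
qed

text \<open>The property of generalized minimizers on which the proof rests: on compact subintervals they are
uniformly close to functions that minimize the energy up to a small error.\<close>

definition limit_of_minimizers :: "(real \<times> real \<times> real \<Rightarrow> real) \<Rightarrow> (real \<Rightarrow> real) \<Rightarrow> real \<Rightarrow> real \<Rightarrow> bool" where
  "limit_of_minimizers \<Lambda> u a b \<longleftrightarrow> (\<forall>p q e. a < p \<longrightarrow> p \<le> q \<longrightarrow> q < b \<longrightarrow> e > 0 \<longrightarrow>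
     (\<exists>v. near_minimizer \<Lambda> e v p q \<and> (\<forall>x\<in>{p..q}. \<bar>v x - u x\<bar> < e)))"

lemma limit_of_minimizers_reflect_y:
  assumes "limit_of_minimizers \<Lambda> u a b"
  shows "limit_of_minimizers (reflect_y \<Lambda>) (\<lambda>x. - u x) a b"
  unfolding limit_of_minimizers_def
proof (intro allI impI)
  fix p q e assume *: "a < p" "p \<le> q" "q < b" "(e::real) > 0"
  then obtain v where "near_minimizer \<Lambda> e v p q" "\<forall>x\<in>{p..q}. \<bar>v x - u x\<bar> < e"
    using assms unfolding limit_of_minimizers_def by blast
  then show "\<exists>v. near_minimizer (reflect_y \<Lambda>) e v p q \<and> (\<forall>x\<in>{p..q}. \<bar>v x - - u x\<bar> < e)"
    by (intro exI[of _ "\<lambda>x. - v x"]) (auto intro: near_minimizer_reflect_y)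
qed

lemma limit_of_minimizers_reflect_x:
  assumes \<Lambda>: "\<Lambda> \<in> borel_measurable borel" and "limit_of_minimizers \<Lambda> u a b"
  shows "limit_of_minimizers (reflect_x \<Lambda>) (\<lambda>x. u (- x)) (- b) (- a)"
  unfolding limit_of_minimizers_def
proof (intro allI impI)
  fix p q e assume *: "- b < p" "p \<le> q" "q < - a" "(e::real) > 0"
  then have "a < - q" "- q \<le> - p" "- p < b" by auto
  then obtain v where v: "near_minimizer \<Lambda> e v (- q) (- p)" "\<forall>x\<in>{-q..-p}. \<bar>v x - u x\<bar> < e"
    using assms *(4) unfolding limit_of_minimizers_def by blast
  show "\<exists>v. near_minimizer (reflect_x \<Lambda>) e v p q \<and> (\<forall>x\<in>{p..q}. \<bar>v x - u (- x)\<bar> < e)"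
    using near_minimizer_reflect_x[OF \<Lambda> v(1)] v(2) by (intro exI[of _ "\<lambda>x. v (- x)"]) auto
qed

text \<open>By compactness, locally uniform convergence is uniform on \<open>{p..q}\<close>; near-minimality passes to this
subinterval.\<close>

lemma (in bounded_growth) limit_of_minimizers_generalized:
  assumes L: "L \<in> borel_measurable borel" and L': "\<And>z. L z = \<Lambda> z + k"
    and gm: "generalized_minimizer L a b u"
  shows "limit_of_minimizers \<Lambda> u a b"
  unfolding limit_of_minimizers_def
proof (intro allI impI)
  fix p q e :: real assume pq: "a < p" "p \<le> q" "q < b" and "e > 0"
  obtain \<alpha> \<beta> :: "nat \<Rightarrow> real" and v where
    ac: "\<forall>n. \<alpha> n < \<beta> n \<and> abs_continuous (\<alpha> n) (\<beta> n) (v n)"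
    and ex: "(\<lambda>n. excess L (v n) (\<alpha> n) (\<beta> n)) \<longlonglongrightarrow> 0"
    and loc: "\<forall>x\<in>{a<..<b}. \<exists>d>0. cball x d \<subseteq> {a<..<b} \<and>
           (\<forall>\<^sub>F n in sequentially. cball x d \<subseteq> {\<alpha> n..\<beta> n}) \<and>
           uniform_limit (cball x d) v u sequentially"
    using gm unfolding generalized_minimizer_def by blast
  have "\<forall>x\<in>{p..q}. \<exists>d>0. \<forall>\<^sub>F n in sequentially. cball x d \<subseteq> {\<alpha> n..\<beta> n} \<and> (\<forall>y\<in>cball x d. \<bar>v n y - u y\<bar> < e)"
  proof
    fix x assume "x \<in> {p..q}"
    then have "x \<in> {a<..<b}" using pq by auto
    then obtain d where d: "d > 0" "\<forall>\<^sub>F n in sequentially. cball x d \<subseteq> {\<alpha> n..\<beta> n}"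
      "uniform_limit (cball x d) v u sequentially" using loc by blast
    have "\<forall>\<^sub>F n in sequentially. \<forall>y\<in>cball x d. dist (v n y) (u y) < e"
      using d(3) \<open>e > 0\<close> unfolding uniform_limit_iff by blast
    with d(2) have "\<forall>\<^sub>F n in sequentially. cball x d \<subseteq> {\<alpha> n..\<beta> n} \<and> (\<forall>y\<in>cball x d. \<bar>v n y - u y\<bar> < e)"
      by eventually_elim (auto simp: dist_real_def)
    with d(1) show "\<exists>d>0. \<forall>\<^sub>F n in sequentially. cball x d \<subseteq> {\<alpha> n..\<beta> n} \<and> (\<forall>y\<in>cball x d. \<bar>v n y - u y\<bar> < e)"
      by blast
  qed
  from bchoice[OF this] obtain d where d: "\<forall>x\<in>{p..q}. d x > 0 \<and>
      (\<forall>\<^sub>F n in sequentially. cball x (d x) \<subseteq> {\<alpha> n..\<beta> n} \<and> (\<forall>y\<in>cball x (d x). \<bar>v n y - u y\<bar> < e))" by blast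
  have cov: "{p..q} \<subseteq> (\<Union>x\<in>{p..q}. ball x (d x))" using d by fastforce
  obtain F where F: "F \<subseteq> {p..q}" "finite F" "{p..q} \<subseteq> (\<Union>x\<in>F. ball x (d x))"
    using compactE_image[of "{p..q}" "{p..q}" "\<lambda>x. ball x (d x)", OF compact_Icc _ cov] by auto
  have "\<forall>\<^sub>F n in sequentially. \<forall>x\<in>F. cball x (d x) \<subseteq> {\<alpha> n..\<beta> n} \<and> (\<forall>y\<in>cball x (d x). \<bar>v n y - u y\<bar> < e)"
    using F(1,2) d by (intro eventually_ball_finite) auto
  moreover have "\<forall>\<^sub>F n in sequentially. excess L (v n) (\<alpha> n) (\<beta> n) < ereal e"
    using ex \<open>e > 0\<close> by (intro order_tendstoD(2)) auto
  ultimately have "\<forall>\<^sub>F n in sequentially. (\<forall>x\<in>F. cball x (d x) \<subseteq> {\<alpha> n..\<beta> n} \<and> (\<forall>y\<in>cball x (d x). \<bar>v n y - u y\<bar> < e))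
      \<and> excess L (v n) (\<alpha> n) (\<beta> n) < ereal e" by eventually_elim auto
  then obtain n where n: "\<forall>x\<in>F. cball x (d x) \<subseteq> {\<alpha> n..\<beta> n} \<and> (\<forall>y\<in>cball x (d x). \<bar>v n y - u y\<bar> < e)"
      "excess L (v n) (\<alpha> n) (\<beta> n) < ereal e"
    using eventually_happens'[OF sequentially_bot] by blast
  have cl: "x \<in> {\<alpha> n..\<beta> n} \<and> \<bar>v n x - u x\<bar> < e" if x: "x \<in> {p..q}" for x
  proof -
    obtain y where "y \<in> F" "x \<in> ball y (d y)" using F(3) x by blast
    then have "x \<in> cball y (d y)" by auto
    then show ?thesis using n(1) \<open>y \<in> F\<close> by blast
  qed
  have nm: "near_minimizer \<Lambda> e (v n) (\<alpha> n) (\<beta> n)"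
    using ac \<open>e > 0\<close> n(2) by (intro near_minimizer_of_excess[OF L L']) simp_all
  have ends: "\<alpha> n \<le> p" "q \<le> \<beta> n" using cl[of p] cl[of q] pq(2) by simp_all
  have "near_minimizer \<Lambda> e (v n) p q"
    by (rule near_minimizer_subinterval[OF borel nm ends(1) pq(2) ends(2)])
  then show "\<exists>v. near_minimizer \<Lambda> e v p q \<and> (\<forall>x\<in>{p..q}. \<bar>v x - u x\<bar> < e)" using cl by blast
qed

text \<open>Singular points whose derivative from the right is \<open>+\<infinity>\<close>. Reflections in the axes reduce the three
other kinds to this one.\<close>

definition right_singular :: "(real \<times> real \<times> real \<Rightarrow> real) \<Rightarrow> (real \<times> real) set" where
  "right_singular \<Lambda> = {(x0, y0). \<exists>b u. x0 < b \<and> continuous_on {x0..b} u \<and> u x0 = y0 \<and>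
     limit_of_minimizers \<Lambda> u x0 b \<and>
     filterlim (\<lambda>x. (u x - u x0) / (x - x0)) at_top (at_right x0)}"

lemma limit_of_minimizers_mono:
  "limit_of_minimizers \<Lambda> u a b \<Longrightarrow> a \<le> c \<Longrightarrow> d \<le> b \<Longrightarrow> limit_of_minimizers \<Lambda> u c d"
  unfolding limit_of_minimizers_def by (meson le_less_trans less_le_trans)

lemma (in bounded_growth) universal_singular_cases:
  assumes L: "L \<in> borel_measurable borel" and L': "\<And>z. L z = \<Lambda> z + k"
    and z: "(x0, y0) \<in> universal_singular_set L"
  shows "(x0, y0) \<in> right_singular \<Lambda> \<or> (x0, - y0) \<in> right_singular (reflect_y \<Lambda>) \<or>
    (- x0, y0) \<in> right_singular (reflect_x \<Lambda>) \<or> (- x0, - y0) \<in> right_singular (reflect_y (reflect_x \<Lambda>))"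
proof -
  obtain a b u where ab: "a < b" "a \<le> x0" "x0 \<le> b" and gm: "generalized_minimizer L a b u" and u: "u x0 = y0"
    and inf: "filterlim (\<lambda>x. (u x - u x0) / (x - x0)) at_top (at x0 within {a..b}) \<or>
         filterlim (\<lambda>x. (u x - u x0) / (x - x0)) at_bot (at x0 within {a..b})"
    using z unfolding universal_singular_set_def by auto
  have lim: "limit_of_minimizers \<Lambda> u a b" by (rule limit_of_minimizers_generalized[OF L L' gm])
  have cont: "continuous_on {a..b} u" using gm by (simp add: generalized_minimizer_def)
  show ?thesis
  proof (cases "x0 < b")
    case True
    have le: "at_right x0 \<le> at x0 within {a..b}"
    proof -
      have "at_right x0 = at x0 within {x0..b}" using True by (simp add: at_within_Icc_at_right)
      also have "\<dots> \<le> at x0 within {a..b}" using ab by (intro at_le) auto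
      finally show ?thesis .
    qed
    have c: "continuous_on {x0..b} u" using ab by (intro continuous_on_subset[OF cont]) auto
    have l: "limit_of_minimizers \<Lambda> u x0 b" using ab by (intro limit_of_minimizers_mono[OF lim]) auto
    from inf show ?thesis
    proof
      assume "filterlim (\<lambda>x. (u x - u x0) / (x - x0)) at_top (at x0 within {a..b})"
      then have "filterlim (\<lambda>x. (u x - u x0) / (x - x0)) at_top (at_right x0)"
        using le by (rule filterlim_mono[OF _ order_refl])
      then show ?thesis using True c l u unfolding right_singular_def by blast
    next
      assume "filterlim (\<lambda>x. (u x - u x0) / (x - x0)) at_bot (at x0 within {a..b})"
      then have "filterlim (\<lambda>x. (u x - u x0) / (x - x0)) at_bot (at_right x0)"
        using le by (rule filterlim_mono[OF _ order_refl])
      then have "filterlim (\<lambda>x. - ((u x - u x0) / (x - x0))) at_top (at_right x0)"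
        by (simp add: filterlim_uminus_at_top)
      then have "filterlim (\<lambda>x. (- u x - - u x0) / (x - x0)) at_top (at_right x0)"
        by (simp add: minus_divide_left)
      moreover have "continuous_on {x0..b} (\<lambda>x. - u x)" using c by (intro continuous_intros)
      ultimately have "(x0, - y0) \<in> right_singular (reflect_y \<Lambda>)"
        using True u limit_of_minimizers_reflect_y[OF l] unfolding right_singular_def
        by (intro CollectI case_prodI exI[of _ b] exI[of _ "\<lambda>x. - u x"]) auto
      then show ?thesis by blast
    qed
  next
    case False
    then have x0: "x0 = b" "a < x0" using ab by auto
    have le: "at_left x0 \<le> at x0 within {a..b}"
    proof -
      have "at_left x0 = at x0 within {a..x0}" using x0 by (simp add: at_within_Icc_at_left)
      also have "\<dots> \<le> at x0 within {a..b}" using ab by (intro at_le) auto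
      finally show ?thesis .
    qed
    define r where "r x = u (- x)" for x
    have c: "continuous_on {- x0..- a} r"
      unfolding r_def using x0 by (intro continuous_on_compose2[OF cont] continuous_intros) auto
    have l: "limit_of_minimizers (reflect_x \<Lambda>) r (- x0) (- a)"
      using limit_of_minimizers_reflect_x[OF borel lim] x0 by (simp add: r_def[abs_def])
    have flip: "filterlim (\<lambda>x. - ((r x - r (- x0)) / (x - - x0))) F (at_right (- x0))"
      if "filterlim (\<lambda>x. (u x - u x0) / (x - x0)) F (at x0 within {a..b})" for F
    proof -
      have "filterlim (\<lambda>x. (u x - u x0) / (x - x0)) F (at_left x0)"
        using that le by (rule filterlim_mono[OF _ order_refl])
      then have "filterlim (\<lambda>x. (u (- x) - u x0) / (- x - x0)) F (at_right (- x0))"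
        by (simp add: filterlim_at_left_to_right)
      moreover have "(u (- x) - u x0) / (- x - x0) = - ((r x - r (- x0)) / (x - - x0))" for x
        unfolding r_def by (metis add_uminus_conv_diff minus_add_distrib minus_diff_eq minus_divide_right minus_minus)
      ultimately show ?thesis by simp
    qed
    from inf show ?thesis
    proof
      assume "filterlim (\<lambda>x. (u x - u x0) / (x - x0)) at_bot (at x0 within {a..b})"
      from flip[OF this] have "filterlim (\<lambda>x. (r x - r (- x0)) / (x - - x0)) at_top (at_right (- x0))"
        by (simp add: filterlim_uminus_at_top)
      then have "(- x0, y0) \<in> right_singular (reflect_x \<Lambda>)"
        using x0 u c l unfolding right_singular_def
        by (intro CollectI case_prodI exI[of _ "- a"] exI[of _ r]) (auto simp: r_def)
      then show ?thesis by blast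
    next
      assume "filterlim (\<lambda>x. (u x - u x0) / (x - x0)) at_top (at x0 within {a..b})"
      from flip[OF this] have "filterlim (\<lambda>x. (- r x - - r (- x0)) / (x - - x0)) at_top (at_right (- x0))"
        by (simp add: minus_divide_left)
      moreover have "continuous_on {- x0..- a} (\<lambda>x. - r x)" using c by (intro continuous_intros)
      ultimately have "(- x0, - y0) \<in> right_singular (reflect_y (reflect_x \<Lambda>))"
        using x0 u limit_of_minimizers_reflect_y[OF l] unfolding right_singular_def
        by (intro CollectI case_prodI exI[of _ "- a"] exI[of _ "\<lambda>x. - r x"]) (auto simp: r_def)
      then show ?thesis by blast
    qed
  qed
qed

section \<open>The value function\<close>

lemma last_zero:
  fixes f :: "real \<Rightarrow> real"
  assumes "continuous_on {p..r} f" "p \<le> r" "f p \<le> 0" "0 \<le> f r"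
  shows "\<exists>s\<in>{p..r}. f s = 0 \<and> (\<forall>t\<in>{s..r}. 0 \<le> f t)"
proof -
  define Z where "Z = {t \<in> {p..r}. f t = 0}"
  have Z: "Z = f -` {0} \<inter> {p..r}" by (auto simp: Z_def)
  have "\<forall>B. closed B \<longrightarrow> closed (f -` B \<inter> {p..r})"
    using continuous_on_closed_vimage[of "{p..r}" f] assms(1) by simp
  then have "closed Z" unfolding Z by simp
  moreover have "bounded Z" by (rule bounded_subset[of "{p..r}"]) (auto simp: Z_def)
  moreover obtain t0 where "t0 \<in> {p..r}" "f t0 = 0"
    using IVT'[of f p 0 r] assms by auto
  then have "Z \<noteq> {}" by (auto simp: Z_def)
  ultimately obtain s where s: "s \<in> Z" "\<forall>t\<in>Z. t \<le> s"
    using compact_attains_sup[of Z] by (auto simp: compact_eq_bounded_closed)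
  have "0 \<le> f t" if t: "t \<in> {s..r}" for t
  proof (rule ccontr)
    assume "\<not> 0 \<le> f t"
    then have ft: "f t \<le> 0" "f t \<noteq> 0" by auto
    have ps: "p \<le> s" using s(1) by (simp add: Z_def)
    have "continuous_on {t..r} f"
      using ps t by (intro continuous_on_subset[OF assms(1)]) auto
    then obtain x where x: "t \<le> x" "x \<le> r" "f x = 0"
      using IVT'[of f t 0 r] assms(4) t ft by auto
    then have "x \<in> Z" "t < x" using ps t ft by (auto simp: Z_def less_le)
    then show False using s(2) t by fastforce
  qed
  then show ?thesis using s(1) by (auto simp: Z_def)
qed

lemma first_zero:
  fixes f :: "real \<Rightarrow> real"
  assumes "continuous_on {p..r} f" "p \<le> r" "0 \<le> f p" "f r \<le> 0"
  shows "\<exists>s\<in>{p..r}. f s = 0 \<and> (\<forall>t\<in>{p..s}. 0 \<le> f t)"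
proof -
  have c: "continuous_on {-r..-p} (\<lambda>x. f (- x))"
    by (rule continuous_on_compose2[OF assms(1)]) (auto intro!: continuous_intros)
  have "-r \<le> -p" "f (- (-r)) \<le> 0" "0 \<le> f (- (-p))" using assms by auto
  from last_zero[OF c this] obtain s where s: "s \<in> {-r..-p}" "f (- s) = 0" "\<forall>t\<in>{s..-p}. 0 \<le> f (- t)" by blast
  have "0 \<le> f t" if "t \<in> {p..- s}" for t
    using s(3)[rule_format, of "- t"] that by auto
  then show ?thesis using s by (intro bexI[of _ "- s"]) auto
qed

text \<open>The constraint keeps a competitor from diving: a segment of slope \<open>-1\<close> that starts slightly above the
initial point of the path soon meets it, while an unconstrained path might fall more steeply than any
segment whose cost is under control.\<close>

definition rising_paths :: "real \<Rightarrow> real \<Rightarrow> real \<times> real \<Rightarrow> (real \<Rightarrow> real) set" where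
  "rising_paths X Y z = {v. abs_continuous (fst z) X v \<and> v (fst z) = snd z \<and> v X = Y \<and>
     (\<forall>t\<in>{fst z..X}. snd z \<le> v t)}"

definition value_fn :: "(real \<times> real \<times> real \<Rightarrow> real) \<Rightarrow> real \<Rightarrow> real \<Rightarrow> real \<times> real \<Rightarrow> ennreal" where
  "value_fn \<Lambda> X Y z = (INF v\<in>rising_paths X Y z. energy \<Lambda> v (fst z) X)"

context bounded_growth
begin

lemma value_fn_finite:
  assumes "x < X" "y \<le> Y"
  shows "value_fn \<Lambda> X Y (x, y) < \<infinity>"
proof -
  define p where "p = (Y - y) / (X - x)"
  have p: "p \<ge> 0" using assms by (simp add: p_def)
  have "p * (X - x) + y = Y" using assms(1) by (simp add: p_def)
  moreover have "y \<le> p * (t - x) + y" if "t \<in> {x..X}" for t using p that by simp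
  ultimately have "(\<lambda>t. p * (t - x) + y) \<in> rising_paths X Y (x, y)"
    unfolding rising_paths_def by (simp add: abs_continuous_affine)
  then have "value_fn \<Lambda> X Y (x, y) \<le> energy \<Lambda> (\<lambda>t. p * (t - x) + y) x X"
    unfolding value_fn_def by (intro INF_lower2[of "\<lambda>t. p * (t - x) + y"]) simp_all
  also have "\<dots> < \<infinity>" by (rule affine_energy_finite)
  finally show ?thesis .
qed

text \<open>Between two crossings a path may be replaced by a near-minimizer.\<close>

lemma splice_near_minimizer:
  assumes v: "abs_continuous x X v" and n: "near_minimizer \<Lambda> e n c' c"
    and ord: "x \<le> c'" "c' \<le> c" "c \<le> X" and eq: "v c' = n c'" "n c = v c"
  shows "abs_continuous x X (join_at c' v (join_at c n v))"
    "energy \<Lambda> (join_at c' v (join_at c n v)) x X \<le> energy \<Lambda> v x X + ennreal e"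
proof -
  have acn: "abs_continuous c' c n" using n by (simp add: near_minimizer_def)
  have acv: "abs_continuous x c' v" "abs_continuous c' c v" "abs_continuous c X v" "abs_continuous c' X v"
    using ord by (auto intro: abs_continuous_subinterval[OF v])
  have j: "v c' = join_at c n v c'" using ord eq by (simp add: join_at_def)
  have acj: "abs_continuous c' X (join_at c n v)"
    by (rule abs_continuous_join_at[OF acn acv(3)]) (use ord eq in auto)
  show "abs_continuous x X (join_at c' v (join_at c n v))"
    by (rule abs_continuous_join_at[OF acv(1) acj j]) (use ord in auto)
  have "energy \<Lambda> (join_at c' v (join_at c n v)) x X = energy \<Lambda> v x c' + (energy \<Lambda> n c' c + energy \<Lambda> v c X)"
    using energy_join_at[OF borel acv(1) acj j] energy_join_at[OF borel acn acv(3) eq(2)] ord by simp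
  also have "\<dots> \<le> energy \<Lambda> v x c' + ((energy \<Lambda> v c' c + ennreal e) + energy \<Lambda> v c X)"
    using n acv(2) eq by (intro add_left_mono add_right_mono) (auto simp: near_minimizer_def)
  also have "\<dots> = energy \<Lambda> v x X + ennreal e"
    using energy_split[OF borel v, of c'] energy_split[OF borel acv(4), of c] ord by (simp add: ac_simps)
  finally show "energy \<Lambda> (join_at c' v (join_at c n v)) x X \<le> energy \<Lambda> v x X + ennreal e" .
qed

text \<open>Let \<open>c\<close> be the last point at which \<open>v\<close> catches up with the near-minimizer \<open>n\<close>. If \<open>v\<close> is above \<open>n\<close>
somewhere on \<open>{a1..xh}\<close> there is also an earlier crossing, and replacing \<open>v\<close> by \<open>n\<close> between the two gives
a path above the level \<open>y1\<close> beyond \<open>xh\<close>. Otherwise \<open>n\<close> is above \<open>v\<close> from \<open>a1\<close> on. Then the line of slope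
\<open>-1\<close> from \<open>(a1, n a1)\<close> leads down to \<open>v\<close> at some \<open>d\<close>, because \<open>v\<close> does not fall below \<open>y0\<close>; following
this line and then \<open>v\<close> up to \<open>c\<close> gives a competitor for \<open>n\<close>.\<close>

lemma splice_dichotomy:
  assumes v: "abs_continuous x0 X v" "v x0 = y0" "\<forall>t\<in>{x0..X}. y0 \<le> v t"
    and n: "near_minimizer \<Lambda> e n a1 X"
    and ord: "x0 < a1" "a1 < xh" "xh < X" and roomy: "a1 + (n a1 - y0) \<le> X"
    and ends: "n X < v X" and low: "n a1 < y1" and high: "\<forall>t\<in>{xh..X}. y1 \<le> n t"
  shows "(\<exists>q. abs_continuous x0 X q \<and> q x0 = y0 \<and> q X = v X \<and> (\<forall>t\<in>{xh..X}. y1 \<le> q t) \<and>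
      energy \<Lambda> q x0 X \<le> energy \<Lambda> v x0 X + ennreal e) \<or>
    (\<exists>c d. a1 \<le> d \<and> d \<le> c \<and> xh \<le> c \<and> c \<le> X \<and> n c = v c \<and> (\<forall>t\<in>{c..X}. n t \<le> v t) \<and>
      v d = n a1 - (d - a1) \<and> d - a1 \<le> n a1 - y0 \<and> y0 \<le> n a1)" (is "?path \<or> ?tail")
proof (cases "\<forall>t\<in>{xh..X}. y1 \<le> v t")
  case True
  then have ?path using v(1,2) by (intro exI[of _ v]) auto
  then show ?thesis ..
next
  case False
  then obtain x2 where x2: "x2 \<in> {xh..X}" "v x2 < y1" by force
  have n2: "v x2 < n x2" using high[rule_format, OF x2(1)] x2(2) by simp
  have acn: "abs_continuous a1 X n" using n by (simp add: near_minimizer_def)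
  have cv: "continuous_on {a1..X} v"
    using ord by (intro continuous_on_subset[OF abs_continuous_imp_continuous_on[OF v(1)]]) auto
  have cD: "continuous_on {a1..X} (\<lambda>t. v t - n t)"
    using cv abs_continuous_imp_continuous_on[OF acn] by (rule continuous_on_diff)
  have "\<exists>s\<in>{x2..X}. v s - n s = 0 \<and> (\<forall>t\<in>{s..X}. 0 \<le> v t - n t)"
    using x2 n2 ends ord by (intro last_zero continuous_on_subset[OF cD]) auto
  then obtain c where c: "c \<in> {x2..X}" "v c = n c" "\<forall>t\<in>{c..X}. n t \<le> v t" by auto
  have cord: "xh \<le> c" "c \<le> X" "a1 \<le> c" using c(1) x2(1) ord by auto
  show ?thesis
  proof (cases "\<exists>t\<in>{a1..xh}. n t \<le> v t")
    case True
    then obtain t1 where t1: "t1 \<in> {a1..xh}" "n t1 \<le> v t1" by blast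
    have "\<exists>c'. a1 \<le> c' \<and> c' \<le> c \<and> v c' = n c' \<and> (\<forall>t. xh \<le> t \<and> t \<le> c' \<longrightarrow> n t \<le> v t)"
    proof (cases "n xh \<le> v xh")
      case True
      then have "\<exists>s\<in>{xh..x2}. v s - n s = 0 \<and> (\<forall>t\<in>{xh..s}. 0 \<le> v t - n t)"
        using x2 n2 ord by (intro first_zero continuous_on_subset[OF cD]) auto
      then obtain s where "s \<in> {xh..x2}" "v s = n s" "\<forall>t\<in>{xh..s}. n t \<le> v t" by auto
      then show ?thesis using c(1) ord by (intro exI[of _ s]) auto
    next
      case False
      have "continuous_on {t1..xh} (\<lambda>t. - (v t - n t))"
        using t1 ord by (intro continuous_on_minus continuous_on_subset[OF cD]) auto
      then have "\<exists>s\<in>{t1..xh}. - (v s - n s) = 0 \<and> (\<forall>t\<in>{s..xh}. 0 \<le> - (v t - n t))"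
        by (rule last_zero) (use t1 False in auto)
      then obtain s where "s \<in> {t1..xh}" "v s = n s" by auto
      moreover have "\<forall>t. xh \<le> t \<and> t \<le> s \<longrightarrow> n t \<le> v t"
        using calculation by (auto simp: order_antisym_conv)
      ultimately show ?thesis using t1 cord by (intro exI[of _ s]) auto
    qed
    then obtain c' where c': "a1 \<le> c'" "c' \<le> c" "v c' = n c'" "\<forall>t. xh \<le> t \<and> t \<le> c' \<longrightarrow> n t \<le> v t" by blast
    have nm: "near_minimizer \<Lambda> e n c' c"
      using c' cord by (intro near_minimizer_subinterval[OF borel n]) auto
    define q where "q = join_at c' v (join_at c n v)"
    have q: "abs_continuous x0 X q" "energy \<Lambda> q x0 X \<le> energy \<Lambda> v x0 X + ennreal e"
      using splice_near_minimizer[OF v(1) nm] c' cord c(2) ord unfolding q_def by auto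
    have ?path
    proof (intro exI[of _ q] conjI ballI q)
      show "q x0 = y0" using c' ord v(2) by (simp add: q_def join_at_def)
      show "q X = v X" using c' cord c(2) by (auto simp: q_def join_at_def)
      show "y1 \<le> q t" if "t \<in> {xh..X}" for t
        using high[rule_format, OF that] c'(4) c(3) that by (auto simp: q_def join_at_def intro: order_trans)
    qed
    then show ?thesis ..
  next
    case False
    then have above: "v t < n t" if "t \<in> {a1..xh}" for t using that by force
    define \<rho> where "\<rho> = n a1 - y0"
    have va: "v a1 < n a1" using above[of a1] ord by auto
    moreover have "y0 \<le> v a1" using v(3)[rule_format, of a1] ord by auto
    ultimately have rho: "\<rho> > 0" by (simp add: \<rho>_def)
    have "\<exists>s\<in>{a1..a1 + \<rho>}. (n a1 - (s - a1)) - v s = 0 \<and> (\<forall>t\<in>{a1..s}. 0 \<le> (n a1 - (t - a1)) - v t)"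
    proof (rule first_zero)
      show "continuous_on {a1..a1 + \<rho>} (\<lambda>s. (n a1 - (s - a1)) - v s)"
        using roomy by (intro continuous_intros continuous_on_subset[OF cv]) (auto simp: \<rho>_def)
      show "(n a1 - (a1 + \<rho> - a1)) - v (a1 + \<rho>) \<le> 0"
        using v(3)[rule_format, of "a1 + \<rho>"] roomy ord rho by (simp add: \<rho>_def)
    qed (use rho va in auto)
    then obtain d where d: "d \<in> {a1..a1 + \<rho>}" "v d = n a1 - (d - a1)" "\<forall>t\<in>{a1..d}. v t \<le> n a1 - (t - a1)"
      by auto
    have "d \<le> c"
    proof (rule ccontr)
      assume "\<not> d \<le> c"
      then have "v c \<le> n a1 - (c - a1)" using d(3) cord by auto
      also have "\<dots> \<le> n a1" using cord by simp
      also have "\<dots> < y1" by (fact low)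
      also have "\<dots> \<le> n c" using high[rule_format, of c] cord by simp
      finally show False using c(2) by simp
    qed
    have ?tail
      using d \<open>d \<le> c\<close> cord c rho by (intro exI[of _ c] exI[of _ d]) (auto simp: \<rho>_def)
    then show ?thesis ..
  qed
qed

lemma short_rise_cost:
  assumes ac: "abs_continuous a b v" and ab: "a < b" "b - a \<le> \<xi>" and D: "v b - v a = D"
  shows "ennreal (\<xi> * w (D / \<xi>)) \<le> energy \<Lambda> v a b"
proof -
  have "\<xi> * w (D / \<xi>) \<le> (b - a) * w (D / (b - a))"
    using ab by (intro perspective_antimono) auto
  then have "ennreal (\<xi> * w (D / \<xi>)) \<le> ennreal ((b - a) * w ((v b - v a) / (b - a)))"
    unfolding D by (rule ennreal_leI)
  also have "\<dots> \<le> energy \<Lambda> v a b" by (rule energy_ge[OF lower ac ab(1)])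
  finally show ?thesis .
qed

lemma last_level:
  fixes q :: "real \<Rightarrow> real"
  assumes q: "abs_continuous p X q" and "p \<le> xh" "xh \<le> X" "q p < l" "\<forall>t\<in>{xh..X}. l \<le> q t"
  shows "\<exists>s. p < s \<and> s \<le> xh \<and> q s = l \<and> (\<forall>t\<in>{s..X}. l \<le> q t)"
proof -
  have "\<exists>s\<in>{p..xh}. q s - l = 0 \<and> (\<forall>t\<in>{s..xh}. 0 \<le> q t - l)"
  proof (rule last_zero)
    show "continuous_on {p..xh} (\<lambda>t. q t - l)"
      using assms by (intro continuous_intros continuous_on_subset[OF abs_continuous_imp_continuous_on[OF q]]) auto
  qed (use assms in \<open>auto simp: less_imp_le\<close>)
  then obtain s where s: "s \<in> {p..xh}" "q s = l" "\<forall>t\<in>{s..xh}. l \<le> q t" by auto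
  have "p \<noteq> s" using s(2) assms(4) by auto
  moreover have "l \<le> q t" if "t \<in> {s..X}" for t
    using s(3) assms(5) that by (cases "t \<le> xh") auto
  ultimately show ?thesis using s by (intro exI[of _ s]) auto
qed

text \<open>The path \<open>v\<close>, or the near-minimizer \<open>n\<close> in its place, climbs most of the way from \<open>y0\<close> to \<open>y0 + \<Delta>\<close>
before \<open>xh\<close>, hence steeply. The part \<open>q\<close> after the last visit to the height \<open>y0 + \<Delta>\<close> therefore costs
less than \<open>v\<close> by \<open>K * (\<Delta> / 2)\<close>, up to the errors of order \<open>\<Delta>\<close> from the connecting line and from \<open>n\<close>.
The climb cannot be completed before \<open>x0 + \<xi>\<close>, since that would cost at least \<open>F\<close>.\<close>

lemma cheap_tail:
  assumes v: "abs_continuous x0 X v" "v x0 = y0" "\<forall>t\<in>{x0..X}. y0 \<le> v t"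
    and n: "near_minimizer \<Lambda> e n a1 X" and e: "0 < e"
    and ord: "x0 < a1" "a1 < xh" "xh < X" and roomy: "a1 + (n a1 - y0) \<le> X"
    and ends: "n X < v X" and high: "\<forall>t\<in>{xh..X}. y0 + \<Delta> \<le> n t"
    and \<Delta>: "0 < \<Delta>" and low: "n a1 \<le> y0 + \<Delta> / 2"
    and steep: "\<And>v a b. abs_continuous a b v \<Longrightarrow> a < b \<Longrightarrow> M * (b - a) \<le> v b - v a \<Longrightarrow>
        ennreal (K * (v b - v a)) \<le> energy \<Lambda> v a b"
    and M: "M * (xh - x0) \<le> \<Delta> / 2" "M \<ge> 0" and K: "K \<ge> 0"
    and C: "\<And>x y. x \<in> {x0..X} \<Longrightarrow> y \<in> {y0..y0 + \<Delta>} \<Longrightarrow> \<Lambda> (x, y, -1) \<le> C" "C \<ge> 0"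
    and fast: "\<xi> > 0 \<longrightarrow> (\<forall>D\<in>{y0 + \<Delta> - n a1..\<Delta>}. F \<le> \<xi> * w (D / \<xi>))"
    and above: "y0 \<le> n a1"
    and F: "energy \<Lambda> v x0 X + ennreal (C * (\<Delta> / 2)) + ennreal e < ennreal F"
  shows "\<exists>s q. x0 < s \<and> s \<le> xh \<and> x0 + \<xi> < s \<and> abs_continuous s X q \<and> q s = y0 + \<Delta> \<and> q X = v X \<and>
    (\<forall>t\<in>{s..X}. y0 + \<Delta> \<le> q t) \<and>
    energy \<Lambda> q s X + ennreal (K * (\<Delta> / 2)) \<le> energy \<Lambda> v x0 X + ennreal (C * (\<Delta> / 2)) + ennreal e"
proof -
  have low1: "n a1 < y0 + \<Delta>" using low \<Delta> by simp
  from splice_dichotomy[OF v n ord roomy ends low1 high] show ?thesis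
  proof (elim disjE)
    assume "\<exists>q. abs_continuous x0 X q \<and> q x0 = y0 \<and> q X = v X \<and> (\<forall>t\<in>{xh..X}. y0 + \<Delta> \<le> q t) \<and>
      energy \<Lambda> q x0 X \<le> energy \<Lambda> v x0 X + ennreal e"
    then obtain q where path: "abs_continuous x0 X q" "q x0 = y0" "q X = v X" "\<forall>t\<in>{xh..X}. y0 + \<Delta> \<le> q t"
      "energy \<Lambda> q x0 X \<le> energy \<Lambda> v x0 X + ennreal e" by blast
    obtain s where s: "x0 < s" "s \<le> xh" "q s = y0 + \<Delta>" "\<forall>t\<in>{s..X}. y0 + \<Delta> \<le> q t"
      using last_level[OF path(1), of xh "y0 + \<Delta>"] path(2,4) ord \<Delta> by auto
    have acq: "abs_continuous x0 s q" "abs_continuous s X q"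
      using s ord by (auto intro: abs_continuous_subinterval[OF path(1)])
    have split: "energy \<Lambda> q x0 X = energy \<Lambda> q x0 s + energy \<Lambda> q s X"
      using s ord by (intro energy_split[OF borel path(1)]) auto
    have tot: "energy \<Lambda> q x0 s + energy \<Lambda> q s X \<le> energy \<Lambda> v x0 X + ennreal (C * (\<Delta> / 2)) + ennreal e"
      using path(5) unfolding split by (meson order_trans add_right_mono le_iff_add)
    have rise: "q s - q x0 = \<Delta>" using s path by simp
    have "x0 + \<xi> < s"
    proof (rule ccontr)
      assume ns: "\<not> x0 + \<xi> < s"
      have "ennreal F \<le> ennreal (\<xi> * w (\<Delta> / \<xi>))"
        using fast[rule_format, of \<Delta>] ns s(1) above \<Delta> by (intro ennreal_leI) auto
      also have "\<dots> \<le> energy \<Lambda> q x0 s"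
        using ns s(1) by (intro short_rise_cost[OF acq(1)] rise) auto
      also have "\<dots> \<le> energy \<Lambda> q x0 s + energy \<Lambda> q s X" by simp
      finally show False using tot F by (meson le_less_trans not_less order_trans)
    qed
    moreover have "energy \<Lambda> q s X + ennreal (K * (\<Delta> / 2)) \<le> energy \<Lambda> v x0 X + ennreal (C * (\<Delta> / 2)) + ennreal e"
    proof -
      have "M * (s - x0) \<le> M * (xh - x0)" using s M by (intro mult_left_mono) auto
      then have "ennreal (K * (q s - q x0)) \<le> energy \<Lambda> q x0 s"
        using M \<Delta> by (intro steep[OF acq(1) s(1)]) (simp add: rise)
      moreover have "ennreal (K * (\<Delta> / 2)) \<le> ennreal (K * (q s - q x0))"
        unfolding rise using K \<Delta> by (intro ennreal_leI mult_left_mono) auto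
      ultimately have "ennreal (K * (\<Delta> / 2)) \<le> energy \<Lambda> q x0 s" by (rule order_trans[rotated])
      then have "energy \<Lambda> q s X + ennreal (K * (\<Delta> / 2)) \<le> energy \<Lambda> q s X + energy \<Lambda> q x0 s"
        by (rule add_left_mono)
      also have "\<dots> = energy \<Lambda> q x0 s + energy \<Lambda> q s X" by (rule add.commute)
      also note tot
      finally show ?thesis .
    qed
    ultimately show ?thesis using s acq(2) path(3) by blast
  next
    assume "\<exists>c d. a1 \<le> d \<and> d \<le> c \<and> xh \<le> c \<and> c \<le> X \<and> n c = v c \<and> (\<forall>t\<in>{c..X}. n t \<le> v t) \<and>
      v d = n a1 - (d - a1) \<and> d - a1 \<le> n a1 - y0 \<and> y0 \<le> n a1"
    then obtain c d where tail: "a1 \<le> d" "d \<le> c" "xh \<le> c" "c \<le> X" "n c = v c" "\<forall>t\<in>{c..X}. n t \<le> v t"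
      "v d = n a1 - (d - a1)" "d - a1 \<le> n a1 - y0" "y0 \<le> n a1" by blast
    have acn: "abs_continuous a1 X n" using n by (simp add: near_minimizer_def)
    obtain s where s: "a1 < s" "s \<le> xh" "n s = y0 + \<Delta>" "\<forall>t\<in>{s..X}. y0 + \<Delta> \<le> n t"
      using last_level[OF acn, of xh "y0 + \<Delta>"] low1 high ord by auto
    have sc: "s \<le> c" using s tail by simp
    have ac: "abs_continuous a1 s n" "abs_continuous s c n" "abs_continuous a1 c n"
      using s tail sc by (auto intro: abs_continuous_subinterval[OF acn])
    have acv: "abs_continuous c X v" "abs_continuous d c v" "abs_continuous d X v"
      using tail ord by (auto intro: abs_continuous_subinterval[OF v(1)])
    define q where "q = join_at c n v"
    have acq: "abs_continuous s X q" unfolding q_def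
      by (rule abs_continuous_join_at[OF ac(2) acv(1)]) (use tail sc in auto)
    have Eq: "energy \<Lambda> q s X = energy \<Lambda> n s c + energy \<Lambda> v c X"
      unfolding q_def by (rule energy_join_at[OF borel ac(2) acv(1)]) (use tail sc in auto)
    define line where "line t = (-1) * (t - a1) + n a1" for t
    have acl: "abs_continuous a1 d line" unfolding line_def by (rule abs_continuous_affine)
    have dl: "d - a1 \<le> \<Delta> / 2" using tail low by simp
    have El: "energy \<Lambda> line a1 d \<le> ennreal (C * (\<Delta> / 2))"
    proof -
      have "energy \<Lambda> line a1 d \<le> ennreal (C * (d - a1))"
        unfolding line_def
      proof (rule energy_affine_le)
        fix x assume x: "x \<in> {a1<..<d}"
        then have "(-1) * (x - a1) + n a1 \<in> {y0..y0 + \<Delta>}" using tail low \<Delta> by auto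
        then show "\<Lambda> (x, (-1) * (x - a1) + n a1, -1) \<le> C" using x ord tail by (intro C(1)) auto
      qed (use tail in simp)
      also have "\<dots> \<le> ennreal (C * (\<Delta> / 2))" using dl C(2) by (intro ennreal_leI mult_left_mono) auto
      finally show ?thesis .
    qed
    define r where "r = join_at d line v"
    have acr: "abs_continuous a1 c r" unfolding r_def
      by (rule abs_continuous_join_at[OF acl acv(2)]) (use tail in \<open>auto simp: line_def\<close>)
    have Er: "energy \<Lambda> r a1 c = energy \<Lambda> line a1 d + energy \<Lambda> v d c"
      unfolding r_def by (rule energy_join_at[OF borel acl acv(2)]) (use tail in \<open>auto simp: line_def\<close>)
    have nm: "near_minimizer \<Lambda> e n a1 c"
      using tail ord by (intro near_minimizer_subinterval[OF borel n]) auto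
    have "r a1 = n a1" "r c = n c" using tail by (auto simp: r_def join_at_def line_def)
    then have le: "energy \<Lambda> n a1 c \<le> energy \<Lambda> line a1 d + energy \<Lambda> v d c + ennreal e"
      using nm acr Er by (auto simp: near_minimizer_def)
    have split: "energy \<Lambda> n a1 c = energy \<Lambda> n a1 s + energy \<Lambda> n s c"
      using s sc by (intro energy_split[OF borel ac(3)]) auto
    have vle: "energy \<Lambda> v d c + energy \<Lambda> v c X \<le> energy \<Lambda> v x0 X"
      using energy_split[OF borel v(1), of d] energy_split[OF borel acv(3), of c] tail ord by simp
    have tot: "energy \<Lambda> n a1 s + energy \<Lambda> q s X \<le> energy \<Lambda> v x0 X + ennreal (C * (\<Delta> / 2)) + ennreal e"
    proof -
      have "energy \<Lambda> n a1 s + energy \<Lambda> q s X = energy \<Lambda> n a1 c + energy \<Lambda> v c X"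
        unfolding Eq split by (simp add: ac_simps)
      also have "\<dots> \<le> (energy \<Lambda> line a1 d + energy \<Lambda> v d c + ennreal e) + energy \<Lambda> v c X"
        by (rule add_right_mono[OF le])
      also have "\<dots> = (energy \<Lambda> v d c + energy \<Lambda> v c X) + energy \<Lambda> line a1 d + ennreal e"
        by (simp add: ac_simps)
      also have "\<dots> \<le> energy \<Lambda> v x0 X + ennreal (C * (\<Delta> / 2)) + ennreal e"
        by (intro add_mono vle El order_refl)
      finally show ?thesis .
    qed
    have "x0 + \<xi> < s"
    proof (rule ccontr)
      assume ns: "\<not> x0 + \<xi> < s"
      have "ennreal F \<le> ennreal (\<xi> * w ((n s - n a1) / \<xi>))"
        using fast[rule_format, of "n s - n a1"] ns s tail(9) ord by (intro ennreal_leI) auto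
      also have "\<dots> \<le> energy \<Lambda> n a1 s"
        using ns s(1) ord by (intro short_rise_cost[OF ac(1)]) auto
      also have "\<dots> \<le> energy \<Lambda> n a1 s + energy \<Lambda> q s X" by simp
      finally show False using tot F by (meson le_less_trans not_less order_trans)
    qed
    moreover have "energy \<Lambda> q s X + ennreal (K * (\<Delta> / 2)) \<le> energy \<Lambda> v x0 X + ennreal (C * (\<Delta> / 2)) + ennreal e"
    proof -
      have "M * (s - a1) \<le> M * (xh - x0)" using s M ord by (intro mult_left_mono) auto
      then have "ennreal (K * (n s - n a1)) \<le> energy \<Lambda> n a1 s"
        using M low s(3) by (intro steep[OF ac(1) s(1)]) simp
      moreover have "ennreal (K * (\<Delta> / 2)) \<le> ennreal (K * (n s - n a1))"
        using K low s(3) by (intro ennreal_leI mult_left_mono) auto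
      ultimately have "ennreal (K * (\<Delta> / 2)) \<le> energy \<Lambda> n a1 s" by (rule order_trans[rotated])
      then have "energy \<Lambda> q s X + ennreal (K * (\<Delta> / 2)) \<le> energy \<Lambda> q s X + energy \<Lambda> n a1 s"
        by (rule add_left_mono)
      also have "\<dots> = energy \<Lambda> n a1 s + energy \<Lambda> q s X" by (rule add.commute)
      also note tot
      finally show ?thesis .
    qed
    moreover have "q s = y0 + \<Delta>" "q X = v X" using s sc tail by (auto simp: q_def join_at_def)
    moreover have "y0 + \<Delta> \<le> q t" if "t \<in> {s..X}" for t
      using s(4)[rule_format, of t] tail(6)[rule_format, of t] that by (auto simp: q_def join_at_def)
    ultimately show ?thesis using s ord acq by (intro exI[of _ s] exI[of _ q]) auto
  qed
qed

end

context bounded_growth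
begin

lemma steep_right_of_singularity:
  assumes "filterlim (\<lambda>x. (u x - u x0) / (x - x0)) at_top (at_right (x0::real))"
  shows "\<exists>h>0. \<forall>t. x0 < t \<longrightarrow> t < x0 + h \<longrightarrow> u x0 + M * (t - x0) \<le> u t"
proof -
  have "\<forall>\<^sub>F x in at_right x0. M \<le> (u x - u x0) / (x - x0)"
    using assms unfolding filterlim_at_top by blast
  then obtain c where c: "c > x0" "\<forall>y>x0. y < c \<longrightarrow> M \<le> (u y - u x0) / (y - x0)"
    unfolding eventually_at_right_field by blast
  have "u x0 + M * (t - x0) \<le> u t" if "x0 < t" "t < c" for t
    using c(2)[rule_format, OF that] that by (simp add: field_simps)
  then show ?thesis using c(1) by (intro exI[of _ "c - x0"]) auto
qed

text \<open>Here \<open>\<Delta>\<close> is the height above the singular point at which a segment from the displaced point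
\<open>(x0 + \<xi>, y0 + \<eta>)\<close> joins a nearly optimal path. The condition with \<open>R\<close> bounds the slope of this segment;
the condition for \<open>\<xi> > 0\<close> forces every such path to be still below the height \<open>y0 + \<Delta>\<close> at \<open>x0 + \<xi>\<close>, so
that the segment goes to the right.\<close>

definition descent_set :: "real \<Rightarrow> real \<Rightarrow> (real \<times> real) set" where
  "descent_set X Y = {(x0, y0). x0 < X \<and> y0 < Y \<and>
    (\<forall>K\<ge>0. \<forall>R\<ge>0. \<exists>\<delta>>0. \<forall>\<xi> \<eta> \<Delta>. 0 < \<Delta> \<longrightarrow> \<Delta> < \<delta> \<longrightarrow> \<bar>\<xi>\<bar> \<le> \<Delta> \<longrightarrow> \<bar>\<eta>\<bar> \<le> \<Delta> \<longrightarrow>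
       \<Delta> - \<eta> \<le> R * max (- \<xi>) 0 \<longrightarrow>
       (\<xi> > 0 \<longrightarrow> enn2real (value_fn \<Lambda> X Y (x0, y0)) + 3 \<le> \<xi> * w (\<Delta> / \<xi>)) \<longrightarrow>
       value_fn \<Lambda> X Y (x0 + \<xi>, y0 + \<eta>) + ennreal (K * \<Delta>) \<le> value_fn \<Lambda> X Y (x0, y0))}"

text \<open>A nearly optimal path from \<open>(x0, y0)\<close> is cut at the height \<open>y0 + \<Delta>\<close>, and its tail is joined to the
displaced point by a segment. The segment has bounded slope and length of order \<open>\<Delta>\<close>, so its cost is a
fixed multiple of \<open>\<Delta>\<close>, while the saving is \<open>K' * (\<Delta> / 2)\<close> with \<open>K'\<close> at our disposal.\<close>

theorem value_fn_descent:
  assumes z0: "(x0, y0) \<in> right_singular \<Lambda>"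
  shows "\<exists>X\<in>\<rat>. \<exists>Y\<in>\<rat>. (x0, y0) \<in> descent_set X Y"
proof -
  obtain b u where b: "x0 < b" and cu: "continuous_on {x0..b} u" and u0: "u x0 = y0"
    and lim: "limit_of_minimizers \<Lambda> u x0 b"
    and inf: "filterlim (\<lambda>x. (u x - u x0) / (x - x0)) at_top (at_right x0)"
    using z0 unfolding right_singular_def by auto
  obtain h where h: "h > 0" "\<forall>t. x0 < t \<longrightarrow> t < x0 + h \<longrightarrow> u x0 + 1 * (t - x0) \<le> u t"
    using steep_right_of_singularity[OF inf, of 1] by blast
  obtain X where X: "X \<in> \<rat>" "x0 < X" "X < min b (x0 + h)"
    using Rats_dense_in_real[of x0 "min b (x0 + h)"] b h(1) by auto
  have pos: "y0 < u t" if "x0 < t" "t \<le> X" for t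
    using h(2)[rule_format, of t] that X(3) u0 by auto
  \<comment> \<open>The target lies above \<open>u\<close>, so that paths to it end above the approximating near-minimizers.\<close>
  obtain Y where Y: "Y \<in> \<rat>" "u X < Y" using Rats_dense_in_real[of "u X" "u X + 1"] by auto
  have yY: "y0 < Y" using pos[of X] X Y by auto
  define f where "f = value_fn \<Lambda> X Y"
  define V0 where "V0 = enn2real (f (x0, y0))"
  have V0: "f (x0, y0) = ennreal V0" "V0 \<ge> 0"
    using value_fn_finite[of x0 X y0 Y] X yY unfolding V0_def f_def by auto
  have main: "\<exists>\<delta>>0. \<forall>\<xi> \<eta> \<Delta>. 0 < \<Delta> \<longrightarrow> \<Delta> < \<delta> \<longrightarrow> \<bar>\<xi>\<bar> \<le> \<Delta> \<longrightarrow> \<bar>\<eta>\<bar> \<le> \<Delta> \<longrightarrow>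
       \<Delta> - \<eta> \<le> R * max (- \<xi>) 0 \<longrightarrow> (\<xi> > 0 \<longrightarrow> V0 + 3 \<le> \<xi> * w (\<Delta> / \<xi>)) \<longrightarrow>
       f (x0 + \<xi>, y0 + \<eta>) + ennreal (K * \<Delta>) \<le> f (x0, y0)" if "K \<ge> 0" "R \<ge> 0" for K R :: real
  proof -
    define r where "r = \<bar>x0\<bar> + \<bar>X\<bar> + \<bar>y0\<bar> + R + 4"
    obtain C where C: "C \<ge> 0" "\<forall>x y p. \<bar>x\<bar> \<le> r \<longrightarrow> \<bar>y\<bar> \<le> r \<longrightarrow> \<bar>p\<bar> \<le> r \<longrightarrow> \<Lambda> (x, y, p) \<le> C"
      using box_bound[of r] by blast
    \<comment> \<open>Half of \<open>K' * \<Delta>\<close> is gained; \<open>3 * C\<close> pays for the segment and the connecting line, and \<open>2\<close> for the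
    errors of \<open>v\<close> and of the near-minimizer.\<close>
    define K' where "K' = 2 * (K + 3 * C + 2)"
    have K': "K' \<ge> 0" using C \<open>K \<ge> 0\<close> by (simp add: K'_def)
    obtain M0 where M0: "M0 > 0" "\<forall>v a b. abs_continuous a b v \<longrightarrow> a < b \<longrightarrow> M0 * (b - a) \<le> v b - v a \<longrightarrow>
        ennreal (K' * (v b - v a)) \<le> energy \<Lambda> v a b"
      using steep_rise_cost[OF lower K'] by blast
    define M where "M = max M0 1"
    have M: "M \<ge> 1" "M0 \<le> M" by (auto simp: M_def)
    obtain h1 where h1: "h1 > 0" "\<forall>t. x0 < t \<longrightarrow> t < x0 + h1 \<longrightarrow> u x0 + (4 * M) * (t - x0) \<le> u t"
      using steep_right_of_singularity[OF inf, of "4 * M"] by blast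
    define h2 where "h2 = min (h1 / 2) (X - x0)"
    have h2: "h2 > 0" "h2 < h1" "x0 + h2 \<le> X" using h1 X by (auto simp: h2_def)
    have "\<exists>s\<in>{x0 + h2..X}. \<forall>t\<in>{x0 + h2..X}. u s \<le> u t"
      using X h2 by (intro continuous_attains_inf continuous_on_subset[OF cu]) auto
    then obtain s0 where s0: "s0 \<in> {x0 + h2..X}" "\<forall>t\<in>{x0 + h2..X}. u s0 \<le> u t" by blast
    define \<mu> where "\<mu> = u s0 - y0"
    have mu: "\<mu> > 0" using pos[of s0] s0(1) h2 by (simp add: \<mu>_def)
    define \<delta> where "\<delta> = min (\<mu> / 2) (min ((X - x0) / 2) (1 / (2 + C)))"
    have \<delta>: "\<delta> > 0" using mu X C by (simp add: \<delta>_def)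
    show ?thesis
    proof (intro exI[of _ \<delta>] conjI allI impI \<delta>)
      fix \<xi> \<eta> \<Delta> :: real
      assume \<Delta>: "0 < \<Delta>" "\<Delta> < \<delta>" and small: "\<bar>\<xi>\<bar> \<le> \<Delta>" "\<bar>\<eta>\<bar> \<le> \<Delta>"
        and slope: "\<Delta> - \<eta> \<le> R * max (- \<xi>) 0" and fast: "\<xi> > 0 \<longrightarrow> V0 + 3 \<le> \<xi> * w (\<Delta> / \<xi>)"
      have D1: "\<Delta> < \<mu> / 2" "2 * \<Delta> < X - x0" using \<Delta> by (auto simp: \<delta>_def)
      have D2: "\<Delta> * (2 + C) < 1"
        using \<Delta> C by (simp add: \<delta>_def pos_less_divide_eq)
      have D3: "\<Delta> < 1" using D2 C \<Delta> by (smt (verit) mult_le_cancel_left1)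
      \<comment> \<open>At slope \<open>4 * M\<close> the height \<open>2 * \<Delta>\<close> is reached at \<open>xh\<close>.\<close>
      define xh where "xh = x0 + \<Delta> / (2 * M)"
      have dM: "\<Delta> / (2 * M) \<le> \<Delta> / 2" using M \<Delta> by (intro divide_left_mono) auto
      have xh: "x0 < xh" "xh \<le> x0 + \<Delta> / 2" "xh < X" "M * (xh - x0) \<le> \<Delta> / 2"
        using M \<Delta> D1 dM by (auto simp: xh_def)
      have uhigh: "y0 + 2 * \<Delta> \<le> u t" if t: "t \<in> {xh..X}" for t
      proof (cases "t \<le> x0 + h2")
        case True
        have "u x0 + (4 * M) * (t - x0) \<le> u t" using h1(2) True t xh h2 by auto
        moreover have "(4 * M) * (xh - x0) \<le> (4 * M) * (t - x0)" using t M by (intro mult_left_mono) auto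
        moreover have "(4 * M) * (xh - x0) = 2 * \<Delta>" using M by (simp add: xh_def)
        ultimately show ?thesis using u0 by linarith
      next
        case False
        then have "u s0 \<le> u t" using s0(2) t by auto
        then show ?thesis using D1 by (simp add: \<mu>_def)
      qed
      \<comment> \<open>The near-minimizer starts slightly above \<open>y0\<close> and climbs by slightly less than \<open>\<Delta>\<close>; by continuity
      of \<open>w\<close> this is still too expensive within the time \<open>\<xi>\<close>.\<close>
      have "\<exists>\<rho>>0. \<forall>D. \<bar>D - \<Delta>\<bar> \<le> \<rho> \<longrightarrow> \<xi> > 0 \<longrightarrow> V0 + 2 \<le> \<xi> * w (D / \<xi>)"
      proof (cases "\<xi> > 0")
        case True
        have "continuous_on UNIV (\<lambda>D. \<xi> * w (D / \<xi>))"
          using True by (intro continuous_intros continuous_on_compose2[OF continuous]) auto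
        then have "isCont (\<lambda>D. \<xi> * w (D / \<xi>)) \<Delta>" by (simp add: continuous_on_eq_continuous_at)
        then obtain d where d: "d > 0" "\<forall>D. dist D \<Delta> < d \<longrightarrow> dist (\<xi> * w (D / \<xi>)) (\<xi> * w (\<Delta> / \<xi>)) < 1"
          unfolding continuous_at_eps_delta using zero_less_one by blast
        have "V0 + 2 \<le> \<xi> * w (D / \<xi>)" if "\<bar>D - \<Delta>\<bar> \<le> d / 2" for D
          using d(2)[rule_format, of D] d(1) that fast True by (auto simp: dist_real_def)
        then show ?thesis using d(1) by (intro exI[of _ "d / 2"]) auto
      qed (auto intro: exI[of _ 1])
      then obtain \<rho>0 where \<rho>0: "\<rho>0 > 0" "\<forall>D. \<bar>D - \<Delta>\<bar> \<le> \<rho>0 \<longrightarrow> \<xi> > 0 \<longrightarrow> V0 + 2 \<le> \<xi> * w (D / \<xi>)" by blast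
      define \<rho> where "\<rho> = min (\<Delta> / 2) \<rho>0"
      have \<rho>: "\<rho> > 0" "\<rho> \<le> \<Delta> / 2" "\<rho> \<le> \<rho>0" using \<rho>0 \<Delta> by (auto simp: \<rho>_def)
      obtain d where d: "d > 0" "\<forall>t\<in>{x0..b}. dist t x0 < d \<longrightarrow> dist (u t) (u x0) < \<rho> / 2"
        using cu b \<rho>(1) unfolding continuous_on_iff
        by (metis atLeastAtMost_iff half_gt_zero less_imp_le order_refl)
      define a1 where "a1 = x0 + min (d / 2) ((xh - x0) / 2)"
      have a1: "x0 < a1" "a1 < xh" "a1 - x0 < d" using d xh by (auto simp: a1_def min_def field_simps)
      have ua1: "y0 < u a1" "u a1 < y0 + \<rho> / 2"
        using pos[of a1] d(2)[rule_format, of a1] a1 xh X u0 by (auto simp: dist_real_def)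
      \<comment> \<open>An error below \<open>e\<close> keeps the near-minimizer above \<open>y0\<close> at \<open>a1\<close>, above \<open>y0 + \<Delta>\<close> beyond \<open>xh\<close> and
      below \<open>Y\<close> at \<open>X\<close>.\<close>
      define e where "e = min (min \<Delta> (\<rho> / 2)) (min (u a1 - y0) (Y - u X))"
      have e: "0 < e" "e \<le> \<Delta>" "e \<le> \<rho> / 2" "e \<le> u a1 - y0" "e \<le> Y - u X"
        using \<Delta> \<rho> ua1 Y unfolding e_def by linarith+
      have "x0 < a1" "a1 \<le> X" "X < b" using a1 xh X by auto
      then obtain n where n: "near_minimizer \<Lambda> e n a1 X" "\<forall>t\<in>{a1..X}. \<bar>n t - u t\<bar> < e"
        using lim e(1) unfolding limit_of_minimizers_def by blast
      have na1: "y0 \<le> n a1" "n a1 \<le> y0 + \<rho>"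
        using n(2)[rule_format, of a1] a1 xh e ua1 by auto
      have nX: "n X < Y" using n(2)[rule_format, of X] a1 xh e by auto
      have nhigh: "\<forall>t\<in>{xh..X}. y0 + \<Delta> \<le> n t"
      proof
        fix t assume t: "t \<in> {xh..X}"
        then have "\<bar>n t - u t\<bar> < e" using n(2) a1 by auto
        then show "y0 + \<Delta> \<le> n t" using uhigh[OF t] e by linarith
      qed
      have "f (x0, y0) < ennreal (V0 + \<Delta>)"
        unfolding V0(1) using \<Delta> V0 by (intro ennreal_lessI) auto
      then obtain v where v: "v \<in> rising_paths X Y (x0, y0)" "energy \<Lambda> v x0 X < ennreal (V0 + \<Delta>)"
        unfolding f_def value_fn_def INF_less_iff by auto
      then have v': "abs_continuous x0 X v" "v x0 = y0" "v X = Y" "\<forall>t\<in>{x0..X}. y0 \<le> v t"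
        by (auto simp: rising_paths_def)
      have "\<exists>s q. x0 < s \<and> s \<le> xh \<and> x0 + \<xi> < s \<and> abs_continuous s X q \<and> q s = y0 + \<Delta> \<and> q X = v X \<and>
          (\<forall>t\<in>{s..X}. y0 + \<Delta> \<le> q t) \<and>
          energy \<Lambda> q s X + ennreal (K' * (\<Delta> / 2)) \<le> energy \<Lambda> v x0 X + ennreal (C * (\<Delta> / 2)) + ennreal e"
      proof (rule cheap_tail[where M=M and F="V0 + 2", OF v'(1) v'(2) v'(4) n(1) e(1) a1(1) a1(2) xh(3)])
        show "a1 + (n a1 - y0) \<le> X" using a1 xh na1 \<rho> D1 by auto
        show "n X < v X" using nX v' by simp
        show "n a1 \<le> y0 + \<Delta> / 2" using na1 \<rho> by simp
        show "ennreal (K' * (v b - v a)) \<le> energy \<Lambda> v a b"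
          if "abs_continuous a b v" "a < b" "M * (b - a) \<le> v b - v a" for v and a b :: real
        proof -
          have "M0 * (b - a) \<le> M * (b - a)" using M that by (intro mult_right_mono) auto
          then have "M0 * (b - a) \<le> v b - v a" using that(3) by (rule order_trans)
          then show ?thesis by (rule M0(2)[rule_format, OF that(1,2)])
        qed
        show "\<Lambda> (x, y, -1) \<le> C" if "x \<in> {x0..X}" "y \<in> {y0..y0 + \<Delta>}" for x y
          using that D3 \<open>R \<ge> 0\<close> by (intro C(2)[rule_format]) (auto simp: r_def)
        show "\<xi> > 0 \<longrightarrow> (\<forall>D\<in>{y0 + \<Delta> - n a1..\<Delta>}. V0 + 2 \<le> \<xi> * w (D / \<xi>))"
        proof (intro impI ballI)
          fix D assume "\<xi> > 0" "D \<in> {y0 + \<Delta> - n a1..\<Delta>}"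
          then show "V0 + 2 \<le> \<xi> * w (D / \<xi>)" using na1 \<rho> by (intro \<rho>0(2)[rule_format]) auto
        qed
        have "energy \<Lambda> v x0 X + ennreal (C * (\<Delta> / 2)) + ennreal e
            \<le> ennreal (V0 + \<Delta>) + ennreal (C * (\<Delta> / 2)) + ennreal \<Delta>"
          using v(2) e by (intro add_mono ennreal_leI) auto
        also have "\<dots> = ennreal (V0 + \<Delta> + C * (\<Delta> / 2) + \<Delta>)"
          using V0 \<Delta> C by (simp flip: ennreal_plus)
        also have "\<dots> < ennreal (V0 + 2)"
        proof (rule ennreal_lessI)
          have "\<Delta> * C \<ge> 0" using \<Delta> C by simp
          then show "V0 + \<Delta> + C * (\<Delta> / 2) + \<Delta> < V0 + 2" using D2 by (simp add: algebra_simps)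
        qed (use V0 in simp)
        finally show "energy \<Lambda> v x0 X + ennreal (C * (\<Delta> / 2)) + ennreal e < ennreal (V0 + 2)" .
      qed (use v' n a1 xh nhigh \<Delta> M K' C na1 e in auto)
      then obtain s q where s: "x0 < s" "s \<le> xh" "x0 + \<xi> < s" and q: "abs_continuous s X q" "q s = y0 + \<Delta>" "q X = Y"
        "\<forall>t\<in>{s..X}. y0 + \<Delta> \<le> q t"
        and Eq: "energy \<Lambda> q s X + ennreal (K' * (\<Delta> / 2)) \<le> energy \<Lambda> v x0 X + ennreal (C * (\<Delta> / 2)) + ennreal e"
        using v'(3) by auto
      define p where "p = (\<Delta> - \<eta>) / (s - (x0 + \<xi>))"
      have etaD: "\<eta> \<le> \<Delta>" using small(2) by simp
      have p: "0 \<le> p" "p \<le> R"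
      proof -
        show "0 \<le> p" using etaD s by (simp add: p_def)
        have "\<Delta> - \<eta> \<le> R * (s - (x0 + \<xi>))"
        proof (rule order_trans[OF slope], rule mult_left_mono[OF _ \<open>R \<ge> 0\<close>])
          show "max (- \<xi>) 0 \<le> s - (x0 + \<xi>)" using s by auto
        qed
        then show "p \<le> R" using s(3) by (simp add: p_def field_simps)
      qed
      define line where "line t = p * (t - (x0 + \<xi>)) + (y0 + \<eta>)" for t
      have line_s: "line s = y0 + \<Delta>" using s(3) by (simp add: line_def p_def)
      have acl: "abs_continuous (x0 + \<xi>) s line" unfolding line_def by (rule abs_continuous_affine)
      have El: "energy \<Lambda> line (x0 + \<xi>) s \<le> ennreal (2 * C * \<Delta>)"
      proof -
        have "energy \<Lambda> line (x0 + \<xi>) s \<le> ennreal (C * (s - (x0 + \<xi>)))"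
          unfolding line_def
        proof (rule energy_affine_le)
          fix x assume x: "x \<in> {x0 + \<xi><..<s}"
          have lx: "p * (x - (x0 + \<xi>)) + (y0 + \<eta>) \<ge> y0 + \<eta>" using x p by simp
          have "p * (x - (x0 + \<xi>)) \<le> p * (s - (x0 + \<xi>))" using x p by (intro mult_left_mono) auto
          then have hx: "p * (x - (x0 + \<xi>)) + (y0 + \<eta>) \<le> y0 + \<Delta>" using line_s by (simp add: line_def)
          have "\<bar>x\<bar> \<le> r" using x s xh small D3 \<open>R \<ge> 0\<close> by (auto simp: r_def)
          moreover have "\<bar>p * (x - (x0 + \<xi>)) + (y0 + \<eta>)\<bar> \<le> r"
            using lx hx small D3 \<open>R \<ge> 0\<close> unfolding r_def by linarith
          moreover have "\<bar>p\<bar> \<le> r" using p by (simp add: r_def)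
          ultimately show "\<Lambda> (x, p * (x - (x0 + \<xi>)) + (y0 + \<eta>), p) \<le> C" using C(2) by blast
        qed (use s in simp)
        also have "\<dots> \<le> ennreal (C * (2 * \<Delta>))"
          using s xh small C(1) by (intro ennreal_leI mult_left_mono) auto
        finally show ?thesis by (simp add: ac_simps)
      qed
      define g where "g = join_at s line q"
      have acg: "abs_continuous (x0 + \<xi>) X g" unfolding g_def
        by (rule abs_continuous_join_at[OF acl q(1)]) (use s xh q line_s in auto)
      have Eg: "energy \<Lambda> g (x0 + \<xi>) X = energy \<Lambda> line (x0 + \<xi>) s + energy \<Lambda> q s X"
        unfolding g_def by (rule energy_join_at[OF borel acl q(1)]) (use s xh q line_s in auto)
      have "g \<in> rising_paths X Y (x0 + \<xi>, y0 + \<eta>)"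
      proof -
        have "g (x0 + \<xi>) = y0 + \<eta>" using s by (simp add: g_def join_at_def line_def)
        moreover have "g X = Y" using s xh q line_s by (auto simp: g_def join_at_def)
        moreover have "y0 + \<eta> \<le> g t" if "t \<in> {x0 + \<xi>..X}" for t
        proof (cases "t \<le> s")
          case True
          then show ?thesis using that p by (simp add: g_def join_at_def line_def)
        next
          case False
          then have "y0 + \<Delta> \<le> q t" using q(4) that by auto
          then show ?thesis using False etaD by (simp add: g_def join_at_def)
        qed
        ultimately show ?thesis using acg by (simp add: rising_paths_def)
      qed
      then have "f (x0 + \<xi>, y0 + \<eta>) \<le> energy \<Lambda> g (x0 + \<xi>) X"
        unfolding f_def value_fn_def by (intro INF_lower2[of g]) simp_all
      also have "\<dots> \<le> ennreal (2 * C * \<Delta>) + energy \<Lambda> q s X"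
        unfolding Eg by (rule add_right_mono[OF El])
      finally have "f (x0 + \<xi>, y0 + \<eta>) + ennreal (K' * (\<Delta> / 2))
          \<le> ennreal (2 * C * \<Delta>) + energy \<Lambda> q s X + ennreal (K' * (\<Delta> / 2))"
        by (rule add_right_mono)
      also have "\<dots> = ennreal (2 * C * \<Delta>) + (energy \<Lambda> q s X + ennreal (K' * (\<Delta> / 2)))" by (rule add.assoc)
      also have "\<dots> \<le> ennreal (2 * C * \<Delta>) + (ennreal (V0 + \<Delta>) + ennreal (C * (\<Delta> / 2)) + ennreal \<Delta>)"
        using v(2) e by (intro add_left_mono order_trans[OF Eq] add_mono ennreal_leI) auto
      also have "\<dots> = ennreal V0 + ennreal (2 * C * \<Delta> + \<Delta> + C * (\<Delta> / 2) + \<Delta>)"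
        using V0 \<Delta> C by (simp flip: ennreal_plus)
      also have "\<dots> \<le> ennreal V0 + ennreal ((3 * C + 2) * \<Delta>)"
        using \<Delta> C by (intro add_left_mono ennreal_leI) (simp add: algebra_simps)
      finally have "(f (x0 + \<xi>, y0 + \<eta>) + ennreal (K * \<Delta>)) + ennreal ((3 * C + 2) * \<Delta>)
          \<le> ennreal V0 + ennreal ((3 * C + 2) * \<Delta>)"
      proof -
        assume *: "f (x0 + \<xi>, y0 + \<eta>) + ennreal (K' * (\<Delta> / 2)) \<le> ennreal V0 + ennreal ((3 * C + 2) * \<Delta>)"
        have eq: "K' * (\<Delta> / 2) = K * \<Delta> + (3 * C + 2) * \<Delta>" by (simp add: K'_def algebra_simps)
        have "ennreal (K' * (\<Delta> / 2)) = ennreal (K * \<Delta>) + ennreal ((3 * C + 2) * \<Delta>)"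
          unfolding eq using \<Delta> C \<open>K \<ge> 0\<close> by (intro ennreal_plus) auto
        then show ?thesis using * by (simp add: add.assoc)
      qed
      then have "ennreal ((3 * C + 2) * \<Delta>) + (f (x0 + \<xi>, y0 + \<eta>) + ennreal (K * \<Delta>))
          \<le> ennreal ((3 * C + 2) * \<Delta>) + ennreal V0"
        by (simp only: add.commute)
      then show "f (x0 + \<xi>, y0 + \<eta>) + ennreal (K * \<Delta>) \<le> f (x0, y0)"
        unfolding V0(1) ennreal_add_left_cancel_le by simp
    qed
  qed
  have "(x0, y0) \<in> descent_set X Y"
    using main X(2) yY unfolding descent_set_def V0_def f_def by simp
  then show ?thesis using X(1) Y(1) by blast
qed

end

section \<open>Chains in sets with small gaps\<close>

lemma Ioo_subset_one_of_disjoint: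
  fixes s t :: "nat \<Rightarrow> real"
  assumes dj: "disjoint_family (\<lambda>i. {s i<..<t i})" and sub: "{p<..<q} \<subseteq> (\<Union>i. {s i<..<t i})" and pq: "p < q"
  shows "\<exists>i. s i \<le> p \<and> q \<le> t i"
proof -
  define m where "m = (p + q) / 2"
  have m: "p < m" "m < q" using pq by (auto simp: m_def)
  then obtain i where i: "m \<in> {s i<..<t i}" using sub by fastforce
  have uniq: "j = i" if "x \<in> {s j<..<t j}" "x \<in> {s i<..<t i}" for j x
    using dj that unfolding disjoint_family_on_def by blast
  have "s i \<le> p"
  proof (rule ccontr)
    assume "\<not> s i \<le> p"
    then have "s i \<in> {p<..<q}" using i m by auto
    then obtain j where j: "s i \<in> {s j<..<t j}" using sub by blast
    have "(s i + min (t i) (t j)) / 2 \<in> {s j<..<t j}" "(s i + min (t i) (t j)) / 2 \<in> {s i<..<t i}"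
      using i j by auto
    then have "j = i" by (rule uniq)
    then show False using j by simp
  qed
  moreover have "q \<le> t i"
  proof (rule ccontr)
    assume "\<not> q \<le> t i"
    then have "t i \<in> {p<..<q}" using i m by auto
    then obtain j where j: "t i \<in> {s j<..<t j}" using sub by blast
    have "(t i + max (s i) (s j)) / 2 \<in> {s j<..<t j}" "(t i + max (s i) (s j)) / 2 \<in> {s i<..<t i}"
      using i j by auto
    then have "j = i" by (rule uniq)
    then show False using j by simp
  qed
  ultimately show ?thesis by blast
qed

text \<open>The set is not porous at \<open>y0\<close> from the right.\<close>

definition small_gaps :: "real set \<Rightarrow> real \<Rightarrow> bool" where
  "small_gaps Y y0 \<longleftrightarrow> (\<forall>\<kappa>>0. \<exists>\<delta>>0. \<forall>y1\<in>Y. y0 < y1 \<longrightarrow> y1 < y0 + \<delta> \<longrightarrow>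
    (\<forall>p q. y0 \<le> p \<longrightarrow> q \<le> y1 \<longrightarrow> p < q \<longrightarrow> \<kappa> * (y1 - y0) \<le> q - p \<longrightarrow> Y \<inter> {p..q} \<noteq> {}))"

text \<open>By the Borel-Cantelli lemma: the lengths of the gaps are summable, so almost every point lies in
only finitely many of the intervals that extend each gap to the left by a fixed multiple of its
length.\<close>

lemma gaps_small_almost_everywhere:
  fixes Y :: "real set"
  assumes Y: "Y \<subseteq> {a<..<b}"
  shows "\<exists>N\<in>null_sets lborel. \<forall>y0\<in>Y - N. small_gaps Y y0"
proof -
  define U where "U = {a<..<b} - closure Y"
  have U: "open U" "U \<subseteq> {a<..<b}" by (auto simp: U_def)
  obtain s t :: "nat \<Rightarrow> real" where st: "\<forall>i. s i \<le> t i" "disjoint_family (\<lambda>i. {s i<..<t i})" "U = (\<Union>i. {s i<..<t i})"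
    using bounded_open_real_disjoint_intervals[OF U] by blast
  have sumst: "summable (\<lambda>i. t i - s i)"
  proof -
    have "(\<Sum>i. ennreal (t i - s i)) = (\<Sum>i. emeasure lborel {s i<..<t i})" using st(1) by simp
    also have "\<dots> = emeasure lborel U" unfolding st(3) using st(2) by (intro suminf_emeasure) auto
    also have "\<dots> \<le> emeasure lborel {a<..<b}" using U by (intro emeasure_mono) auto
    also have "\<dots> < \<infinity>" by (cases "a \<le> b") auto
    finally show ?thesis using st(1) by (intro summable_suminf_not_top) auto
  qed
  \<comment> \<open>If the \<open>i\<close>-th gap lies between \<open>y0\<close> and \<open>y1\<close> and has at least the length \<open>(y1 - y0) / (k + 1)\<close>, then
  \<open>y0\<close> is in \<open>J k i\<close>.\<close>
  define J where "J k i = {s i - real (Suc k) * (t i - s i)..s i}" for k i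
  have "limsup (J k) \<in> null_sets lborel" for k
  proof (rule borel_cantelli_limsup1)
    show "J k n \<in> sets lborel" for n by (simp add: J_def)
    have len: "emeasure lborel (J k n) = ennreal (real (Suc k) * (t n - s n))" for n
      using st(1) by (simp add: J_def)
    then show "emeasure lborel (J k n) < \<infinity>" for n by simp
    have "measure lborel (J k n) = real (Suc k) * (t n - s n)" for n
      using len[of n] st(1) by (simp add: measure_def)
    then show "summable (\<lambda>n. measure lborel (J k n))" using sumst by simp
  qed
  then have N1: "(\<Union>k. limsup (J k)) \<in> null_sets lborel" by (intro null_sets_UN) auto
  have N2: "range s \<in> null_sets lborel" by (intro countable_imp_null_set_lborel) auto
  define N where "N = (\<Union>k. limsup (J k)) \<union> range s"
  have N: "N \<in> null_sets lborel" unfolding N_def using N1 N2 by (rule null_sets.Un)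
  show ?thesis
    unfolding small_gaps_def
  proof (intro bexI[OF _ N] ballI allI impI)
    fix y0 \<kappa> :: real assume y0: "y0 \<in> Y - N" and "\<kappa> > 0"
    obtain k :: nat where "1 / \<kappa> \<le> real k" using real_arch_simple[of "1 / \<kappa>"] by blast
    then have k: "1 / \<kappa> \<le> real (Suc k)" by simp
    have "y0 \<notin> limsup (J k)" using y0 by (auto simp: N_def)
    then obtain n0 where n0: "\<forall>n\<ge>n0. y0 \<notin> J k n" by (auto simp: limsup_INF_SUP)
    define D where "D = insert 1 ((\<lambda>i. s i - y0) ` {i. i < n0 \<and> y0 < s i})"
    have D: "finite D" "D \<noteq> {}" by (auto simp: D_def)
    define \<delta> where "\<delta> = Min D"
    have "\<delta> > 0" unfolding \<delta>_def using D by (subst Min_gr_iff) (auto simp: D_def)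
    have \<delta>s: "y0 + \<delta> \<le> s i" if "i < n0" "y0 < s i" for i
    proof -
      have "\<delta> \<le> s i - y0" unfolding \<delta>_def using D that by (intro Min_le) (auto simp: D_def)
      then show ?thesis by simp
    qed
    show "\<exists>\<delta>>0. \<forall>y1\<in>Y. y0 < y1 \<longrightarrow> y1 < y0 + \<delta> \<longrightarrow>
      (\<forall>p q. y0 \<le> p \<longrightarrow> q \<le> y1 \<longrightarrow> p < q \<longrightarrow> \<kappa> * (y1 - y0) \<le> q - p \<longrightarrow> Y \<inter> {p..q} \<noteq> {})"
    proof (intro exI[of _ \<delta>] conjI ballI allI impI \<open>\<delta> > 0\<close>)
      fix y1 p q assume y1: "y1 \<in> Y" "y0 < y1" "y1 < y0 + \<delta>" and pq: "y0 \<le> p" "q \<le> y1" "p < q" "\<kappa> * (y1 - y0) \<le> q - p"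
      show "Y \<inter> {p..q} \<noteq> {}"
      proof
        assume "Y \<inter> {p..q} = {}"
        then have "{p<..<q} \<inter> Y = {}" by auto
        then have "{p<..<q} \<inter> closure Y = {}" by (simp add: open_Int_closure_eq_empty)
        moreover have "{p<..<q} \<subseteq> {a<..<b}" using pq y0 y1 Y by force
        ultimately have "{p<..<q} \<subseteq> (\<Union>i. {s i<..<t i})" using st(3) by (auto simp: U_def)
        then obtain i where i: "s i \<le> p" "q \<le> t i" using Ioo_subset_one_of_disjoint[OF st(2) _ pq(3)] by blast
        have disj: "{s i<..<t i} \<inter> Y = {}" using st(3) closure_subset[of Y] by (auto simp: U_def)
        have "y0 \<le> s i" using disj y0 pq i by (meson DiffD1 disjoint_iff greaterThanLessThan_iff le_less_trans less_le_trans not_le)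
        moreover have "y0 \<noteq> s i" using y0 by (auto simp: N_def)
        ultimately have ys: "y0 < s i" by simp
        have "s i < y1" using i pq by simp
        then have "\<not> i < n0" using \<delta>s[of i] ys y1 by auto
        then have "y0 \<notin> J k i" using n0 by auto
        then have "real (Suc k) * (t i - s i) < s i - y0" using ys by (auto simp: J_def)
        also have "\<dots> \<le> y1 - y0" using \<open>s i < y1\<close> by simp
        also have "\<dots> \<le> (1 / \<kappa>) * (q - p)" using pq(4) \<open>\<kappa> > 0\<close> by (simp add: field_simps)
        also have "\<dots> \<le> real (Suc k) * (q - p)" using k pq(3) by (intro mult_right_mono) auto
        also have "\<dots> \<le> real (Suc k) * (t i - s i)" using i by (intro mult_left_mono) auto
        finally show False by simp
      qed
    qed
  qed
qed

context growth
begin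

text \<open>Since \<open>w p / p\<close> increases with \<open>p\<close>, a hop of height at most \<open>d\<close> and cost at least \<open>c\<close> has a slope \<open>p\<close> with
\<open>c / d \<le> w p / p\<close>. The chord of the chain is at least as steep as its least steep hop.\<close>

lemma chain_steepness:
  fixes X :: "real \<Rightarrow> real"
  assumes mono: "\<And>i. i < m \<Longrightarrow> e i \<le> e (Suc i)" and gap: "\<And>i. i < m \<Longrightarrow> e (Suc i) - e i \<le> d"
    and c: "c > 0" and d: "d > 0"
    and hop: "\<And>i. i < m \<Longrightarrow> X (e (Suc i)) = X (e i) \<or>
       c \<le> \<bar>X (e (Suc i)) - X (e i)\<bar> * w ((e (Suc i) - e i) / \<bar>X (e (Suc i)) - X (e i)\<bar>)"
    and ne: "X (e m) \<noteq> X (e 0)"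
  shows "(c / d) * (e m - e 0) \<le> \<bar>X (e m) - X (e 0)\<bar> * w ((e m - e 0) / \<bar>X (e m) - X (e 0)\<bar>)"
proof (rule ccontr)
  define \<xi> where "\<xi> i = \<bar>X (e (Suc i)) - X (e i)\<bar>" for i
  define T where "T = \<bar>X (e m) - X (e 0)\<bar>"
  have T: "T > 0" using ne by (simp add: T_def)
  define D where "D = e m - e 0"
  have tele: "(\<Sum>i<m. e (Suc i) - e i) = D" unfolding D_def by (rule sum_lessThan_telescope)
  have D0: "D \<ge> 0" unfolding tele[symmetric] using mono by (intro sum_nonneg) auto
  have sumT: "T \<le> (\<Sum>i<m. \<xi> i)"
  proof -
    have "X (e m) - X (e 0) = (\<Sum>i<m. X (e (Suc i)) - X (e i))"
      using sum_lessThan_telescope[of "\<lambda>i. X (e i)" m] by simp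
    then show ?thesis unfolding T_def \<xi>_def by (simp add: sum_abs)
  qed
  assume "\<not> (c / d) * (e m - e 0) \<le> \<bar>X (e m) - X (e 0)\<bar> * w ((e m - e 0) / \<bar>X (e m) - X (e 0)\<bar>)"
  then have lt: "T * w (D / T) < (c / d) * D" by (simp add: T_def D_def)
  have "0 \<le> T * w (D / T)" using T nonneg by simp
  then have Dpos: "D > 0" using lt D0 by (cases "D = 0") auto
  define P where "P = D / T"
  have P: "P > 0" using Dpos T by (simp add: P_def)
  have slope: "w P / P < c / d" using lt T Dpos by (simp add: P_def field_simps)
  have strict: "P * \<xi> i < e (Suc i) - e i" if i: "i < m" and pos: "\<xi> i > 0" for i
  proof -
    define l where "l = e (Suc i) - e i"
    have h: "c \<le> \<xi> i * w (l / \<xi> i)" using hop[OF i] pos by (auto simp: \<xi>_def l_def)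
    have l0: "l \<ge> 0" using mono[OF i] by (simp add: l_def)
    have lpos: "l > 0"
    proof (rule ccontr)
      assume "\<not> l > 0"
      then have "l = 0" using l0 by simp
      then show False using h c zero by simp
    qed
    have "c / d \<le> c / l" using gap[OF i] c lpos d by (intro divide_left_mono) (auto simp: l_def)
    also have "\<dots> \<le> w (l / \<xi> i) / (l / \<xi> i)" using h lpos pos by (simp add: field_simps)
    finally have "w P / P < w (l / \<xi> i) / (l / \<xi> i)" using slope by simp
    then have "\<not> l / \<xi> i \<le> P" using slope_mono[of "l / \<xi> i" P] lpos pos by auto
    then show ?thesis using pos by (simp add: l_def field_simps)
  qed
  have weak: "P * \<xi> i \<le> e (Suc i) - e i" if "i < m" for i
    using strict[OF that] mono[OF that] by (cases "\<xi> i > 0") (auto simp: \<xi>_def)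
  have "\<exists>i<m. \<xi> i > 0"
  proof (rule ccontr)
    assume "\<not> ?thesis"
    then have "(\<Sum>i<m. \<xi> i) \<le> 0" by (intro sum_nonpos) auto
    then show False using sumT T by simp
  qed
  then have "(\<Sum>i<m. P * \<xi> i) < (\<Sum>i<m. e (Suc i) - e i)"
    using weak strict by (intro sum_strict_mono_ex1) auto
  then have "P * (\<Sum>i<m. \<xi> i) < D" by (simp add: tele sum_distrib_left)
  moreover have "P * T \<le> P * (\<Sum>i<m. \<xi> i)" using sumT P by (intro mult_left_mono) auto
  moreover have "P * T = D" using T by (simp add: P_def)
  ultimately show False by simp
qed

text \<open>Small gaps provide a chain of about \<open>n\<close> hops, each of height at most \<open>2 / n\<close> times the total height,
and \<open>n\<close> is chosen proportional to \<open>E\<close>.\<close>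

lemma steepness_upgrade:
  fixes X :: "real \<Rightarrow> real"
  assumes hop: "\<And>y y'. y \<in> Y \<Longrightarrow> y' \<in> Y \<Longrightarrow> X y' = X y \<or> c \<le> \<bar>X y' - X y\<bar> * w ((y' - y) / \<bar>X y' - X y\<bar>)"
    and c: "c > 0" and y0: "y0 \<in> Y"
    and gaps: "small_gaps Y y0"
  shows "\<exists>\<delta>>0. \<forall>y1\<in>Y. y0 < y1 \<longrightarrow> y1 < y0 + \<delta> \<longrightarrow> X y1 \<noteq> X y0 \<longrightarrow>
    E \<le> \<bar>X y1 - X y0\<bar> * w ((y1 - y0) / \<bar>X y1 - X y0\<bar>)"
proof -
  obtain n :: nat where n: "2 * \<bar>E\<bar> / c + 1 \<le> real n" using real_arch_simple by blast
  have "0 \<le> 2 * \<bar>E\<bar> / c" using c by simp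
  then have n0: "real n > 0" using n by linarith
  have En: "E \<le> c * real n / 2"
  proof -
    have "2 * \<bar>E\<bar> / c \<le> real n" using n by simp
    then have "2 * \<bar>E\<bar> \<le> c * real n" using c by (simp add: field_simps)
    then show ?thesis by linarith
  qed
  have "1 / real n > 0" using n0 by simp
  from gaps[unfolded small_gaps_def, rule_format, OF this] obtain \<delta> where \<delta>: "\<delta> > 0" "\<forall>y1\<in>Y. y0 < y1 \<longrightarrow> y1 < y0 + \<delta> \<longrightarrow>
      (\<forall>p q. y0 \<le> p \<longrightarrow> q \<le> y1 \<longrightarrow> p < q \<longrightarrow> (1 / real n) * (y1 - y0) \<le> q - p \<longrightarrow> Y \<inter> {p..q} \<noteq> {})"
    by auto
  show ?thesis
  proof (intro exI[of _ \<delta>] conjI ballI impI \<delta>(1))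
    fix y1 assume y1: "y1 \<in> Y" "y0 < y1" "y1 < y0 + \<delta>" and ne: "X y1 \<noteq> X y0"
    define D where "D = y1 - y0"
    have D: "D > 0" using y1 by (simp add: D_def)
    define g where "g i = y0 + real i * (D / real n)" for i
    have gS: "g (Suc i) = g i + D / real n" for i by (simp add: g_def algebra_simps add_divide_distrib)
    have "\<exists>z. z \<in> Y \<inter> {g i..g (Suc i)}" if "i < n" for i
    proof -
      have "Y \<inter> {g i..g (Suc i)} \<noteq> {}"
      proof (rule \<delta>(2)[rule_format, OF y1])
        show "y0 \<le> g i" using D n0 by (simp add: g_def)
        have "real (Suc i) * (D / real n) \<le> real n * (D / real n)" using that D by (intro mult_right_mono) auto
        then show "g (Suc i) \<le> y1" using n0 by (simp add: g_def D_def)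
        show "g i < g (Suc i)" using D n0 by (simp add: gS)
        show "(1 / real n) * (y1 - y0) \<le> g (Suc i) - g i" by (simp add: gS D_def)
      qed
      then show ?thesis by blast
    qed
    then obtain z where z: "\<And>i. i < n \<Longrightarrow> z i \<in> Y \<inter> {g i..g (Suc i)}" by metis
    \<comment> \<open>One point of \<open>Y\<close> in each of the \<open>n\<close> equal parts, together with both ends.\<close>
    define e where "e i = (if i = 0 then y0 else if i \<le> n then z (i - 1) else y1)" for i
    have gn: "g n = y1" using n0 by (simp add: g_def D_def)
    have g0: "g 0 = y0" by (simp add: g_def)
    have eY: "e i \<in> Y" for i using y0 y1 z[of "i - 1"] by (auto simp: e_def)
    have lo: "g (i - 1) \<le> e i" "e i \<le> g i" if "i \<le> n" "i > 0" for i
      using z[of "i - 1"] that by (auto simp: e_def)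
    have step: "e i \<le> e (Suc i) \<and> e (Suc i) - e i \<le> 2 * (D / real n)" if "i < Suc n" for i
    proof -
      have q: "D / real n > 0" using D n0 by simp
      consider "i = 0" | "i > 0" "i < n" | "i = n" "i > 0" using \<open>i < Suc n\<close> by linarith
      then show ?thesis
      proof cases
        case 1
        then have "e i = g 0" "g 0 \<le> e (Suc i)" "e (Suc i) \<le> g 1"
          using lo[of 1] n0 g0 by (auto simp: e_def)
        then show ?thesis using gS[of 0] q by simp
      next
        case 2
        then have "g (i - 1) \<le> e i" "e i \<le> g i" "g i \<le> e (Suc i)" "e (Suc i) \<le> g (Suc i)"
          using lo[of i] lo[of "Suc i"] by auto
        then show ?thesis using gS[of i] gS[of "i - 1"] 2 by simp
      next
        case 3
        then have "g (i - 1) \<le> e i" "e i \<le> g i" "e (Suc i) = g i"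
          using lo[of i] gn by (auto simp: e_def)
        then show ?thesis using gS[of "i - 1"] 3 q by simp
      qed
    qed
    have ends: "e 0 = y0" "e (Suc n) = y1" by (auto simp: e_def)
    have ch: "(c / (2 * (D / real n))) * (e (Suc n) - e 0) \<le>
        \<bar>X (e (Suc n)) - X (e 0)\<bar> * w ((e (Suc n) - e 0) / \<bar>X (e (Suc n)) - X (e 0)\<bar>)"
    proof (rule chain_steepness)
      show "X (e (Suc i)) = X (e i) \<or> c \<le> \<bar>X (e (Suc i)) - X (e i)\<bar> * w ((e (Suc i) - e i) / \<bar>X (e (Suc i)) - X (e i)\<bar>)" for i
        by (rule hop[OF eY eY])
    qed (use step c D n0 ne ends in auto)
    have "e (Suc n) - e 0 = D" by (simp add: ends D_def)
    then have eq: "(c / (2 * (D / real n))) * (e (Suc n) - e 0) = c * real n / 2"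
      using D n0 by (simp add: field_simps)
    have "c * real n / 2 \<le> \<bar>X y1 - X y0\<bar> * w ((y1 - y0) / \<bar>X y1 - X y0\<bar>)"
      using ch unfolding eq unfolding ends .
    then show "E \<le> \<bar>X y1 - X y0\<bar> * w ((y1 - y0) / \<bar>X y1 - X y0\<bar>)" using En by linarith
  qed
qed

end

section \<open>Singular points on graphs\<close>

context bounded_growth
begin

lemma right_singular_subset_descent_sets:
  "right_singular \<Lambda> \<subseteq> (\<Union>(X, Y)\<in>\<rat> \<times> \<rat>. descent_set X Y)"
proof
  fix z assume z: "z \<in> right_singular \<Lambda>"
  obtain x0 y0 where zz: "z = (x0, y0)" by fastforce
  from value_fn_descent[OF z[unfolded zz]] obtain X Y where "X \<in> \<rat>" "Y \<in> \<rat>" "(x0, y0) \<in> descent_set X Y"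
    by blast
  then show "z \<in> (\<Union>(X, Y)\<in>\<rat> \<times> \<rat>. descent_set X Y)" unfolding zz by blast
qed

lemma content1_zero_of_descent_sets:
  assumes "\<And>X Y. content1 (G \<inter> descent_set X Y) = 0"
  shows "content1 (G \<inter> right_singular \<Lambda>) = 0"
proof -
  have "content1 (\<Union>XY\<in>\<rat> \<times> \<rat>. G \<inter> (case XY of (X, Y) \<Rightarrow> descent_set X Y)) = 0"
    using assms by (intro content1_zero_countable_UN countable_SIGMA countable_rat) auto
  moreover have "G \<inter> right_singular \<Lambda> \<subseteq> (\<Union>XY\<in>\<rat> \<times> \<rat>. G \<inter> (case XY of (X, Y) \<Rightarrow> descent_set X Y))"
    using right_singular_subset_descent_sets by blast
  ultimately show ?thesis by (rule content1_zero_subset)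
qed

lemma dist_le_sum: "dist (x', y') (x, y) \<le> \<bar>x' - x\<bar> + \<bar>y' - (y::real)\<bar>" for x x' :: real
  using sqrt_sum_squares_le_sum_abs[of "x' - x" "y' - y"] by (simp add: dist_Pair_Pair dist_real_def)

lemma dist_coordinates: "\<bar>x' - x\<bar> \<le> dist (x', y') (x, y)" "\<bar>y' - y\<bar> \<le> dist (x', y') (x, y)" for x x' y y' :: real
  using dist_fst_le[of "(x', y')" "(x, y)"] dist_snd_le[of "(x', y')" "(x, y)"] by (auto simp: dist_real_def)

lemma descent_step:
  assumes "x' < X" "y' < Y" "x0 < X" "y0 < Y" "K \<ge> 0" "\<Delta> \<ge> 0" "\<bar>x' - x0\<bar> \<le> \<Delta>" "\<bar>y' - y0\<bar> \<le> \<Delta>"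
    and le: "value_fn \<Lambda> X Y (x', y') + ennreal (2 * K * \<Delta>) \<le> value_fn \<Lambda> X Y (x0, y0)"
  shows "enn2real (value_fn \<Lambda> X Y (x', y')) \<le> enn2real (value_fn \<Lambda> X Y (x0, y0)) - K * dist (x', y') (x0, y0)"
proof -
  obtain a where a: "0 \<le> a" "value_fn \<Lambda> X Y (x', y') = ennreal a"
    using value_fn_finite[of x' X y' Y] assms by (auto simp: less_top_ennreal)
  obtain b where b: "0 \<le> b" "value_fn \<Lambda> X Y (x0, y0) = ennreal b"
    using value_fn_finite[of x0 X y0 Y] assms by (auto simp: less_top_ennreal)
  have "ennreal (a + 2 * K * \<Delta>) \<le> ennreal b"
    using le a b assms by (simp add: ennreal_plus)
  then have "a + 2 * K * \<Delta> \<le> b" using b(1) by (simp add: ennreal_le_iff)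
  moreover have "K * dist (x', y') (x0, y0) \<le> K * (2 * \<Delta>)"
    using dist_le_sum[of x' y' x0 y0] assms by (intro mult_left_mono) auto
  ultimately show ?thesis using a b by simp
qed

text \<open>A point of the graph to the left of a singular point gains the height \<open>\<Delta> = R' * (x0 - x)\<close> within the
horizontal distance \<open>x0 - x\<close> by a segment of slope at most \<open>2 * R'\<close>. So the value function drops in the
direction of decreasing first coordinate.\<close>

theorem content1_singular_lipschitz_graph:
  assumes G: "\<And>x y x' y'. (x, y) \<in> G \<Longrightarrow> (x', y') \<in> G \<Longrightarrow> \<bar>y' - y\<bar> \<le> R * \<bar>x' - x\<bar>"
  shows "content1 (G \<inter> right_singular \<Lambda>) = 0"
proof (rule content1_zero_of_descent_sets)
  fix X Y :: real
  define R' where "R' = max R 1"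
  have R': "R' \<ge> 1" "R \<le> R'" by (auto simp: R'_def)
  show "content1 (G \<inter> descent_set X Y) = 0"
  proof (rule content1_zero_of_descent[where \<kappa>="\<lambda>z. - fst z" and f="\<lambda>z. enn2real (value_fn \<Lambda> X Y z)"])
    show "inj_on (\<lambda>z. - fst z) (G \<inter> descent_set X Y)"
    proof (rule inj_onI)
      fix z z' assume z: "z \<in> G \<inter> descent_set X Y" "z' \<in> G \<inter> descent_set X Y" "- fst z = - fst z'"
      obtain x y x' y' where "z = (x, y)" "z' = (x', y')" by fastforce
      then show "z = z'" using G[of x y x' y'] z by auto
    qed
    fix z K assume z: "z \<in> G \<inter> descent_set X Y" and K: "(K::real) > 0"
    obtain x0 y0 where zz: "z = (x0, y0)" by fastforce
    have z0: "(x0, y0) \<in> G" "x0 < X" "y0 < Y" using z zz by (auto simp: descent_set_def)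
    have "2 * K \<ge> 0" "2 * R' \<ge> 0" using K R' by auto
    then obtain \<delta> where \<delta>: "\<delta> > 0" "\<forall>\<xi> \<eta> \<Delta>. 0 < \<Delta> \<longrightarrow> \<Delta> < \<delta> \<longrightarrow> \<bar>\<xi>\<bar> \<le> \<Delta> \<longrightarrow> \<bar>\<eta>\<bar> \<le> \<Delta> \<longrightarrow>
       \<Delta> - \<eta> \<le> 2 * R' * max (- \<xi>) 0 \<longrightarrow>
       (\<xi> > 0 \<longrightarrow> enn2real (value_fn \<Lambda> X Y (x0, y0)) + 3 \<le> \<xi> * w (\<Delta> / \<xi>)) \<longrightarrow>
       value_fn \<Lambda> X Y (x0 + \<xi>, y0 + \<eta>) + ennreal (2 * K * \<Delta>) \<le> value_fn \<Lambda> X Y (x0, y0)"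
      using z unfolding zz descent_set_def by blast
    show "\<exists>\<delta>>0. \<forall>z'\<in>G \<inter> descent_set X Y. dist z' z < \<delta> \<and> - fst z < - fst z' \<longrightarrow>
        enn2real (value_fn \<Lambda> X Y z') \<le> enn2real (value_fn \<Lambda> X Y z) - K * dist z' z"
    proof (intro exI[of _ "\<delta> / R'"] conjI ballI impI)
      show "\<delta> / R' > 0" using \<delta> R' by simp
      fix z' assume z': "z' \<in> G \<inter> descent_set X Y" and near: "dist z' z < \<delta> / R' \<and> - fst z < - fst z'"
      obtain x y where zz': "z' = (x, y)" by fastforce
      have g: "(x, y) \<in> G" "x < X" "y < Y" "x < x0" using z' near zz zz' by (auto simp: descent_set_def)
      define \<Delta> where "\<Delta> = R' * (x0 - x)"
      have gap: "\<bar>y - y0\<bar> \<le> \<Delta>"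
      proof -
        have "\<bar>y - y0\<bar> \<le> R * \<bar>x - x0\<bar>" by (rule G[OF z0(1) g(1)])
        also have "\<dots> \<le> R' * \<bar>x - x0\<bar>" using R' by (intro mult_right_mono) auto
        finally show ?thesis using g(4) by (simp add: \<Delta>_def)
      qed
      have hor: "\<bar>x - x0\<bar> \<le> \<Delta>"
      proof -
        have "1 * (x0 - x) \<le> R' * (x0 - x)" using R' g(4) by (intro mult_right_mono) auto
        then show ?thesis using g(4) by (simp add: \<Delta>_def)
      qed
      have D0: "0 < \<Delta>" using R' g(4) by (simp add: \<Delta>_def)
      have "x0 - x < \<delta> / R'" using dist_coordinates(1)[of x x0 y y0] near zz zz' by auto
      then have D1: "\<Delta> < \<delta>" using R' by (simp add: \<Delta>_def field_simps)
      have "value_fn \<Lambda> X Y (x0 + (x - x0), y0 + (y - y0)) + ennreal (2 * K * \<Delta>) \<le> value_fn \<Lambda> X Y (x0, y0)"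
      proof (rule \<delta>(2)[rule_format, OF D0 D1 hor gap])
        have "\<Delta> - (y - y0) \<le> 2 * \<Delta>" using gap by auto
        also have "\<dots> = 2 * R' * max (- (x - x0)) 0" using g(4) by (simp add: \<Delta>_def max_def)
        finally show "\<Delta> - (y - y0) \<le> 2 * R' * max (- (x - x0)) 0" .
      qed (use g in simp)
      then have "value_fn \<Lambda> X Y (x, y) + ennreal (2 * K * \<Delta>) \<le> value_fn \<Lambda> X Y (x0, y0)" by simp
      then show "enn2real (value_fn \<Lambda> X Y z') \<le> enn2real (value_fn \<Lambda> X Y z) - K * dist z' z"
        unfolding zz zz' using g z0 K D0 hor gap by (intro descent_step) auto
    qed
  qed
qed

text \<open>The value function drops in the direction of increasing height: the displaced point moves
horizontally to the right and \<open>\<Delta>\<close> is the difference in height. It starts to the left of nearly optimal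
paths wherever the steepness of the graph tends to infinity, that is, except for heights in a null
set, and these carry a null part of the graph.\<close>

theorem content1_singular_steep_graph_local:
  assumes G: "\<And>x y x' y'. (x, y) \<in> G \<Longrightarrow> (x', y') \<in> G \<Longrightarrow> x' = x \<or> c \<le> \<bar>x' - x\<bar> * w ((y' - y) / (x' - x))"
    and vert: "\<And>x y x' y'. (x, y) \<in> G \<Longrightarrow> (x', y') \<in> G \<Longrightarrow> \<bar>x' - x\<bar> \<le> \<bar>y' - y\<bar>"
    and c: "c > 0" and bdd: "snd ` G \<subseteq> {a<..<b}"
  shows "content1 (G \<inter> right_singular \<Lambda>) = 0"
proof -
  have inj: "inj_on snd G"
  proof (rule inj_onI)
    fix z z' assume z: "z \<in> G" "z' \<in> G" "snd z = snd z'"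
    obtain x y x' y' where "z = (x, y)" "z' = (x', y')" by fastforce
    then show "z = z'" using vert[of x y x' y'] z by auto
  qed
  define Yset where "Yset = snd ` G"
  define Xf where "Xf y = fst (the_inv_into G snd y)" for y
  have Xf: "Xf y = x" if "(x, y) \<in> G" for x y
    using the_inv_into_f_f[OF inj that] by (simp add: Xf_def)
  have Xin: "(Xf y, y) \<in> G" if "y \<in> Yset" for y
    using that Xf by (force simp: Yset_def)
  have w_abs: "w (d / \<bar>e\<bar>) = w (d / e)" for d e
    using even[of "d / e"] by (cases "e \<ge> 0") auto
  have hop: "Xf y' = Xf y \<or> c \<le> \<bar>Xf y' - Xf y\<bar> * w ((y' - y) / \<bar>Xf y' - Xf y\<bar>)" if "y \<in> Yset" "y' \<in> Yset" for y y'
    using G[OF Xin[OF that(1)] Xin[OF that(2)]] by (simp add: w_abs)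
  obtain N where N: "N \<in> null_sets lborel" and
    gaps: "\<forall>y0\<in>Yset - N. small_gaps Yset y0"
    using gaps_small_almost_everywhere[of Yset a b] bdd unfolding Yset_def by blast
  define G1 where "G1 = {z \<in> G. snd z \<in> N}"
  define G2 where "G2 = {z \<in> G. snd z \<notin> N}"
  have "content1 G1 = 0"
  proof -
    have "content1 ((\<lambda>y. (Xf y, y)) ` (Yset \<inter> N)) = 0"
    proof (rule content1_lipschitz_null[where \<epsilon>=2])
      show "Yset \<inter> N \<in> null_sets lebesgue" using N null_sets_completion_iff2 by blast
      show "Yset \<inter> N \<subseteq> {a<..<b}" using bdd by (auto simp: Yset_def)
      fix q q' assume q: "q \<in> Yset \<inter> N" "q' \<in> Yset \<inter> N" "q' < q"
      have "dist (Xf q', q') (Xf q, q) \<le> \<bar>Xf q' - Xf q\<bar> + \<bar>q' - q\<bar>" by (rule dist_le_sum)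
      also have "\<dots> \<le> 2 * (q - q')" using vert[OF Xin Xin, of q q'] q by auto
      finally show "dist (Xf q', q') (Xf q, q) \<le> 2 * (q - q')" .
    qed simp
    moreover have "G1 \<subseteq> (\<lambda>y. (Xf y, y)) ` (Yset \<inter> N)"
    proof
      fix z assume z: "z \<in> G1"
      then have "z = (Xf (snd z), snd z)" using Xf[of "fst z" "snd z"] by (auto simp: G1_def prod_eq_iff)
      then show "z \<in> (\<lambda>y. (Xf y, y)) ` (Yset \<inter> N)" using z by (auto simp: G1_def Yset_def intro!: image_eqI)
    qed
    ultimately show ?thesis by (rule content1_zero_subset)
  qed
  moreover have "content1 (G2 \<inter> right_singular \<Lambda>) = 0"
  proof (rule content1_zero_of_descent_sets)
    fix X Y :: real
    show "content1 (G2 \<inter> descent_set X Y) = 0"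
    proof (rule content1_zero_of_descent[where \<kappa>=snd and f="\<lambda>z. enn2real (value_fn \<Lambda> X Y z)"])
      show "inj_on snd (G2 \<inter> descent_set X Y)" by (rule inj_on_subset[OF inj]) (auto simp: G2_def)
      fix z K assume z: "z \<in> G2 \<inter> descent_set X Y" and K: "(K::real) > 0"
      obtain x0 y0 where zz: "z = (x0, y0)" by fastforce
      have z0: "(x0, y0) \<in> G" "y0 \<notin> N" "x0 < X" "y0 < Y" using z zz by (auto simp: descent_set_def G2_def)
      have y0: "y0 \<in> Yset" using z0(1) by (force simp: Yset_def)
      have "2 * K \<ge> 0" "(0::real) \<ge> 0" using K by auto
      then obtain \<delta> where \<delta>: "\<delta> > 0" "\<forall>\<xi> \<eta> \<Delta>. 0 < \<Delta> \<longrightarrow> \<Delta> < \<delta> \<longrightarrow> \<bar>\<xi>\<bar> \<le> \<Delta> \<longrightarrow> \<bar>\<eta>\<bar> \<le> \<Delta> \<longrightarrow>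
         \<Delta> - \<eta> \<le> 0 * max (- \<xi>) 0 \<longrightarrow>
         (\<xi> > 0 \<longrightarrow> enn2real (value_fn \<Lambda> X Y (x0, y0)) + 3 \<le> \<xi> * w (\<Delta> / \<xi>)) \<longrightarrow>
         value_fn \<Lambda> X Y (x0 + \<xi>, y0 + \<eta>) + ennreal (2 * K * \<Delta>) \<le> value_fn \<Lambda> X Y (x0, y0)"
        using z unfolding zz descent_set_def by blast
      define E where "E = enn2real (value_fn \<Lambda> X Y (x0, y0)) + 3"
      have "small_gaps Yset y0" using gaps y0 z0(2) by blast
      from steepness_upgrade[OF hop c y0 this]
      obtain \<delta>' where \<delta>': "\<delta>' > 0" "\<forall>y1\<in>Yset. y0 < y1 \<longrightarrow> y1 < y0 + \<delta>' \<longrightarrow> Xf y1 \<noteq> Xf y0 \<longrightarrow>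
          E \<le> \<bar>Xf y1 - Xf y0\<bar> * w ((y1 - y0) / \<bar>Xf y1 - Xf y0\<bar>)" by blast
      show "\<exists>\<delta>>0. \<forall>z'\<in>G2 \<inter> descent_set X Y. dist z' z < \<delta> \<and> snd z < snd z' \<longrightarrow>
          enn2real (value_fn \<Lambda> X Y z') \<le> enn2real (value_fn \<Lambda> X Y z) - K * dist z' z"
      proof (intro exI[of _ "min \<delta> \<delta>'"] conjI ballI impI)
        show "min \<delta> \<delta>' > 0" using \<delta> \<delta>' by simp
        fix z' assume z': "z' \<in> G2 \<inter> descent_set X Y" and near: "dist z' z < min \<delta> \<delta>' \<and> snd z < snd z'"
        obtain x y where zz': "z' = (x, y)" by fastforce
        have g: "(x, y) \<in> G" "x < X" "y < Y" "y0 < y" using z' near zz zz' by (auto simp: descent_set_def G2_def)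
        have yY: "y \<in> Yset" using g(1) by (force simp: Yset_def)
        have "y - y0 < min \<delta> \<delta>'" using dist_coordinates(2)[of y y0 x x0] near zz zz' by auto
        then have D: "0 < y - y0" "y - y0 < \<delta>" "y < y0 + \<delta>'" using g(4) by auto
        have hor: "\<bar>x - x0\<bar> \<le> y - y0" using vert[OF z0(1) g(1)] g(4) by simp
        have ver: "\<bar>y - y0\<bar> \<le> y - y0" using g(4) by simp
        have "value_fn \<Lambda> X Y (x0 + (x - x0), y0 + (y - y0)) + ennreal (2 * K * (y - y0)) \<le> value_fn \<Lambda> X Y (x0, y0)"
        proof (rule \<delta>(2)[rule_format, OF D(1,2) hor ver])
          show "y - y0 - (y - y0) \<le> 0 * max (- (x - x0)) 0" by simp
          assume pos: "x - x0 > 0"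
          have "Xf y \<noteq> Xf y0" using Xf[OF g(1)] Xf[OF z0(1)] pos by simp
          then have "E \<le> \<bar>Xf y - Xf y0\<bar> * w ((y - y0) / \<bar>Xf y - Xf y0\<bar>)"
            using \<delta>'(2) yY g(4) D(3) by blast
          then show "enn2real (value_fn \<Lambda> X Y (x0, y0)) + 3 \<le> (x - x0) * w ((y - y0) / (x - x0))"
            using Xf[OF g(1)] Xf[OF z0(1)] pos by (simp add: E_def)
        qed
        then have "value_fn \<Lambda> X Y (x, y) + ennreal (2 * K * (y - y0)) \<le> value_fn \<Lambda> X Y (x0, y0)" by simp
        then show "enn2real (value_fn \<Lambda> X Y z') \<le> enn2real (value_fn \<Lambda> X Y z) - K * dist z' z"
          unfolding zz zz' using g z0 K hor by (intro descent_step) auto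
      qed
    qed
  qed
  moreover have "G \<inter> right_singular \<Lambda> \<subseteq> G1 \<union> (G2 \<inter> right_singular \<Lambda>)" by (auto simp: G1_def G2_def)
  ultimately show ?thesis by (meson content1_zero_Un content1_zero_subset)
qed

text \<open>Nearby points satisfy \<open>\<bar>x' - x\<bar> \<le> \<bar>y' - y\<bar>\<close>, as otherwise \<open>c \<le> \<bar>x' - x\<bar> * w 1\<close>.\<close>

theorem content1_singular_steep_graph:
  assumes G: "\<And>x y x' y'. (x, y) \<in> G \<Longrightarrow> (x', y') \<in> G \<Longrightarrow> x' = x \<or> c \<le> \<bar>x' - x\<bar> * w ((y' - y) / (x' - x))"
    and c: "c > 0"
  shows "content1 (G \<inter> right_singular \<Lambda>) = 0"
proof -
  define r where "r = c / (2 * (w 1 + 1))"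
  have w1: "w 1 \<ge> 0" by (rule nonneg)
  have r: "r > 0" using c w1 by (simp add: r_def)
  obtain E :: "(real \<times> real) set" where E: "countable E" "\<And>X. open X \<Longrightarrow> X \<noteq> {} \<Longrightarrow> \<exists>d\<in>E. d \<in> X"
    using countable_dense_exists by blast
  have piece: "content1 ((G \<inter> ball e r) \<inter> right_singular \<Lambda>) = 0" for e
  proof (rule content1_singular_steep_graph_local[OF _ _ c])
    have near: "dist z z' < 2 * r" if "z \<in> ball e r" "z' \<in> ball e r" for z z'
      using that dist_triangle3[of z z' e] by auto
    show "x' = x \<or> c \<le> \<bar>x' - x\<bar> * w ((y' - y) / (x' - x))" if "(x, y) \<in> G \<inter> ball e r" "(x', y') \<in> G \<inter> ball e r" for x y x' y'
      using G that by blast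
    show "\<bar>x' - x\<bar> \<le> \<bar>y' - y\<bar>" if z: "(x, y) \<in> G \<inter> ball e r" "(x', y') \<in> G \<inter> ball e r" for x y x' y'
    proof (rule ccontr)
      assume n: "\<not> \<bar>x' - x\<bar> \<le> \<bar>y' - y\<bar>"
      then have ne: "x' \<noteq> x" by auto
      have "w ((y' - y) / (x' - x)) = w \<bar>(y' - y) / (x' - x)\<bar>" by (simp only: abs_arg)
      also have "\<dots> \<le> w 1" using n ne by (intro mono) (auto simp: abs_divide field_simps)
      finally have "c \<le> \<bar>x' - x\<bar> * w 1"
        using G[of x y x' y'] z ne by (auto intro: order_trans[OF _ mult_left_mono])
      also have "\<dots> \<le> dist (x', y') (x, y) * w 1"
        using w1 dist_coordinates(1)[of x' x y' y] by (intro mult_right_mono) auto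
      also have "\<dots> \<le> 2 * r * w 1" using w1 near[of "(x', y')" "(x, y)"] z by (intro mult_right_mono) auto
      also have "\<dots> < c" using c w1 by (simp add: r_def field_simps)
      finally show False by simp
    qed
    have "snd p \<in> {snd e - r<..<snd e + r}" if "p \<in> ball e r" for p
      using that dist_snd_le[of e p] by (auto simp: dist_real_def)
    then show "snd ` (G \<inter> ball e r) \<subseteq> {snd e - r<..<snd e + r}" by blast
  qed
  have "content1 (\<Union>e\<in>E. (G \<inter> ball e r) \<inter> right_singular \<Lambda>) = 0"
    using piece E(1) by (intro content1_zero_countable_UN)
  moreover have "G \<inter> right_singular \<Lambda> \<subseteq> (\<Union>e\<in>E. (G \<inter> ball e r) \<inter> right_singular \<Lambda>)"
  proof
    fix z assume z: "z \<in> G \<inter> right_singular \<Lambda>"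
    obtain e where "e \<in> E" "e \<in> ball z r" using E(2)[of "ball z r"] r by fastforce
    then show "z \<in> (\<Union>e\<in>E. (G \<inter> ball e r) \<inter> right_singular \<Lambda>)" using z by (auto simp: dist_commute)
  qed
  ultimately show ?thesis by (rule content1_zero_subset)
qed

end

section \<open>Decomposition of the curve\<close>

definition lipschitz_at :: "(real \<Rightarrow> real) \<Rightarrow> (real \<Rightarrow> real) \<Rightarrow> real set \<Rightarrow> nat \<Rightarrow> real \<Rightarrow> bool" where
  "lipschitz_at x y S m t \<longleftrightarrow> (\<forall>s\<in>S. \<bar>s - t\<bar> < 1 / real m \<longrightarrow>
     x s = x t \<or> \<bar>y s - y t\<bar> \<le> real m * \<bar>x s - x t\<bar>)"

definition steep_at :: "(real \<Rightarrow> real) \<Rightarrow> (real \<Rightarrow> real) \<Rightarrow> (real \<Rightarrow> real) \<Rightarrow> real set \<Rightarrow> nat \<Rightarrow> real \<Rightarrow> bool" where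
  "steep_at w x y S m t \<longleftrightarrow> (\<forall>s\<in>S. \<bar>s - t\<bar> < 1 / real m \<longrightarrow>
     x s = x t \<or> 1 / real m \<le> \<bar>x s - x t\<bar> * w ((y s - y t) / (x s - x t)))"

lemma content1_zero_isometric_preimage:
  fixes T :: "'a::metric_space \<Rightarrow> 'b::metric_space" and U :: "'b \<Rightarrow> 'a"
  assumes iso: "\<And>z z'. dist (U z) (U z') \<le> dist z z'" and inv: "\<And>z. z \<in> S \<Longrightarrow> U (T z) = z"
    and zero: "content1 (T ` S) = 0"
  shows "content1 S = 0"
proof -
  have "content1 S \<le> 0"
  proof (rule ennreal_le_epsilon)
    fix e :: real assume "e > 0"
    then have "content1 (T ` S) < ennreal e" using zero by simp
    then obtain C :: "nat \<Rightarrow> 'b set" where C: "T ` S \<subseteq> (\<Union>i. C i)" "\<forall>i. bounded (C i)"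
      and sum: "(\<Sum>i. ennreal (diameter (C i))) < ennreal e"
      using content1_approx by blast
    have d: "dist x y \<le> diameter (C i)" if xy: "x \<in> U ` C i" "y \<in> U ` C i" for x y i
    proof -
      obtain p q where pq: "p \<in> C i" "q \<in> C i" "x = U p" "y = U q" using xy by blast
      have "bounded (C i)" using C(2) by blast
      from diameter_bounded_bound[OF this pq(1,2)] show ?thesis
        using iso[of p q] unfolding pq(3,4) by linarith
    qed
    have "content1 S \<le> (\<Sum>i. ennreal (diameter (U ` C i)))"
    proof (rule content1_le)
      show "S \<subseteq> (\<Union>i. U ` C i)"
      proof
        fix z assume z: "z \<in> S"
        then obtain i where "T z \<in> C i" using C(1) by blast
        then have "U (T z) \<in> U ` C i" by (rule imageI)
        then show "z \<in> (\<Union>i. U ` C i)" using inv[OF z] by auto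
      qed
      show "bounded (U ` C i)" for i using d[of _ i] by (meson bounded_two_points)
    qed
    also have "\<dots> \<le> (\<Sum>i. ennreal (diameter (C i)))"
    proof (intro suminf_le ennreal_leI)
      fix i
      show "diameter (U ` C i) \<le> diameter (C i)"
      proof (cases "C i = {}")
        case False
        then show ?thesis
          unfolding diameter_def[of "U ` C i"] using d[of _ i]
          by (auto intro!: cSUP_least simp: image_iff)
      qed simp
    qed auto
    also have "\<dots> \<le> ennreal e" using sum by simp
    finally show "content1 S \<le> 0 + ennreal e" by simp
  qed
  then show ?thesis by simp
qed

context bounded_growth
begin

text \<open>The hypotheses on a graph are invariant under reflections, so each kind of singular point can be
treated on a reflected copy.\<close>

lemma content1_universal_singular:
  assumes L: "L \<in> borel_measurable borel" and L': "\<And>z. L z = \<Lambda> z + k"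
    and P: "\<And>s1 s2 \<Lambda>'. s1 \<in> {1, -1} \<Longrightarrow> s2 \<in> {1, -1} \<Longrightarrow> bounded_growth w \<Lambda>' \<Longrightarrow>
      content1 ((\<lambda>(x, y). (s1 * x, s2 * y)) ` G \<inter> right_singular \<Lambda>') = 0"
  shows "content1 (G \<inter> universal_singular_set L) = 0"
proof -
  define H where "H s1 s2 \<Lambda>' = {z \<in> G. (s1 * fst z, s2 * snd z) \<in> right_singular \<Lambda>'}" for s1 s2 :: real and \<Lambda>'
  have H0: "content1 (H s1 s2 \<Lambda>') = 0"
    if s: "s1 \<in> {1, -1}" "s2 \<in> {1, -1}" and bg: "bounded_growth w \<Lambda>'" for s1 s2 \<Lambda>'
  proof (rule content1_zero_isometric_preimage)
    let ?T = "\<lambda>z::real \<times> real. (s1 * fst z, s2 * snd z)"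
    show "dist (?T z) (?T z') \<le> dist z z'" for z z'
      using s by (cases z; cases z') (auto simp: dist_Pair_Pair dist_real_def power2_commute)
    show "?T (?T z) = z" for z using s by auto
    have "?T ` H s1 s2 \<Lambda>' \<subseteq> (\<lambda>(x, y). (s1 * x, s2 * y)) ` G \<inter> right_singular \<Lambda>'"
      by (force simp: H_def case_prod_beta)
    then show "content1 (?T ` H s1 s2 \<Lambda>') = 0" by (rule content1_zero_subset[OF P[OF s bg]])
  qed
  have bx: "bounded_growth w (reflect_x \<Lambda>)" by (rule bounded_growth_reflect_x)
  have bxy: "bounded_growth w (reflect_y (reflect_x \<Lambda>))"
    by (rule bounded_growth.bounded_growth_reflect_y[OF bx])
  have "content1 ((H 1 1 \<Lambda> \<union> H 1 (-1) (reflect_y \<Lambda>)) \<union>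
      (H (-1) 1 (reflect_x \<Lambda>) \<union> H (-1) (-1) (reflect_y (reflect_x \<Lambda>)))) = 0"
    by (intro content1_zero_Un H0 bx bxy bounded_growth_reflect_y bounded_growth_axioms) auto
  moreover have "G \<inter> universal_singular_set L \<subseteq> (H 1 1 \<Lambda> \<union> H 1 (-1) (reflect_y \<Lambda>)) \<union>
      (H (-1) 1 (reflect_x \<Lambda>) \<union> H (-1) (-1) (reflect_y (reflect_x \<Lambda>)))"
  proof
    fix z assume z: "z \<in> G \<inter> universal_singular_set L"
    obtain x0 y0 where zz: "z = (x0, y0)" by fastforce
    from universal_singular_cases[OF L L', of x0 y0] z zz
    show "z \<in> (H 1 1 \<Lambda> \<union> H 1 (-1) (reflect_y \<Lambda>)) \<union>
      (H (-1) 1 (reflect_x \<Lambda>) \<union> H (-1) (-1) (reflect_y (reflect_x \<Lambda>)))"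
      by (auto simp: H_def)
  qed
  ultimately show ?thesis by (rule content1_zero_subset)
qed

lemma content1_universal_lipschitz_graph:
  assumes L: "L \<in> borel_measurable borel" and L': "\<And>z. L z = \<Lambda> z + k"
    and G: "\<And>x y x' y'. (x, y) \<in> G \<Longrightarrow> (x', y') \<in> G \<Longrightarrow> \<bar>y' - y\<bar> \<le> R * \<bar>x' - x\<bar>"
  shows "content1 (G \<inter> universal_singular_set L) = 0"
proof (rule content1_universal_singular[OF L L'])
  fix s1 s2 :: real and \<Lambda>' assume s: "s1 \<in> {1, -1}" "s2 \<in> {1, -1}" and bg: "bounded_growth w \<Lambda>'"
  show "content1 ((\<lambda>(x, y). (s1 * x, s2 * y)) ` G \<inter> right_singular \<Lambda>') = 0"
  proof (rule bounded_growth.content1_singular_lipschitz_graph[OF bg])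
    fix x y x' y'
    assume "(x, y) \<in> (\<lambda>(x, y). (s1 * x, s2 * y)) ` G" "(x', y') \<in> (\<lambda>(x, y). (s1 * x, s2 * y)) ` G"
    then obtain p q p' q' where pq: "(p, q) \<in> G" "(p', q') \<in> G" "x = s1 * p" "y = s2 * q" "x' = s1 * p'" "y' = s2 * q'"
      by auto
    have "\<bar>y' - y\<bar> = \<bar>q' - q\<bar>" "\<bar>x' - x\<bar> = \<bar>p' - p\<bar>" using s pq by auto
    then show "\<bar>y' - y\<bar> \<le> R * \<bar>x' - x\<bar>" using G[OF pq(1,2)] by simp
  qed
qed

lemma content1_universal_steep_graph:
  assumes L: "L \<in> borel_measurable borel" and L': "\<And>z. L z = \<Lambda> z + k"
    and G: "\<And>x y x' y'. (x, y) \<in> G \<Longrightarrow> (x', y') \<in> G \<Longrightarrow> x' = x \<or> c \<le> \<bar>x' - x\<bar> * w ((y' - y) / (x' - x))"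
    and c: "c > 0"
  shows "content1 (G \<inter> universal_singular_set L) = 0"
proof (rule content1_universal_singular[OF L L'])
  fix s1 s2 :: real and \<Lambda>' assume s: "s1 \<in> {1, -1}" "s2 \<in> {1, -1}" and bg: "bounded_growth w \<Lambda>'"
  show "content1 ((\<lambda>(x, y). (s1 * x, s2 * y)) ` G \<inter> right_singular \<Lambda>') = 0"
  proof (rule bounded_growth.content1_singular_steep_graph[OF bg _ c])
    fix x y x' y'
    assume "(x, y) \<in> (\<lambda>(x, y). (s1 * x, s2 * y)) ` G" "(x', y') \<in> (\<lambda>(x, y). (s1 * x, s2 * y)) ` G"
    then obtain p q p' q' where pq: "(p, q) \<in> G" "(p', q') \<in> G" "x = s1 * p" "y = s2 * q" "x' = s1 * p'" "y' = s2 * q'"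
      by auto
    have ax: "\<bar>x' - x\<bar> = \<bar>p' - p\<bar>" and ay: "\<bar>y' - y\<bar> = \<bar>q' - q\<bar>" using s pq by auto
    have "w ((y' - y) / (x' - x)) = w \<bar>(y' - y) / (x' - x)\<bar>" by (simp only: abs_arg)
    also have "\<dots> = w \<bar>(q' - q) / (p' - p)\<bar>" unfolding abs_divide ax ay ..
    also have "\<dots> = w ((q' - q) / (p' - p))" by (simp only: abs_arg)
    finally have we: "w ((y' - y) / (x' - x)) = w ((q' - q) / (p' - p))" .
    have "x' = x \<longleftrightarrow> p' = p" using ax by auto
    then show "x' = x \<or> c \<le> \<bar>x' - x\<bar> * w ((y' - y) / (x' - x))"
      using G[OF pq(1,2)] unfolding we ax by simp
  qed
qed

text \<open>The parameters are sorted by the constant \<open>m\<close> and into short intervals. A Lipschitz piece is a graph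
over the first coordinate except at parameters \<open>t\<close> for which another parameter \<open>t'\<close> of the piece has the
same first but a different second coordinate. For \<open>s\<close> near \<open>t\<close> the Lipschitz bound at \<open>t'\<close> then fails
unless \<open>x s = x t\<close>; hence \<open>x\<close> is constant near \<open>t\<close>, and \<open>t\<close> belongs to a steep piece.\<close>

theorem content1_curve_universal_singular:
  fixes x y :: "real \<Rightarrow> real"
  assumes L: "L \<in> borel_measurable borel" and L': "\<And>z. L z = \<Lambda> z + k"
    and ac: "abs_continuous a b (\<lambda>t. (x t, y t))"
    and N: "N \<in> null_sets lebesgue"
    and alt: "\<And>t. t \<in> {a..b} \<Longrightarrow> t \<notin> N \<Longrightarrow>
      (\<exists>m>0. lipschitz_at x y {a..b} m t) \<or>
      (\<exists>m>0. steep_at w x y {a..b} m t)"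
  shows "content1 ((\<lambda>t. (x t, y t)) ` {a..b} \<inter> universal_singular_set L) = 0"
proof -
  define \<gamma> where "\<gamma> t = (x t, y t)" for t
  \<comment> \<open>Parameters in \<open>I m i\<close> are closer than \<open>1 / (2 * m)\<close>, which leaves room for a further parameter
  \<open>s\<close> near one of them.\<close>
  define I where "I m i = {t \<in> {a..b}. \<lfloor>t * (2 * real m)\<rfloor> = i}" for m :: nat and i
  define A where "A m i = {t \<in> I m i. lipschitz_at x y {a..b} m t}" for m i
  define A' where "A' m i = {t \<in> A m i. \<forall>t'\<in>A m i. x t' = x t \<longrightarrow> y t' = y t}" for m i
  define B where "B m i = {t \<in> I m i. steep_at w x y {a..b} m t}" for m i
  have close: "\<bar>s - t\<bar> < 1 / (2 * real m)" if "s \<in> I m i" "t \<in> I m i" "m > 0" for s t m i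
  proof -
    have "\<lfloor>s * (2 * real m)\<rfloor> = \<lfloor>t * (2 * real m)\<rfloor>" using that by (simp add: I_def)
    then have "\<bar>s * (2 * real m) - t * (2 * real m)\<bar> < 1" by linarith
    then have "\<bar>s - t\<bar> * (2 * real m) < 1" by (simp add: abs_mult left_diff_distrib[symmetric])
    then show ?thesis using that(3) by (simp add: field_simps)
  qed
  have close': "\<bar>s - t\<bar> < 1 / real m" if "s \<in> I m i" "t \<in> I m i" "m > 0" for s t m i
  proof -
    have "1 / (2 * real m) \<le> 1 / real m" using that(3) by (intro divide_left_mono) auto
    then show ?thesis using close[OF that] by linarith
  qed
  have zA: "content1 (\<gamma> ` A' m i \<inter> universal_singular_set L) = 0" if m: "m > 0" for m i
  proof (rule content1_universal_lipschitz_graph[OF L L', where R="real m"])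
    fix p q p' q' assume "(p, q) \<in> \<gamma> ` A' m i" "(p', q') \<in> \<gamma> ` A' m i"
    then obtain t t' where t: "t \<in> A' m i" "t' \<in> A' m i" "p = x t" "q = y t" "p' = x t'" "q' = y t'"
      by (auto simp: \<gamma>_def)
    then have tI: "t \<in> I m i" "t' \<in> I m i" unfolding A'_def A_def by blast+
    show "\<bar>q' - q\<bar> \<le> real m * \<bar>p' - p\<bar>"
    proof (cases "p' = p")
      case True
      have "t' \<in> A m i" using t(2) unfolding A'_def by blast
      moreover have "\<forall>t'\<in>A m i. x t' = x t \<longrightarrow> y t' = y t" using t(1) unfolding A'_def by blast
      moreover have "x t' = x t" using True t(3,5) by simp
      ultimately have "y t' = y t" by blast
      then show ?thesis using t(4,6) by simp
    next
      case False
      have "lipschitz_at x y {a..b} m t"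
        using t(1) unfolding A'_def A_def by blast
      moreover have "t' \<in> {a..b}" using tI(2) by (simp add: I_def)
      ultimately have "x t' = x t \<or> \<bar>y t' - y t\<bar> \<le> real m * \<bar>x t' - x t\<bar>" using close'[OF tI(2,1) m] unfolding lipschitz_at_def steep_at_def by blast
      then show ?thesis using False t(3-6) by simp
    qed
  qed
  have zB: "content1 (\<gamma> ` B m i \<inter> universal_singular_set L) = 0" if m: "m > 0" for m i
  proof (rule content1_universal_steep_graph[OF L L', where c="1 / real m"])
    fix p q p' q' assume "(p, q) \<in> \<gamma> ` B m i" "(p', q') \<in> \<gamma> ` B m i"
    then obtain t t' where t: "t \<in> B m i" "t' \<in> B m i" "p = x t" "q = y t" "p' = x t'" "q' = y t'"
      by (auto simp: \<gamma>_def)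
    then have tI: "t \<in> I m i" "t' \<in> I m i" unfolding B_def by blast+
    show "p' = p \<or> 1 / real m \<le> \<bar>p' - p\<bar> * w ((q' - q) / (p' - p))"
    proof -
      have "steep_at w x y {a..b} m t"
        using t(1) unfolding B_def by blast
      moreover have "t' \<in> {a..b}" using tI(2) by (simp add: I_def)
      ultimately have "x t' = x t \<or> 1 / real m \<le> \<bar>x t' - x t\<bar> * w ((y t' - y t) / (x t' - x t))"
        using close'[OF tI(2,1) m] unfolding lipschitz_at_def steep_at_def by blast
      then show ?thesis using t(3-6) by simp
    qed
  qed (use m in simp)
  have cont: "continuous_on {a..b} \<gamma>"
    unfolding \<gamma>_def by (rule abs_continuous_imp_continuous_on[OF ac])
  have cx: "continuous_on {a..b} x" using continuous_on_fst[OF cont] by (simp add: \<gamma>_def)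
  have cy: "continuous_on {a..b} y" using continuous_on_snd[OF cont] by (simp add: \<gamma>_def)
  have cover: "t \<in> N \<or> (\<exists>m>0. \<exists>i. t \<in> A' m i \<union> B m i)" if t: "t \<in> {a..b}" for t
  proof (cases "t \<in> N")
    case False
    from alt[OF t False] show ?thesis
    proof
      assume "\<exists>m>0. steep_at w x y {a..b} m t"
      then obtain m where "m > 0" "t \<in> B m \<lfloor>t * (2 * real m)\<rfloor>" using t unfolding B_def I_def by blast
      then show ?thesis by blast
    next
      assume "\<exists>m>0. lipschitz_at x y {a..b} m t"
      then obtain m where m: "m > 0" "t \<in> A m \<lfloor>t * (2 * real m)\<rfloor>" using t unfolding A_def I_def by blast
      define i where "i = \<lfloor>t * (2 * real m)\<rfloor>"
      show ?thesis
      proof (cases "t \<in> A' m i")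
        case True
        then show ?thesis using m by blast
      next
        case False
        then obtain t' where t': "t' \<in> A m i" "x t' = x t" "y t' \<noteq> y t"
          using m(2) unfolding A'_def i_def by blast
        have tI: "t \<in> I m i" "t' \<in> I m i" using m(2) t'(1) unfolding A_def i_def by blast+
        define g where "g s = \<bar>y s - y t'\<bar> - real m * \<bar>x s - x t'\<bar>" for s
        have "continuous_on {a..b} g" unfolding g_def by (intro continuous_intros cx cy)
        moreover have gt: "g t > 0" using t' by (simp add: g_def)
        ultimately obtain d where d: "d > 0" "\<forall>s\<in>{a..b}. dist s t < d \<longrightarrow> dist (g s) (g t) < g t"
          using t unfolding continuous_on_iff by blast
        obtain n where n: "n > 0" "1 / real n < min d (1 / (2 * real m))"
          using nat_approx_posE[of "min d (1 / (2 * real m))"] d(1) m(1)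
          by (metis min_less_iff_conj mult_pos_pos of_nat_0_less_iff zero_less_Suc zero_less_divide_1_iff zero_less_numeral)
        have "t \<in> B n \<lfloor>t * (2 * real n)\<rfloor>"
        proof -
          have "x s = x t" if s: "s \<in> {a..b}" "\<bar>s - t\<bar> < 1 / real n" for s
          proof -
            have "dist s t < d" using s n by (simp add: dist_real_def)
            then have "dist (g s) (g t) < g t" using d(2) s(1) by blast
            then have gs: "\<not> \<bar>y s - y t'\<bar> \<le> real m * \<bar>x s - x t'\<bar>" by (auto simp: dist_real_def g_def abs_if split: if_splits)
            have "\<bar>s - t\<bar> < 1 / (2 * real m)" using s n by simp
            moreover have "\<bar>t - t'\<bar> < 1 / (2 * real m)" by (rule close[OF tI m(1)])
            moreover have "1 / (2 * real m) + 1 / (2 * real m) = 1 / real m" using m(1) by (simp add: field_simps)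
            ultimately have "\<bar>s - t'\<bar> < 1 / real m" by linarith
            then have "x s = x t' \<or> \<bar>y s - y t'\<bar> \<le> real m * \<bar>x s - x t'\<bar>" using t'(1) s(1) unfolding A_def lipschitz_at_def by blast
            then show ?thesis using gs t'(2) by simp
          qed
          then show ?thesis using t by (simp add: B_def I_def steep_at_def)
        qed
        then show ?thesis using n(1) by blast
      qed
    qed
  qed simp
  have "content1 (\<gamma> ` (N \<inter> {a..b})) = 0"
  proof (rule content1_abs_continuous_null)
    show "abs_continuous a b \<gamma>" unfolding \<gamma>_def by (rule ac)
    show "N \<inter> {a..b} \<in> null_sets lebesgue" using N by (intro null_set_Int2) auto
  qed simp
  moreover have "content1 (\<Union>(m, i)\<in>{0<..} \<times> UNIV. (\<gamma> ` A' m i \<inter> universal_singular_set L) \<union> (\<gamma> ` B m i \<inter> universal_singular_set L)) = 0"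
    by (rule content1_zero_countable_UN) (auto intro!: content1_zero_Un zA zB)
  ultimately have "content1 (\<gamma> ` (N \<inter> {a..b}) \<union>
      (\<Union>(m, i)\<in>{0<..} \<times> UNIV. (\<gamma> ` A' m i \<inter> universal_singular_set L) \<union> (\<gamma> ` B m i \<inter> universal_singular_set L))) = 0"
    by (rule content1_zero_Un)
  moreover have "\<gamma> ` {a..b} \<inter> universal_singular_set L \<subseteq> \<gamma> ` (N \<inter> {a..b}) \<union>
      (\<Union>(m, i)\<in>{0<..} \<times> UNIV. (\<gamma> ` A' m i \<inter> universal_singular_set L) \<union> (\<gamma> ` B m i \<inter> universal_singular_set L))"
  proof
    fix z assume z: "z \<in> \<gamma> ` {a..b} \<inter> universal_singular_set L"
    then obtain t where t: "t \<in> {a..b}" "z = \<gamma> t" by blast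
    show "z \<in> \<gamma> ` (N \<inter> {a..b}) \<union>
      (\<Union>(m, i)\<in>{0<..} \<times> UNIV. (\<gamma> ` A' m i \<inter> universal_singular_set L) \<union> (\<gamma> ` B m i \<inter> universal_singular_set L))"
    proof (cases "t \<in> N")
      case True
      then show ?thesis using t by blast
    next
      case False
      then obtain m i where mi: "m > 0" "t \<in> A' m i \<union> B m i" using cover[OF t(1)] by blast
      then have "z \<in> (\<gamma> ` A' m i \<inter> universal_singular_set L) \<union> (\<gamma> ` B m i \<inter> universal_singular_set L)"
        using t z by blast
      then show ?thesis using mi(1) by (intro UnI2 UN_I[of "(m, i)"]) auto
    qed
  qed
  ultimately have "content1 (\<gamma> ` {a..b} \<inter> universal_singular_set L) = 0" by (rule content1_zero_subset)
  then show ?thesis by (simp add: \<gamma>_def)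
qed

end

lemma eventually_at_within_nat:
  fixes t :: real
  assumes "\<forall>\<^sub>F s in at t within S. P s" and "P t"
  shows "\<exists>m>0. \<forall>n\<ge>m. \<forall>s\<in>S. \<bar>s - t\<bar> < 1 / real n \<longrightarrow> P s"
proof -
  obtain d where d: "d > 0" "\<forall>s\<in>S. s \<noteq> t \<and> dist s t < d \<longrightarrow> P s"
    using assms(1) unfolding eventually_at by blast
  obtain m where m: "1 / real (Suc m) < d" using nat_approx_posE[OF d(1)] .
  have "P s" if "n \<ge> Suc m" "s \<in> S" "\<bar>s - t\<bar> < 1 / real n" for n s
  proof -
    have "1 / real n \<le> 1 / real (Suc m)" using that(1) by (intro divide_left_mono) auto
    then have "dist s t < d" using that(3) m by (simp add: dist_real_def)
    then show ?thesis using d(2) that(2) assms(2) by (cases "s = t") auto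
  qed
  then show ?thesis by (intro exI[of _ "Suc m"]) auto
qed

theorem theorem3p1:
  fixes \<omega> :: "real \<Rightarrow> real" and x y :: "real \<Rightarrow> real" and a b :: real
    and L :: "real \<times> real \<times> real \<Rightarrow> real"
  assumes even: "\<And>p. \<omega> (- p) = \<omega> p"
    and convex: "convex_on UNIV \<omega>"
    and superlin: "superlinear \<omega>"
    and ab: "a \<le> b"
    and curve: "abs_continuous a b (\<lambda>t. (x t, y t))"
    and alternative: "AE t in lebesgue. t \<in> {a..b} \<longrightarrow>
      Limsup (at t within {a..b})
        (\<lambda>s. if x s = x t then 0 else ereal \<bar>(y s - y t) / (x s - x t)\<bar>) < \<infinity> \<or>
      Liminf (at t within {a..b})
        (\<lambda>s. if x s = x t then \<infinity>
              else ereal (\<bar>x s - x t\<bar> * \<omega> ((y s - y t) / (x s - x t)))) > 0"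
    and lagr: "lagrangian L"
    and lower: "\<And>\<xi> \<eta> p. L (\<xi>, \<eta>, p) \<ge> \<omega> p"
  shows "linear_measure ((\<lambda>t. (x t, y t)) ` {a..b} \<inter> universal_singular_set L) = 0"
proof -
  \<comment> \<open>By symmetry and convexity \<open>\<omega> 0\<close> is the minimum of \<open>\<omega>\<close>.\<close>
  define w where "w p = \<omega> p - \<omega> 0" for p
  define \<Lambda> where "\<Lambda> z = L z - \<omega> 0" for z
  have Lm: "L \<in> borel_measurable borel" and Lb: "\<And>z. \<exists>U. open U \<and> z \<in> U \<and> bdd_above (L ` U)"
    using lagr by (auto simp: lagrangian_def)
  interpret bounded_growth w \<Lambda>
  proof
    show "convex_on UNIV w"
      using convex_on_add[OF convex, of "\<lambda>p. - \<omega> 0"] by (simp add: w_def[abs_def] convex_on_const)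
    show "w (- p) = w p" for p using even by (simp add: w_def)
    show "w 0 = 0" by (simp add: w_def)
    show "superlinear w"
      unfolding superlinear_def filterlim_at_top
    proof
      fix Z :: real
      have "\<forall>\<^sub>F p in at_infinity. Z + \<bar>\<omega> 0\<bar> \<le> \<omega> p / \<bar>p\<bar>"
        using superlin unfolding superlinear_def filterlim_at_top by blast
      moreover have "\<forall>\<^sub>F p::real in at_infinity. 1 \<le> \<bar>p\<bar>"
        unfolding eventually_at_infinity by (intro exI[of _ 1]) auto
      ultimately show "\<forall>\<^sub>F p in at_infinity. Z \<le> w p / \<bar>p\<bar>"
      proof eventually_elim
        case (elim p)
        have "\<omega> 0 / \<bar>p\<bar> \<le> \<bar>\<omega> 0\<bar> / \<bar>p\<bar>" using elim by (intro divide_right_mono) auto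
        also have "\<dots> \<le> \<bar>\<omega> 0\<bar>"
          using elim mult_left_mono[of 1 "\<bar>p\<bar>" "\<bar>\<omega> 0\<bar>"] by (simp add: divide_le_eq)
        finally show ?case using elim by (simp add: w_def diff_divide_distrib)
      qed
    qed
    show "\<Lambda> \<in> borel_measurable borel" unfolding \<Lambda>_def[abs_def] using Lm by simp
    show "w p \<le> \<Lambda> (x, y, p)" for x y p using lower[of p x y] by (simp add: w_def \<Lambda>_def)
    fix z
    obtain U where U: "open U" "z \<in> U" "bdd_above (L ` U)" using Lb[of z] by blast
    then obtain M where "\<forall>c\<in>L ` U. c \<le> M" unfolding bdd_above_def by blast
    then have "bdd_above (\<Lambda> ` U)" by (intro bdd_aboveI[of _ "M - \<omega> 0"]) (auto simp: \<Lambda>_def)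
    with U show "\<exists>U. open U \<and> z \<in> U \<and> bdd_above (\<Lambda> ` U)" by (intro exI[of _ U]) simp
  qed
  have cx: "continuous_on {a..b} x"
    using continuous_on_fst[OF abs_continuous_imp_continuous_on[OF curve]] by simp
  define Q where "Q t \<longleftrightarrow>
      Limsup (at t within {a..b})
        (\<lambda>s. if x s = x t then 0 else ereal \<bar>(y s - y t) / (x s - x t)\<bar>) < \<infinity> \<or>
      Liminf (at t within {a..b})
        (\<lambda>s. if x s = x t then \<infinity>
              else ereal (\<bar>x s - x t\<bar> * \<omega> ((y s - y t) / (x s - x t)))) > 0" for t
  have "AE t in lebesgue. t \<in> {a..b} \<longrightarrow> Q t" unfolding Q_def by (rule alternative)
  then obtain N where N: "N \<in> null_sets lebesgue" and "{t \<in> space lebesgue. \<not> (t \<in> {a..b} \<longrightarrow> Q t)} \<subseteq> N"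
    unfolding eventually_ae_filter by blast
  then have alt: "Q t" if "t \<in> {a..b}" "t \<notin> N" for t using that by auto
  have "content1 ((\<lambda>t. (x t, y t)) ` {a..b} \<inter> universal_singular_set L) = 0"
  proof (rule content1_curve_universal_singular[OF Lm _ curve N])
    show "L z = \<Lambda> z + \<omega> 0" for z by (simp add: \<Lambda>_def)
    fix t assume t: "t \<in> {a..b}" "t \<notin> N"
    from alt[OF t, unfolded Q_def] show "(\<exists>m>0. lipschitz_at x y {a..b} m t) \<or>
      (\<exists>m>0. steep_at w x y {a..b} m t)"
    proof (rule disj_forward)
      assume "Limsup (at t within {a..b})
        (\<lambda>s. if x s = x t then 0 else ereal \<bar>(y s - y t) / (x s - x t)\<bar>) < \<infinity>"
      then obtain R where R: "Limsup (at t within {a..b})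
        (\<lambda>s. if x s = x t then 0 else ereal \<bar>(y s - y t) / (x s - x t)\<bar>) < ereal R"
        using ereal_dense2 by blast
      have "\<forall>\<^sub>F s in at t within {a..b}. x s = x t \<or> \<bar>y s - y t\<bar> \<le> R * \<bar>x s - x t\<bar>"
        using Limsup_lessD[OF R]
      proof eventually_elim
        case (elim s)
        show ?case
        proof (cases "x s = x t")
          case False
          then have "\<bar>y s - y t\<bar> / \<bar>x s - x t\<bar> < R" using elim by (simp add: abs_divide)
          then have "\<bar>y s - y t\<bar> < R * \<bar>x s - x t\<bar>" using False by (simp add: pos_divide_less_eq)
          then show ?thesis by simp
        qed simp
      qed
      then obtain m where m: "m > 0" "\<forall>n\<ge>m. \<forall>s\<in>{a..b}. \<bar>s - t\<bar> < 1 / real n \<longrightarrow> x s = x t \<or> \<bar>y s - y t\<bar> \<le> R * \<bar>x s - x t\<bar>"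
        using eventually_at_within_nat[of "\<lambda>s. x s = x t \<or> \<bar>y s - y t\<bar> \<le> R * \<bar>x s - x t\<bar>" t "{a..b}"] by auto
      obtain k :: nat where k: "R \<le> real k" using real_arch_simple[of R] by blast
      define n where "n = max m k"
      have n: "n > 0" "n \<ge> m" "R \<le> real n" using m(1) k by (auto simp: n_def)
      have "x s = x t \<or> \<bar>y s - y t\<bar> \<le> real n * \<bar>x s - x t\<bar>" if "s \<in> {a..b}" "\<bar>s - t\<bar> < 1 / real n" for s
      proof -
        have "R * \<bar>x s - x t\<bar> \<le> real n * \<bar>x s - x t\<bar>" using n by (intro mult_right_mono) auto
        then show ?thesis using m(2)[rule_format, OF n(2) that] by auto
      qed
      then show "\<exists>m>0. lipschitz_at x y {a..b} m t"
        using n(1) unfolding lipschitz_at_def by blast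
    next
      assume "0 < Liminf (at t within {a..b})
        (\<lambda>s. if x s = x t then \<infinity> else ereal (\<bar>x s - x t\<bar> * \<omega> ((y s - y t) / (x s - x t))))"
      then obtain c where c: "0 < ereal c" "ereal c < Liminf (at t within {a..b})
        (\<lambda>s. if x s = x t then \<infinity> else ereal (\<bar>x s - x t\<bar> * \<omega> ((y s - y t) / (x s - x t))))"
        using ereal_dense2 by blast
      have cpos: "c > 0" using c(1) by simp
      define P where "P s \<longleftrightarrow> x s = x t \<or> c / 2 \<le> \<bar>x s - x t\<bar> * w ((y s - y t) / (x s - x t))" for s
      have "(x \<longlongrightarrow> x t) (at t within {a..b})" using cx t(1) by (simp add: continuous_on_def)
      then have "\<forall>\<^sub>F s in at t within {a..b}. dist (x s) (x t) < c / (2 * (\<bar>\<omega> 0\<bar> + 1))"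
        using cpos by (intro tendstoD) auto
      with less_LiminfD[OF c(2)] have "\<forall>\<^sub>F s in at t within {a..b}. P s"
      proof eventually_elim
        case (elim s)
        show ?case
        proof (cases "x s = x t")
          case False
          then have 1: "c < \<bar>x s - x t\<bar> * \<omega> ((y s - y t) / (x s - x t))" using elim(1) by simp
          have "\<bar>x s - x t\<bar> * \<omega> 0 \<le> \<bar>x s - x t\<bar> * (\<bar>\<omega> 0\<bar> + 1)" by (intro mult_left_mono) auto
          also have "\<dots> \<le> c / 2" using elim(2) by (simp add: dist_real_def field_simps)
          finally have "\<bar>x s - x t\<bar> * \<omega> 0 \<le> c / 2" .
          then have "c / 2 \<le> \<bar>x s - x t\<bar> * w ((y s - y t) / (x s - x t))"
            using 1 by (simp add: w_def right_diff_distrib)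
          then show ?thesis by (simp add: P_def)
        qed (simp add: P_def)
      qed
      then obtain m where m: "m > 0" "\<forall>n\<ge>m. \<forall>s\<in>{a..b}. \<bar>s - t\<bar> < 1 / real n \<longrightarrow> P s"
        using eventually_at_within_nat[of P t "{a..b}"] by (auto simp: P_def)
      obtain k :: nat where k: "1 / (c / 2) \<le> real k" using real_arch_simple[of "1 / (c / 2)"] by blast
      define n where "n = max m k"
      have n: "n > 0" "n \<ge> m" "1 / (c / 2) \<le> real n" using m(1) k by (auto simp: n_def)
      have nc: "1 / real n \<le> c / 2" using n cpos by (simp add: field_simps)
      have "x s = x t \<or> 1 / real n \<le> \<bar>x s - x t\<bar> * w ((y s - y t) / (x s - x t))"
        if "s \<in> {a..b}" "\<bar>s - t\<bar> < 1 / real n" for s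
        using m(2)[rule_format, OF n(2) that] nc by (auto simp: P_def)
      then show "\<exists>m>0. steep_at w x y {a..b} m t"
        using n(1) unfolding steep_at_def by blast
    qed
  qed
  then show ?thesis by (rule linear_measure_0)
qed

end
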